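(* Let $H=\int_\Omega^\oplus H_\omega\,d\mu(\omega)$ satisfy condition (A) (defined in the context) and let $\lambda\in\mathbb{R}$ be arbitrary. Let $P_{comp}=(P_{comp,\omega})_\omega$, where $P_{comp,\omega}$ is the orthogonal projection onto the closed subspace of $\ell^2(X(\omega))$ spanned by the compactly supported solutions $u$ of $(H_\omega-\lambda)u=0$. Then $$E_H(\{\lambda\})=P_{comp},$$ where $E_H$ is the spectral family of $H$ (equality of decomposable operators on $\mathcal{H}$, i.e. $E_{H_\omega}(\{\lambda\})=P_{comp,\omega}$ for $\mu$-almost every $\omega$).
   Context: Geometric setting. $(X,d)$ is a locally compact metric space with a countable basis of its topology. $\Gamma$ is a locally compact amenable unimodular group with a left-invariant metric $d_\Gamma$ inducing its topology such that every ball is precompact; $|A|$ denotes the Haar measure of a Borel set $A\subset\Gamma$. $\Gamma$ acts continuously by isometries on $X$ such that: (1) there is a fundamental domain $F'\subset X$ (every $x\in X$ can be written uniquely as $x=\gamma x_0$ with $\gamma\in\Gamma$, $x_0\in F'$) which is a countable union of compact sets and has compact closure $F$; (2) the map $\Phi:X\to\Gamma$, $\Phi(x)=\gamma$ whenever $x\in\gamma F'$, is a rough isometry: there are $a\ge 1$, $b\ge 0$ with $\frac1a d_\Gamma(\Phi(x),\Phi(y))-b\le d(x,y)\le a\,d_\Gamma(\Phi(x),\Phi(y))+b$ for all $x,y\in X$. Configurations. $\mathcal{D}$ is the set of all $A\subset X$ with $d(x,y)\ge 1$ for all distinct $x,y\in A$. Fix a compactification $\mathbb{C}^*$ of $\mathbb{C}$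 and let $\tilde{\mathcal{D}}=\{(A,h): A\in\mathcal{D},\ h:A\times A\to\mathbb{C}^*\}$ with the vague topology, i.e. the coarsest topology making $(A,h)\mapsto\sum_{x,y\in A}\phi(x,y,h(x,y))$ continuous for all $\phi\in C_c(X\times X\times\mathbb{C}^* )$; $\tilde{\mathcal{D}}$ is compact Hausdorff. $\Gamma$ acts on $\tilde{\mathcal D}$ by $\gamma(A,h)=(\gamma A,\gamma h)$, $(\gamma h)(x,y)=h(\gamma^{-1}x,\gamma^{-1}y)$. $\mu$ is a $\Gamma$-invariant (regular Borel) probability measure on $\tilde{\mathcal{D}}$ and $\Omega$ is its topological support. For $\omega=(A,h)$ write $X(\omega)=A$. It is assumed that $\Omega$ does not consist of the empty configuration only. Operators. $\mathcal{H}=\int_\Omega^\oplus \ell^2(X(\omega))\,d\mu(\omega)$. Each $\omega=(X(\omega),h)\in\Omega$ gives an operator $(H_\omega v)(x)=\sum_{y\in X(\omega)}H_\omega(x,y)v(y)$ with $H_\omega(x,y)=h(x,y)$, initially on finitely supported functions on $X(\omega)$. Condition (A): the $H_\omega$ extend to bounded operators on $\ell^2(X(\omega))$ with norm bounded by one constant for all $\omega\in\Omega$; $H=\int_\Omega^\oplus H_\omega\,d\mu(\omega)$ is selfadjoint on $\mathcal{H}$; $H$ has finite hopping range, i.e. there is $R<\infty$ such that $H_\omega(x,y)=0$ for all $\omega\in\Omega$ and $x,y\in X(\omega)$ with $d(x,y)\ge R$; and $H$ is equivariant with respect to a given family of functions $s_\gamma:X\to\{z\in\mathbb{C}:|z|=1\}$,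 $\gamma\in\Gamma$, i.e. $s_\gamma(x)H_{\gamma\omega}(\gamma x,\gamma y)\overline{s_\gamma(y)}=H_\omega(x,y)$ for all $\gamma\in\Gamma$, $\omega\in\Omega$, $x,y\in X(\omega)$. *)

theory Defs
  imports "HOL-Probability.Probability"
begin

section \<open>The group and its action\<close>

text \<open>
  The group is a type of class \<^class>\<open>topological_group_add\<close>: it is written additively but is not
  assumed commutative. Its metric is the one of the type, hence induces the group topology.
  All groups considered below are countable unions of compact metric balls, so a Borel measure
  that is finite on compact sets is automatically regular.
\<close>

definition haar_measure :: "'g::{topological_group_add,metric_space} measure \<Rightarrow> bool" where
  "haar_measure m \<longleftrightarrow>
     sets m = sets borel \<and>
     (\<forall>g. distr m borel (\<lambda>x. g + x) = m) \<and>
     (\<forall>K. compact K \<longrightarrow> emeasure m K < \<infinity>) \<and>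
     emeasure m UNIV \<noteq> 0"

definition unimodular :: "'g::{topological_group_add,metric_space} measure \<Rightarrow> bool" where
  "unimodular m \<longleftrightarrow> (\<forall>g. distr m borel (\<lambda>x. x + g) = m)"

text \<open>
  Amenability in the form of the Foelner condition: for all nonempty compact \<open>K\<close> and
  \<open>\<epsilon> > 0\<close> there is a compact \<open>S\<close> such that the symmetric difference of \<open>K S\<close> and \<open>S\<close> has
  Haar measure less than \<open>\<epsilon>\<close> times that of \<open>S\<close>. The strict inequality forces \<open>S\<close> to have
  positive measure.
\<close>

definition amenable :: "'g::{topological_group_add,metric_space} measure \<Rightarrow> bool" where
  "amenable m \<longleftrightarrow>
     (\<forall>K \<epsilon>. compact K \<and> K \<noteq> {} \<and> (0::real) < \<epsilon> \<longrightarrow>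
        (\<exists>S. compact S \<and>
           emeasure m (sym_diff {k + x |k x. k \<in> K \<and> x \<in> S} S) < ennreal \<epsilon> * emeasure m S))"

definition continuous_isometric_action ::
    "('g::{topological_group_add,metric_space} \<Rightarrow> 'x::metric_space \<Rightarrow> 'x) \<Rightarrow> bool" where
  "continuous_isometric_action act \<longleftrightarrow>
     (\<forall>x. act 0 x = x) \<and>
     (\<forall>g h x. act (g + h) x = act g (act h x)) \<and>
     (\<forall>g x y. dist (act g x) (act g y) = dist x y) \<and>
     continuous_on UNIV (\<lambda>(g, x). act g x)"

definition fundamental_domain :: "('g \<Rightarrow> 'x::topological_space \<Rightarrow> 'x) \<Rightarrow> 'x set \<Rightarrow> bool" where
  "fundamental_domain act F \<longleftrightarrow>
     (\<forall>x. \<exists>!(g, x0). x0 \<in> F \<and> x = act g x0) \<and>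
     (\<exists>K :: nat \<Rightarrow> 'x set. (\<forall>n. compact (K n)) \<and> F = (\<Union>n. K n)) \<and>
     compact (closure F)"

definition group_coordinate :: "('g \<Rightarrow> 'x \<Rightarrow> 'x) \<Rightarrow> 'x set \<Rightarrow> 'x \<Rightarrow> 'g" where
  "group_coordinate act F x = (THE g. x \<in> act g ` F)"

definition rough_isometry :: "real \<Rightarrow> real \<Rightarrow> ('x::metric_space \<Rightarrow> 'g::metric_space) \<Rightarrow> bool" where
  "rough_isometry a b \<Phi> \<longleftrightarrow> a \<ge> 1 \<and> b \<ge> 0 \<and>
     (\<forall>x y. 1 / a * dist (\<Phi> x) (\<Phi> y) - b \<le> dist x y \<and>
            dist x y \<le> a * dist (\<Phi> x) (\<Phi> y) + b)"

section \<open>Configurations\<close>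

definition compactification :: "('a::topological_space \<Rightarrow> 'c::t2_space) \<Rightarrow> bool" where
  "compactification \<iota> \<longleftrightarrow>
     compact (UNIV :: 'c set) \<and> embedding_map euclidean euclidean \<iota> \<and> closure (range \<iota>) = UNIV"

text \<open>
  A configuration is a pair \<open>(A, h)\<close>; a function \<open>h\<close> on \<open>A \<times> A\<close> is represented by the
  total function that is \<open>undefined\<close> outside \<open>A \<times> A\<close>.
\<close>

type_synonym ('x, 'c) conf = "'x set \<times> ('x \<times> 'x \<Rightarrow> 'c)"

definition configurations :: "('x::metric_space, 'c) conf set" where
  "configurations =
     {(A, h). (\<forall>x\<in>A. \<forall>y\<in>A. x \<noteq> y \<longrightarrow> dist x y \<ge> 1) \<and> h \<in> extensional (A \<times> A)}"

definition Cc :: "('a::topological_space \<Rightarrow> complex) set" where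
  "Cc = {\<phi>. continuous_on UNIV \<phi> \<and> compact (closure {z. \<phi> z \<noteq> 0})}"

definition vague_eval ::
    "('x \<times> 'x \<times> 'c \<Rightarrow> complex) \<Rightarrow> ('x, 'c) conf \<Rightarrow> complex" where
  "vague_eval \<phi> = (\<lambda>(A, h). \<Sum>\<^sub>\<infinity>(x, y)\<in>A \<times> A. \<phi> (x, y, h (x, y)))"

definition vague_topology :: "('x::metric_space, 'c::t2_space) conf topology" where
  "vague_topology = topology_generated_by
     {{\<omega> \<in> configurations. vague_eval \<phi> \<omega> \<in> U} |\<phi> U. \<phi> \<in> Cc \<and> open U}"

definition act_conf ::
    "('g::group_add \<Rightarrow> 'x \<Rightarrow> 'x) \<Rightarrow> 'g \<Rightarrow> ('x, 'c) conf \<Rightarrow> ('x, 'c) conf" where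
  "act_conf act g = (\<lambda>(A, h).
     (act g ` A, restrict (\<lambda>(x, y). h (act (- g) x, act (- g) y)) (act g ` A \<times> act g ` A)))"

definition regular_borel_measure :: "'a topology \<Rightarrow> 'a measure \<Rightarrow> bool" where
  "regular_borel_measure T M \<longleftrightarrow>
     space M = topspace T \<and>
     sets M = sigma_sets (topspace T) {U. openin T U} \<and>
     (\<forall>B\<in>sets M. emeasure M B = (SUP K\<in>{K. compactin T K \<and> K \<subseteq> B}. emeasure M K)) \<and>
     (\<forall>B\<in>sets M. emeasure M B = (INF U\<in>{U. openin T U \<and> B \<subseteq> U}. emeasure M U))"

definition topological_support :: "'a topology \<Rightarrow> 'a measure \<Rightarrow> 'a set" where
  "topological_support T M = {x \<in> topspace T. \<forall>U. openin T U \<and> x \<in> U \<longrightarrow> emeasure M U > 0}"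

abbreviation supp_conf :: "('x::metric_space, 'c::t2_space) conf measure \<Rightarrow> ('x, 'c) conf set" where
  "supp_conf \<mu> \<equiv> topological_support vague_topology \<mu>"

section \<open>Hilbert space notions\<close>

text \<open>
  The space of square summable functions on \<open>A\<close>, realised as functions on the ambient type that
  vanish outside \<open>A\<close>. Inner products are conjugate linear in the first argument.
\<close>

definition ell2 :: "'x set \<Rightarrow> ('x \<Rightarrow> complex) set" where
  "ell2 A = {v. (\<forall>x. x \<notin> A \<longrightarrow> v x = 0) \<and> (\<lambda>x. (cmod (v x))\<^sup>2) summable_on A}"

definition ell2_inner :: "'x set \<Rightarrow> ('x \<Rightarrow> complex) \<Rightarrow> ('x \<Rightarrow> complex) \<Rightarrow> complex" where
  "ell2_inner A u v = (\<Sum>\<^sub>\<infinity>x\<in>A. cnj (u x) * v x)"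

definition ell2_norm :: "'x set \<Rightarrow> ('x \<Rightarrow> complex) \<Rightarrow> real" where
  "ell2_norm A v = sqrt (\<Sum>\<^sub>\<infinity>x\<in>A. (cmod (v x))\<^sup>2)"

definition closed_span :: "'x set \<Rightarrow> ('x \<Rightarrow> complex) set \<Rightarrow> ('x \<Rightarrow> complex) set" where
  "closed_span A S = {v \<in> ell2 A. \<forall>\<epsilon>>0. \<exists>T c. finite T \<and> T \<subseteq> S \<and>
     ell2_norm A (\<lambda>x. v x - (\<Sum>u\<in>T. c u * u x)) < \<epsilon>}"

definition ell2_proj ::
    "'x set \<Rightarrow> ('x \<Rightarrow> complex) set \<Rightarrow> ('x \<Rightarrow> complex) \<Rightarrow> ('x \<Rightarrow> complex)" where
  "ell2_proj A U v = (THE w. w \<in> U \<and> (\<forall>u\<in>U. ell2_inner A u (\<lambda>x. v x - w x) = 0))"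

text \<open>
  The following notions are relative to a carrier \<open>V\<close> with a positive semidefinite Hermitian form
  \<open>ip\<close>, so that they apply both to \<^term>\<open>ell2 A\<close> and to the direct integral below, where vectors
  are sections identified up to null sets. Accordingly, equality of vectors is equality modulo
  the null space of \<open>ip\<close>.
\<close>

definition vec_eq :: "'v set \<Rightarrow> ('v \<Rightarrow> 'v \<Rightarrow> complex) \<Rightarrow> 'v \<Rightarrow> 'v \<Rightarrow> bool" where
  "vec_eq V ip u v \<longleftrightarrow> (\<forall>w\<in>V. ip w u = ip w v)"

text \<open>Selfadjointness of an everywhere defined operator.\<close>

definition selfadjoint_on ::
    "'v set \<Rightarrow> ('v \<Rightarrow> 'v \<Rightarrow> complex) \<Rightarrow> ('v \<Rightarrow> 'v) \<Rightarrow> bool" where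
  "selfadjoint_on V ip T \<longleftrightarrow>
     (\<forall>u\<in>V. T u \<in> V) \<and> (\<forall>u\<in>V. \<forall>v\<in>V. ip (T u) v = ip u (T v))"

definition orthogonal_projection_on ::
    "'v set \<Rightarrow> ('v \<Rightarrow> 'v \<Rightarrow> complex) \<Rightarrow> ('v \<Rightarrow> 'v) \<Rightarrow> bool" where
  "orthogonal_projection_on V ip P \<longleftrightarrow>
     selfadjoint_on V ip P \<and> (\<forall>u\<in>V. vec_eq V ip (P (P u)) (P u))"

text \<open>
  \<open>E\<close> is the spectral family (projection-valued measure on the Borel sets of the line) of the
  bounded operator \<open>T\<close>, i.e. \<open>T\<close> is the integral of \<open>t\<close> with respect to \<open>E\<close>. Linearity of each
  \<open>E B\<close> modulo null vectors follows from its symmetry.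
\<close>

definition spectral_measure ::
    "('v \<Rightarrow> 'v \<Rightarrow> complex) \<Rightarrow> (real set \<Rightarrow> 'v \<Rightarrow> 'v) \<Rightarrow> 'v \<Rightarrow> real measure" where
  "spectral_measure ip E u =
     measure_of UNIV (sets borel) (\<lambda>B. ennreal (Re (ip u (E B u))))"

definition spectral_family ::
    "'v set \<Rightarrow> ('v \<Rightarrow> 'v \<Rightarrow> complex) \<Rightarrow> ('v \<Rightarrow> 'v) \<Rightarrow> (real set \<Rightarrow> 'v \<Rightarrow> 'v) \<Rightarrow> bool" where
  "spectral_family V ip T E \<longleftrightarrow>
     (\<forall>B\<in>sets borel. orthogonal_projection_on V ip (E B)) \<and>
     (\<forall>u\<in>V. vec_eq V ip (E UNIV u) u) \<and>
     (\<forall>B\<in>sets borel. \<forall>C\<in>sets borel. \<forall>u\<in>V. vec_eq V ip (E (B \<inter> C) u) (E B (E C u))) \<and>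
     (\<forall>B :: nat \<Rightarrow> real set. range B \<subseteq> sets borel \<and> disjoint_family B \<longrightarrow>
        (\<forall>u\<in>V. \<forall>v\<in>V. (\<lambda>n. ip u (E (B n) v)) sums ip u (E (\<Union>n. B n) v))) \<and>
     (\<forall>u\<in>V. integrable (spectral_measure ip E u) (\<lambda>t. t) \<and>
        ip u (T u) = complex_of_real (\<integral>t. t \<partial>spectral_measure ip E u))"

section \<open>The direct integral\<close>

text \<open>
  The direct integral of the spaces \<open>ell2 (fst \<omega>)\<close> over the support of \<open>\<mu>\<close>: square integrable
  measurable sections, where the measurable structure is the one determined by the fundamental
  family of sections obtained by restricting \<open>\<phi> \<in> Cc\<close> to the sets \<open>fst \<omega>\<close>.
\<close>

definition sections :: "('x::metric_space, 'c::t2_space) conf measure \<Rightarrow>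
    (('x, 'c) conf \<Rightarrow> 'x \<Rightarrow> complex) set" where
  "sections \<mu> = {f.
     (\<forall>\<omega>\<in>supp_conf \<mu>. f \<omega> \<in> ell2 (fst \<omega>)) \<and>
     (\<forall>\<omega>. \<omega> \<notin> supp_conf \<mu> \<longrightarrow> f \<omega> = (\<lambda>_. 0)) \<and>
     (\<forall>\<phi>\<in>Cc. (\<lambda>\<omega>. ell2_inner (fst \<omega>) \<phi> (f \<omega>))
        \<in> borel_measurable (restrict_space \<mu> (supp_conf \<mu>))) \<and>
     integrable (restrict_space \<mu> (supp_conf \<mu>)) (\<lambda>\<omega>. (ell2_norm (fst \<omega>) (f \<omega>))\<^sup>2)}"

definition sections_inner :: "('x::metric_space, 'c::t2_space) conf measure \<Rightarrow>
    (('x, 'c) conf \<Rightarrow> 'x \<Rightarrow> complex) \<Rightarrow> (('x, 'c) conf \<Rightarrow> 'x \<Rightarrow> complex) \<Rightarrow> complex" where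
  "sections_inner \<mu> f g =
     (\<integral>\<omega>. ell2_inner (fst \<omega>) (f \<omega>) (g \<omega>) \<partial>restrict_space \<mu> (supp_conf \<mu>))"

definition direct_integral_op :: "('x::metric_space, 'c::t2_space) conf measure \<Rightarrow>
    (('x, 'c) conf \<Rightarrow> ('x \<Rightarrow> complex) \<Rightarrow> ('x \<Rightarrow> complex)) \<Rightarrow>
    (('x, 'c) conf \<Rightarrow> 'x \<Rightarrow> complex) \<Rightarrow> (('x, 'c) conf \<Rightarrow> 'x \<Rightarrow> complex)" where
  "direct_integral_op \<mu> T f = (\<lambda>\<omega>. if \<omega> \<in> supp_conf \<mu> then T \<omega> (f \<omega>) else (\<lambda>_. 0))"

section \<open>The operators\<close>

definition matrix_element :: "(complex \<Rightarrow> 'c) \<Rightarrow> ('x, 'c) conf \<Rightarrow> 'x \<Rightarrow> 'x \<Rightarrow> complex" where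
  "matrix_element \<iota> \<omega> x y = inv \<iota> (snd \<omega> (x, y))"

text \<open>
  If the operator is bounded on the finitely supported functions, then all rows of its matrix are
  square summable, and its bounded extension to \<^term>\<open>ell2 (fst \<omega>)\<close> is given by the same series.
\<close>

definition hamiltonian ::
    "(complex \<Rightarrow> 'c) \<Rightarrow> ('x, 'c) conf \<Rightarrow> ('x \<Rightarrow> complex) \<Rightarrow> ('x \<Rightarrow> complex)" where
  "hamiltonian \<iota> \<omega> v =
     (\<lambda>x. if x \<in> fst \<omega> then \<Sum>\<^sub>\<infinity>y\<in>fst \<omega>. matrix_element \<iota> \<omega> x y * v y else 0)"

text \<open>
  The first clause makes explicit that the matrix elements of the operators are complex numbers,
  i.e. that \<open>h\<close> does not take values in the boundary of the compactification.
\<close>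

definition condition_A ::
    "('g::group_add \<Rightarrow> 'x::metric_space \<Rightarrow> 'x) \<Rightarrow> ('g \<Rightarrow> 'x \<Rightarrow> complex) \<Rightarrow>
     (complex \<Rightarrow> 'c::t2_space) \<Rightarrow> ('x, 'c) conf measure \<Rightarrow> bool" where
  "condition_A act s \<iota> \<mu> \<longleftrightarrow>
     (\<forall>\<omega>\<in>supp_conf \<mu>. \<forall>x\<in>fst \<omega>. \<forall>y\<in>fst \<omega>. snd \<omega> (x, y) \<in> range \<iota>) \<and>
     (\<exists>C. \<forall>\<omega>\<in>supp_conf \<mu>. \<forall>v. finite {x. v x \<noteq> 0} \<and> {x. v x \<noteq> 0} \<subseteq> fst \<omega> \<longrightarrow>
        hamiltonian \<iota> \<omega> v \<in> ell2 (fst \<omega>) \<and>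
        ell2_norm (fst \<omega>) (hamiltonian \<iota> \<omega> v) \<le> C * ell2_norm (fst \<omega>) v) \<and>
     selfadjoint_on (sections \<mu>) (sections_inner \<mu>) (direct_integral_op \<mu> (hamiltonian \<iota>)) \<and>
     (\<exists>R. \<forall>\<omega>\<in>supp_conf \<mu>. \<forall>x\<in>fst \<omega>. \<forall>y\<in>fst \<omega>. dist x y \<ge> R \<longrightarrow> matrix_element \<iota> \<omega> x y = 0) \<and>
     (\<forall>g x. cmod (s g x) = 1) \<and>
     (\<forall>g. \<forall>\<omega>\<in>supp_conf \<mu>. \<forall>x\<in>fst \<omega>. \<forall>y\<in>fst \<omega>.
        s g x * matrix_element \<iota> (act_conf act g \<omega>) (act g x) (act g y) * cnj (s g y)
          = matrix_element \<iota> \<omega> x y)"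

definition compact_solutions ::
    "(complex \<Rightarrow> 'c) \<Rightarrow> real \<Rightarrow> ('x::topological_space, 'c) conf \<Rightarrow> ('x \<Rightarrow> complex) set" where
  "compact_solutions \<iota> lam \<omega> = {u \<in> ell2 (fst \<omega>).
     (\<exists>K. compact K \<and> {x. u x \<noteq> 0} \<subseteq> K) \<and>
     hamiltonian \<iota> \<omega> u = (\<lambda>x. complex_of_real lam * u x)}"

definition P_comp ::
    "(complex \<Rightarrow> 'c) \<Rightarrow> real \<Rightarrow> ('x::topological_space, 'c) conf \<Rightarrow> ('x \<Rightarrow> complex) \<Rightarrow> ('x \<Rightarrow> complex)"
  where "P_comp \<iota> lam \<omega> = ell2_proj (fst \<omega>) (closed_span (fst \<omega>) (compact_solutions \<iota> lam \<omega>))"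

end

theory Submission
  imports Defs
begin

text \<open>
  Write \<open>K\<^sub>\<omega>\<close> for the part of the eigenspace of \<open>H\<^sub>\<omega>\<close> at \<open>\<lambda>\<close> that is orthogonal to all compactly
  supported solutions, and \<open>Q\<^sub>\<omega>\<close> for the projection onto it; the claim is \<open>Q\<^sub>\<omega> = 0\<close> almost surely.
  If an element of \<open>K\<^sub>\<omega>\<close> vanishes on the boundary strip of a bounded set \<open>\<Lambda>\<close>, its width being twice
  the hopping range, then its restriction to \<open>\<Lambda>\<close> is a compactly supported solution and hence zero.
  Therefore the restrictions of \<open>K\<^sub>\<omega>\<close> to \<open>\<Lambda>\<close> form a space whose dimension is at most the number of
  points in the strip, and this number bounds the trace of \<open>Q\<^sub>\<omega>\<close> over \<open>\<Lambda>\<close>. Averaging over Foelner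
  sets and using the invariance of \<open>\<mu>\<close> shows that the mean density of this trace is zero.
  Measurability comes from iterating polynomials of \<open>H\<close>: for selfadjoint \<open>D\<close> and a cutoff \<open>\<theta>\<close> the
  powers of \<open>1 - (D\<^sup>2 + \<theta>) / M\<close> converge strongly to the projection onto \<open>ker D \<inter> ker \<theta>\<close>.
\<close>

section \<open>Spectral families over a semidefinite form\<close>

text \<open>The spectral family enters through its axioms alone, once on the direct integral and
  once on each fibre. Everything about \<open>E {lam}\<close> is therefore extracted from the first
  moments of the measures \<open>spectral_measure ip E u\<close>: \<open>T\<close> acts as
  \<open>lam\<close> on the range of \<open>E {lam}\<close>, and eigenvectors at \<open>lam\<close>
  are orthogonal to every \<open>f - E {lam} f\<close>. This is done once over a semidefinite form;
  sections are determined only up to null sets, so vector identities are stated by pairing with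
  every vector. Two obstacles remain. Selfadjointness is given for the direct integral only and has
  to be brought down to almost every fibre. And the trace of \<open>Q\<^sub>\<omega>\<close> can be
  averaged only if it is measurable in \<open>\<omega>\<close>, so each projection has to arise as
  an explicit limit of operations that preserve measurable sections. This is the role of the
  cutoffs: a continuous \<theta> that vanishes exactly on a ball turns the solutions supported in
  the ball into a joint kernel, and these kernels increase to the compactly supported
  solutions.\<close>

locale psd_form =
  fixes V :: "'v set"
    and lin :: "complex \<Rightarrow> 'v \<Rightarrow> complex \<Rightarrow> 'v \<Rightarrow> 'v"
    and ip :: "'v \<Rightarrow> 'v \<Rightarrow> complex"
  assumes lin_in [simp, intro]: "u \<in> V \<Longrightarrow> v \<in> V \<Longrightarrow> lin a u b v \<in> V"
    and ip_lin: "w \<in> V \<Longrightarrow> u \<in> V \<Longrightarrow> v \<in> V \<Longrightarrow> ip w (lin a u b v) = a * ip w u + b * ip w v"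
    and ip_cnj: "u \<in> V \<Longrightarrow> v \<in> V \<Longrightarrow> ip v u = cnj (ip u v)"
    and ip_nonneg: "u \<in> V \<Longrightarrow> 0 \<le> Re (ip u u)"
begin

lemma lin_ip:
  assumes "w \<in> V" "u \<in> V" "v \<in> V"
  shows "ip (lin a u b v) w = cnj a * ip u w + cnj b * ip v w"
proof -
  have "ip (lin a u b v) w = cnj (ip w (lin a u b v))" using assms by (intro ip_cnj) auto
  then show ?thesis using assms ip_cnj[of w u] ip_cnj[of w v] by (simp add: ip_lin)
qed

lemma ip_self: "u \<in> V \<Longrightarrow> ip u u = complex_of_real (Re (ip u u))"
  using ip_cnj[of u u] by (metis Reals_cnj_iff of_real_Re)

lemma ip_lin_self:
  assumes "u \<in> V" "v \<in> V"
  shows "Re (ip (lin a u b v) (lin a u b v)) =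
    (cmod a)\<^sup>2 * Re (ip u u) + (cmod b)\<^sup>2 * Re (ip v v) + 2 * Re (cnj a * b * ip u v)"
proof -
  have eq: "ip (lin a u b v) (lin a u b v) =
      (cnj a * a) * ip u u + (cnj b * b) * ip v v + (cnj a * b * ip u v + cnj (cnj a * b * ip u v))"
    using assms ip_cnj[of u v] by (simp add: ip_lin lin_ip algebra_simps)
  have "cnj c * c = complex_of_real ((cmod c)\<^sup>2)" for c
    by (metis complex_norm_square mult.commute)
  then show ?thesis unfolding eq by (simp del: of_real_power add: algebra_simps)
qed

lemma Cauchy_Schwarz:
  assumes "u \<in> V" "v \<in> V"
  shows "(cmod (ip u v))\<^sup>2 \<le> Re (ip u u) * Re (ip v v)"
proof -
  define n where "n = Re (ip v v)"
  define m where "m = Re (ip u u)"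
  define z where "z = ip u v"
  define c where "c = (cmod z)\<^sup>2"
  have quad: "0 \<le> m + t\<^sup>2 * c * n - 2 * t * c" for t :: real
  proof -
    have "0 \<le> Re (ip (lin 1 u (- of_real t * cnj z) v) (lin 1 u (- of_real t * cnj z) v))"
      using assms by (intro ip_nonneg) auto
    also have "\<dots> = m + t\<^sup>2 * c * n + 2 * Re (- of_real t * (cnj z * z))"
      using assms by (simp add: ip_lin_self n_def m_def c_def z_def norm_mult power_mult_distrib algebra_simps)
    also have "cnj z * z = of_real c"
      unfolding c_def by (metis complex_norm_square mult.commute)
    finally show ?thesis by simp
  qed
  have n0: "n \<ge> 0" "m \<ge> 0" "c \<ge> 0" using assms ip_nonneg by (auto simp: n_def m_def c_def)
  have "c \<le> m * n"
  proof (cases "n = 0")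
    case True
    show ?thesis
    proof (rule ccontr)
      assume "\<not> ?thesis"
      then have "c > 0" using True by simp
      \<comment> \<open>With \<open>n = 0\<close> this value of \<open>t\<close> turns the
        inequality into \<open>0 \<le> m - (m + 1)\<close>.\<close>
      then show False using quad[of "(m + 1) / (2 * c)"] True by simp
    qed
  next
    case False
    then have "n > 0" using n0 by simp
    then show ?thesis using quad[of "1 / n"] by (simp add: field_simps power2_eq_square)
  qed
  then show ?thesis by (simp add: c_def z_def m_def n_def)
qed

lemma ip_null:
  assumes "u \<in> V" "Re (ip u u) = 0" "v \<in> V"
  shows "ip u v = 0" "ip v u = 0"
proof -
  show "ip u v = 0" using Cauchy_Schwarz[of u v] assms by simp
  then show "ip v u = 0" using ip_cnj[of u v] assms by simp
qed

end

locale spectral_form = psd_form V lin ip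
  for V :: "'v set" and lin ip +
  fixes T :: "'v \<Rightarrow> 'v" and E :: "real set \<Rightarrow> 'v \<Rightarrow> 'v"
  assumes T: "selfadjoint_on V ip T" and E: "spectral_family V ip T E"
begin

lemma T_in [simp, intro]: "u \<in> V \<Longrightarrow> T u \<in> V"
  and T_sym: "u \<in> V \<Longrightarrow> v \<in> V \<Longrightarrow> ip (T u) v = ip u (T v)"
  using T by (auto simp: selfadjoint_on_def)

lemma E_in [simp, intro]: "B \<in> sets borel \<Longrightarrow> u \<in> V \<Longrightarrow> E B u \<in> V"
  and E_sym: "B \<in> sets borel \<Longrightarrow> u \<in> V \<Longrightarrow> v \<in> V \<Longrightarrow> ip (E B u) v = ip u (E B v)"
  and E_UNIV: "u \<in> V \<Longrightarrow> x \<in> V \<Longrightarrow> ip x (E UNIV u) = ip x u"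
  and E_Int: "B \<in> sets borel \<Longrightarrow> C \<in> sets borel \<Longrightarrow> u \<in> V \<Longrightarrow> x \<in> V \<Longrightarrow>
     ip x (E B (E C u)) = ip x (E (B \<inter> C) u)"
  and integrable_spectral: "u \<in> V \<Longrightarrow> integrable (spectral_measure ip E u) (\<lambda>t. t)"
  and T_integral: "u \<in> V \<Longrightarrow> ip u (T u) = complex_of_real (\<integral>t. t \<partial>spectral_measure ip E u)"
  using E unfolding spectral_family_def orthogonal_projection_on_def selfadjoint_on_def vec_eq_def
  by simp_all

lemma E_sums:
  fixes C :: "nat \<Rightarrow> real set"
  shows "range C \<subseteq> sets borel \<Longrightarrow> disjoint_family C \<Longrightarrow> u \<in> V \<Longrightarrow> x \<in> V \<Longrightarrow>
     (\<lambda>n. ip x (E (C n) u)) sums ip x (E (\<Union>n. C n) u)"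
  using E unfolding spectral_family_def by simp

text \<open>Linearity is not among the axioms for \<open>T\<close>. Symmetry moves \<open>T\<close>
  to the other argument, where the form itself is linear, so linearity holds after pairing.\<close>

lemma T_lin:
  assumes "x \<in> V" "u \<in> V" "v \<in> V"
  shows "ip x (T (lin a u b v)) = a * ip x (T u) + b * ip x (T v)"
  using assms by (metis T_in T_sym ip_lin lin_in)

text \<open>Countable additivity for the constant sequence of empty sets: a constant series
  converges only if its terms vanish.\<close>

lemma E_empty: "u \<in> V \<Longrightarrow> x \<in> V \<Longrightarrow> ip x (E {} u) = 0"
  using E_sums[of "\<lambda>_. {}" u x] sums_unique summable_LIMSEQ_zero[of "\<lambda>_. ip x (E {} u)"]
  by (auto simp: disjoint_family_on_def LIMSEQ_const_iff sums_iff)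

lemma E_Un:
  assumes "B \<in> sets borel" "C \<in> sets borel" "B \<inter> C = {}" "u \<in> V" "x \<in> V"
  shows "ip x (E (B \<union> C) u) = ip x (E B u) + ip x (E C u)"
proof -
  have "(\<lambda>n. ip x (E (binaryset B C n) u)) sums ip x (E (\<Union>n. binaryset B C n) u)"
    using assms by (intro E_sums) (auto simp: range_binaryset_eq disjoint_family_on_def binaryset_def)
  moreover have "(\<lambda>n. ip x (E (binaryset B C n) u)) sums (\<Sum>n<2. ip x (E (binaryset B C n) u))"
    by (rule sums_finite) (use assms in \<open>auto simp: binaryset_def E_empty\<close>)
  moreover have "(\<Sum>n<2. ip x (E (binaryset B C n) u)) = ip x (E B u) + ip x (E C u)"
    by (simp add: numeral_2_eq_2 binaryset_def)
  ultimately show ?thesis by (metis UN_binaryset_eq sums_unique2)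
qed

lemma E_nonneg: "B \<in> sets borel \<Longrightarrow> u \<in> V \<Longrightarrow> 0 \<le> Re (ip u (E B u))"
  by (metis E_Int E_in E_sym Int_absorb ip_nonneg)

lemma sets_spectral [simp]: "sets (spectral_measure ip E u) = sets borel"
  and space_spectral [simp]: "space (spectral_measure ip E u) = UNIV"
  unfolding spectral_measure_def using sets.sigma_sets_eq[of borel]
  by (simp_all add: sets_measure_of_conv space_measure_of_conv)

lemma measurable_spectral [simp]: "measurable (spectral_measure ip E u) N = measurable borel N"
  by (rule measurable_cong_sets) simp_all

text \<open>\<open>measure_of\<close> yields the zero measure unless the given set function is a
  measure, so countable additivity has to be checked before the definition of
  \<open>spectral_measure\<close> says anything.\<close>

lemma emeasure_spectral:
  assumes B: "B \<in> sets borel" and u: "u \<in> V"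
  shows "emeasure (spectral_measure ip E u) B = ennreal (Re (ip u (E B u)))"
proof (rule emeasure_measure_of[OF spectral_measure_def])
  show "positive (sets (spectral_measure ip E u)) (\<lambda>B. ennreal (Re (ip u (E B u))))"
    using E_empty u by (simp add: positive_def)
  show "countably_additive (sets (spectral_measure ip E u)) (\<lambda>B. ennreal (Re (ip u (E B u))))"
  proof (rule countably_additiveI)
    fix A :: "nat \<Rightarrow> real set"
    assume A: "range A \<subseteq> sets (spectral_measure ip E u)" "disjoint_family A"
    have "(\<lambda>n. Re (ip u (E (A n) u))) sums Re (ip u (E (\<Union>n. A n) u))"
      using E_sums[of A u u] A u by (intro sums_Re) auto
    then have "(\<lambda>n. ennreal (Re (ip u (E (A n) u)))) sums ennreal (Re (ip u (E (\<Union>n. A n) u)))"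
      using A u by (subst sums_ennreal) (auto intro!: E_nonneg)
    then show "(\<Sum>i. ennreal (Re (ip u (E (A i) u)))) = ennreal (Re (ip u (E (\<Union> (range A)) u)))"
      by (rule sums_unique[symmetric])
  qed
qed (use B in auto)

lemma finite_spectral: "u \<in> V \<Longrightarrow> finite_measure (spectral_measure ip E u)"
  by (rule finite_measureI) (simp add: emeasure_spectral)

lemma measure_spectral_UNIV: "u \<in> V \<Longrightarrow> measure (spectral_measure ip E u) UNIV = Re (ip u u)"
  by (simp add: measure_def emeasure_spectral E_UNIV ip_nonneg)

lemma spectral_measure_E:
  assumes B: "B \<in> sets borel" and u: "u \<in> V"
  shows "spectral_measure ip E (E B u) = density (spectral_measure ip E u) (indicator B)"
proof (rule measure_eqI)
  fix C assume "C \<in> sets (spectral_measure ip E (E B u))"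
  then have C: "C \<in> sets borel" by simp
  have "ip (E B u) (E C (E B u)) = ip u (E (B \<inter> C) u)"
    using B C u by (simp add: E_sym E_Int) (metis Int_commute Int_left_absorb)
  then show "emeasure (spectral_measure ip E (E B u)) C =
      emeasure (density (spectral_measure ip E u) (indicator B)) C"
    using B C u emeasure_density[of "indicator B" "spectral_measure ip E u" C]
    by (simp add: emeasure_spectral borel_measurable_indicator flip: indicator_inter_arith)
qed simp

text \<open>Projection identities such as \<open>E B (E B u) = E B u\<close> hold only modulo null
  vectors; this allows to use them inside spectral measures.\<close>

lemma spectral_measure_cong:
  assumes "u \<in> V" "v \<in> V" and eq: "\<And>x. x \<in> V \<Longrightarrow> ip x u = ip x v"
  shows "spectral_measure ip E u = spectral_measure ip E v"
proof (rule measure_eqI)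
  fix C assume "C \<in> sets (spectral_measure ip E u)"
  then have C: "C \<in> sets borel" by simp
  have "ip u (E C u) = ip (E C u) v" using C assms by (metis E_in E_sym)
  also have "\<dots> = ip u (E C v)" using C assms by (simp add: E_sym)
  also have "\<dots> = ip v (E C v)" using C assms ip_cnj[of _ u] ip_cnj[of _ v] by (metis E_in)
  finally show "emeasure (spectral_measure ip E u) C = emeasure (spectral_measure ip E v) C"
    using C assms by (simp add: emeasure_spectral)
qed simp

lemma ip_T_E:
  assumes B: "B \<in> sets borel" and u: "u \<in> V"
  shows "ip (E B u) (T (E B u)) = complex_of_real (\<integral>t. indicator B t * t \<partial>spectral_measure ip E u)"
proof -
  have "density (spectral_measure ip E u) (indicator B) =
      density (spectral_measure ip E u) (\<lambda>t. ennreal (indicator B t))"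
    by (simp add: ennreal_indicator)
  then show ?thesis
    using B u integral_density[of "\<lambda>t. t" "spectral_measure ip E u" "indicator B :: real \<Rightarrow> real"]
    by (subst T_integral) (auto simp add: spectral_measure_E)
qed

text \<open>\<open>T\<close> has no matrix elements between the ranges of \<open>E B\<close> and \<open>E (- B)\<close>: the quadratic form
  of \<open>T\<close> at \<open>z = E B u + c E (- B) v\<close> is the sum of its values at the two components.\<close>

lemma ip_E_T_E_Compl:
  assumes B: "B \<in> sets borel" and u: "u \<in> V" and v: "v \<in> V"
  shows "ip (E B u) (T (E (- B) v)) = 0"
proof -
  have B': "- B \<in> sets borel" using B by (simp add: borel_comp)
  define w where "w = E B u"
  define y where "y = E (- B) v"
  have wy: "w \<in> V" "y \<in> V" using B B' u v by (auto simp: w_def y_def)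
  \<comment> \<open>The spectral measures of \<open>E B z\<close> and \<open>E (- B) z\<close> are
    the restrictions of that of \<open>z\<close> to \<open>B\<close> and to its complement, so the
    first moments add up.\<close>
  have split: "ip z (T z) = ip (E B z) (T (E B z)) + ip (E (-B) z) (T (E (-B) z))" if z: "z \<in> V" for z
  proof -
    have int: "integrable (spectral_measure ip E z) (\<lambda>t. indicator C t * t)" if "C \<in> sets borel" for C
      using integrable_mult_indicator[OF _ integrable_spectral[OF z], of C] that by simp
    have "(\<integral>t. t \<partial>spectral_measure ip E z) =
        (\<integral>t. indicator B t * t + indicator (-B) t * t \<partial>spectral_measure ip E z)"
      by (intro Bochner_Integration.integral_cong) (auto simp: indicator_def)
    also have "\<dots> = (\<integral>t. indicator B t * t \<partial>spectral_measure ip E z) +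
        (\<integral>t. indicator (-B) t * t \<partial>spectral_measure ip E z)"
      using B B' by (intro Bochner_Integration.integral_add int)
    finally show ?thesis using ip_T_E[OF B z] ip_T_E[OF B' z] T_integral[OF z] by simp
  qed
  have T_cong': "ip p (T p) = ip q (T q)" if "p \<in> V" "q \<in> V" "\<And>x. x \<in> V \<Longrightarrow> ip x p = ip x q" for p q
    using that by (simp add: T_integral spectral_measure_cong[OF that])
  have cross: "cnj c * ip y (T w) + c * ip w (T y) = 0" for c
  proof -
    define z where "z = lin 1 w c y"
    have z: "z \<in> V" using wy by (simp add: z_def)
    have Ez: "ip x (E C z) = ip x (E C w) + c * ip x (E C y)" if "x \<in> V" "C \<in> sets borel" for x C
      using that wy unfolding z_def by (metis E_in E_sym ip_lin lin_in mult_1)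
    have "ip x (E B z) = ip x w" if "x \<in> V" for x
      using Ez[of x B] that u v B B' by (simp add: w_def y_def E_Int E_empty)
    then have 1: "ip (E B z) (T (E B z)) = ip w (T w)"
      using B z wy by (intro T_cong') auto
    have "ip x (E (-B) z) = ip x (lin 0 w c y)" if "x \<in> V" for x
      using Ez[of x "- B"] that u v B B' by (simp add: w_def y_def E_Int E_empty ip_lin)
    then have 2: "ip (E (-B) z) (T (E (-B) z)) = ip (lin 0 w c y) (T (lin 0 w c y))"
      using B' z wy by (intro T_cong') auto
    have "ip z (T z) = ip w (T w) + cnj c * c * ip y (T y) + (cnj c * ip y (T w) + c * ip w (T y))"
      using wy unfolding z_def by (simp add: T_lin lin_ip algebra_simps)
    moreover have "ip (lin 0 w c y) (T (lin 0 w c y)) = cnj c * c * ip y (T y)"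
      using wy by (simp add: T_lin lin_ip algebra_simps)
    ultimately show ?thesis using split[OF z] 1 2 by simp
  qed
  \<comment> \<open>With \<open>p = ip y (T w)\<close> and \<open>q = ip w (T y)\<close>, the value
    \<open>c = 1\<close> gives \<open>p + q = 0\<close> and the value \<open>c = \<i>\<close> gives
    \<open>p = q\<close>.\<close>
  have "ip w (T y) = 0"
    using cross[of 1] cross[of \<i>] by (simp add: complex_eq_iff)
  then show ?thesis by (simp add: w_def y_def)
qed

text \<open>On the range of \<open>E {lam}\<close> spectral measures are concentrated at
  \<open>lam\<close>, which gives the quadratic form of \<open>T\<close> there. Polarization gives
  the pairings within this range, and \<open>ip_E_T_E_Compl\<close> disposes of the component of
  \<open>x\<close> in the range of \<open>E (- {lam})\<close>.\<close>

lemma E_singleton_eigen: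
  assumes u: "u \<in> V" and x: "x \<in> V"
  shows "ip x (T (E {lam} u)) = complex_of_real lam * ip x (E {lam} u)"
proof -
  have B: "{lam} \<in> sets borel" "- {lam} \<in> sets borel" by auto
  have quad: "ip w (T w) = complex_of_real lam * ip w w" if w: "w \<in> V" "\<And>x. x \<in> V \<Longrightarrow> ip x (E {lam} w) = ip x w" for w
  proof -
    have "ip w (T w) = complex_of_real (\<integral>t. t \<partial>spectral_measure ip E w)" using w by (simp add: T_integral)
    also have "spectral_measure ip E w = density (spectral_measure ip E w) (indicator {lam})"
      using spectral_measure_cong[OF _ _ w(2)] w B by (metis E_in spectral_measure_E)
    also have "\<dots> = density (spectral_measure ip E w) (\<lambda>t. ennreal (indicator {lam} t))"
      by (simp add: ennreal_indicator)
    also have "(\<integral>t. t \<partial>\<dots>) = (\<integral>t. indicator {lam} t * t \<partial>spectral_measure ip E w)"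
      by (subst integral_density) auto
    also have "\<dots> = (\<integral>t. lam * indicator {lam} t \<partial>spectral_measure ip E w)"
      by (intro Bochner_Integration.integral_cong) (auto simp: indicator_def)
    also have "\<dots> = lam * measure (spectral_measure ip E w) {lam}"
      by (simp)
    also have "measure (spectral_measure ip E w) {lam} = Re (ip w w)"
      using w B by (simp add: measure_def emeasure_spectral ip_nonneg)
    finally show ?thesis using ip_self[OF w(1)] by simp
  qed
  define w where "w = E {lam} u"
  define y where "y = E {lam} x"
  have wy: "w \<in> V" "y \<in> V" using B u x by (auto simp: w_def y_def)
  have fix_w: "z \<in> V \<Longrightarrow> ip z (E {lam} w) = ip z w" for z
    using B u by (simp add: w_def E_Int)
  have fix_y: "z \<in> V \<Longrightarrow> ip z (E {lam} y) = ip z y" for z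
    using B x by (simp add: y_def E_Int)
  have cross: "cnj c * ip w (T y) + c * ip y (T w) = lam * (cnj c * ip w y + c * ip y w)" for c
  proof -
    have "ip (lin 1 y c w) (T (lin 1 y c w)) = lam * ip (lin 1 y c w) (lin 1 y c w)"
    proof (rule quad)
      fix x assume x: "x \<in> V"
      have "ip x (E {lam} (lin 1 y c w)) = ip (E {lam} x) (lin 1 y c w)"
        using x wy B by (intro E_sym[symmetric]) auto
      also have "\<dots> = ip x (E {lam} y) + c * ip x (E {lam} w)"
        using x wy B by (simp add: ip_lin E_sym)
      finally show "ip x (E {lam} (lin 1 y c w)) = ip x (lin 1 y c w)"
        using x wy by (simp add: ip_lin fix_w fix_y)
    qed (use wy in auto)
    moreover have "ip (lin 1 y c w) (T (lin 1 y c w)) =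
        ip y (T y) + cnj c * c * ip w (T w) + (cnj c * ip w (T y) + c * ip y (T w))"
      using wy by (simp add: T_lin lin_ip algebra_simps)
    moreover have "ip (lin 1 y c w) (lin 1 y c w) =
        ip y y + cnj c * c * ip w w + (cnj c * ip w y + c * ip y w)"
      using wy by (simp add: ip_lin lin_ip algebra_simps)
    ultimately show ?thesis using quad[OF wy(1) fix_w] quad[OF wy(2) fix_y]
      by (simp add: algebra_simps)
  qed
  have yw: "ip y (T w) = lam * ip y w"
    using cross[of 1] cross[of \<i>] by (simp add: complex_eq_iff algebra_simps)
  have UN: "ip x z = ip y z + ip (E (- {lam}) x) z" if z: "z \<in> V" for z
  proof -
    have "ip z x = ip z (E ({lam} \<union> - {lam}) x)" using z x by (simp add: E_UNIV)
    also have "\<dots> = ip z y + ip z (E (- {lam}) x)" unfolding y_def using B z x by (intro E_Un) auto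
    finally show ?thesis using z x B wy ip_cnj[of z x] ip_cnj[of z y] ip_cnj[of z "E (- {lam}) x"] by simp
  qed
  have "ip (E (- {lam}) x) (T w) = 0"
    using ip_E_T_E_Compl[of "- {lam}" x u] B u x by (simp add: w_def)
  moreover have "ip (E (- {lam}) x) w = 0"
    using B u x by (simp add: w_def E_sym E_Int E_empty)
  ultimately show ?thesis using yw UN[of "T w"] UN[of w] wy by (simp add: w_def)
qed

text \<open>Let \<open>w = E B u\<close> with \<open>B\<close> strictly on one side of
  \<open>lam\<close>. The eigenvalue equation passes to \<open>w\<close>, so \<open>t - lam\<close>
  integrates to 0 against its spectral measure although it has a strict sign on \<open>B\<close>;
  hence \<open>w\<close> is null. Treating the two half-lines separately means that only first
  moments are needed. Thus \<open>u\<close> agrees with \<open>E {lam} u\<close> modulo null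
  vectors, and symmetry of \<open>E {lam}\<close> gives the claim.\<close>

lemma E_singleton_orthogonal:
  assumes f: "f \<in> V" and u: "u \<in> V"
    and ker: "\<And>x. x \<in> V \<Longrightarrow> ip x (T u) = complex_of_real lam * ip x u"
  shows "ip u (lin 1 f (- 1) (E {lam} f)) = 0"
proof -
  have null: "ip x (E B u) = 0"
    if B: "B \<in> sets borel" and side: "(\<forall>t\<in>B. t > lam) \<or> (\<forall>t\<in>B. t < lam)" and x: "x \<in> V" for B x
  proof -
    define w where "w = E B u"
    have B': "- B \<in> sets borel" using B by (simp add: borel_comp)
    have w: "w \<in> V" using B u by (simp add: w_def)
    have split: "ip z u = ip z w + ip z (E (- B) u)" if "z \<in> V" for z
      using E_Un[of B "- B" u z] B B' u that E_UNIV[of u z] by (simp add: w_def)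
    \<comment> \<open>The eigenvalue equation for \<open>u\<close> descends to \<open>w\<close>
      because \<open>T\<close> does not couple the ranges of \<open>E B\<close> and
      \<open>E (- B)\<close>.\<close>
    have "ip w (T w) = ip (T w) u - ip (T w) (E (- B) u)"
      using split[of "T w"] w by (simp add: T_sym[symmetric])
    also have "ip (T w) (E (- B) u) = 0"
      using ip_E_T_E_Compl[OF B u u] w B' u by (simp add: w_def T_sym)
    also have "ip (T w) u = lam * ip w u" using T_sym[of w u] ker w u by simp
    also have "ip w u = ip w w"
      using split[of w] w B B' u by (simp add: w_def E_sym E_Int E_empty)
    finally have quad: "ip w (T w) = lam * ip w w" by simp
    define N where "N = spectral_measure ip E w"
    interpret N: finite_measure N unfolding N_def using w by (rule finite_spectral)
    have int: "integrable N (\<lambda>t. t)" unfolding N_def using w by (rule integrable_spectral)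
    have "(\<integral>t. t - lam \<partial>N) = (\<integral>t. t \<partial>N) - lam * measure N (space N)"
      using int by (subst Bochner_Integration.integral_diff) auto
    also have "\<dots> = 0"
      using quad T_integral[OF w] measure_spectral_UNIV[OF w] ip_self[OF w]
      by (simp add: N_def flip: of_real_mult) (metis of_real_eq_iff of_real_mult)
    finally have int0: "(\<integral>t. t - lam \<partial>N) = 0" .
    have inB: "AE t in N. t \<in> B"
    proof (rule AE_I')
      have "ip w (E (- B) w) = 0" using w B B' u by (simp add: w_def E_Int E_sym E_empty)
      then show "- B \<in> null_sets N"
        using B' w by (simp add: N_def null_sets_def emeasure_spectral)
    qed auto
    have "AE t in N. t = lam"
      using side
    proof
      assume side: "\<forall>t\<in>B. t > lam"
      have "AE t in N. t - lam = 0"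
      proof (subst integral_nonneg_eq_0_iff_AE[symmetric])
        show "AE t in N. 0 \<le> t - lam" using inB by eventually_elim (use side in force)
      qed (use int int0 in auto)
      then show ?thesis by auto
    next
      assume side: "\<forall>t\<in>B. t < lam"
      have "AE t in N. lam - t = 0"
      proof (subst integral_nonneg_eq_0_iff_AE[symmetric])
        show "AE t in N. 0 \<le> lam - t" using inB by eventually_elim (use side in force)
        show "(\<integral>t. lam - t \<partial>N) = 0"
          using int0 Bochner_Integration.integral_minus[of N "\<lambda>t. t - lam"] by simp
      qed (use int in auto)
      then show ?thesis by auto
    qed
    \<comment> \<open>The measure lives on \<open>B\<close> and at the point \<open>lam\<close>,
      which lies outside \<open>B\<close>.\<close>
    with inB have "AE t in N. False" by eventually_elim (use side in auto)
    then have "measure N (space N) = 0"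
      by (simp add: AE_iff_null null_sets_def measure_def)
    then have "Re (ip w w) = 0" using measure_spectral_UNIV[OF w] by (simp add: N_def)
    then show ?thesis using ip_null[OF w _ x] by (simp add: w_def)
  qed
  have "ip x u = ip x (E {lam} u)" if x: "x \<in> V" for x
  proof -
    have "UNIV = {..<lam} \<union> ({lam} \<union> {lam<..})" by auto
    then have "ip x u = ip x (E ({..<lam} \<union> ({lam} \<union> {lam<..})) u)"
      using E_UNIV[OF u x] by simp
    also have "\<dots> = ip x (E {..<lam} u) + (ip x (E {lam} u) + ip x (E {lam<..} u))"
      using u x by (subst E_Un; (subst E_Un)?) auto
    also have "\<dots> = ip x (E {lam} u)" using x by (simp add: null)
    finally show ?thesis .
  qed
  then have "ip u f = ip u (E {lam} f)"
    using E_sym[of "{lam}" f u] ip_cnj[of f u] ip_cnj[of "E {lam} f" u] f u by simp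
  then show ?thesis using f u by (simp add: ip_lin)
qed

end

section \<open>Square summable functions\<close>

lemma ell2_outside: "v \<in> ell2 A \<Longrightarrow> x \<notin> A \<Longrightarrow> v x = 0"
  and ell2_summable: "v \<in> ell2 A \<Longrightarrow> (\<lambda>x. (cmod (v x))\<^sup>2) summable_on A"
  by (auto simp: ell2_def)

lemma ell2_prod_summable:
  assumes "u \<in> ell2 A" "v \<in> ell2 A"
  shows "(\<lambda>x. cnj (u x) * v x) summable_on A"
proof (rule abs_summable_summable, rule summable_on_comparison_test)
  show "(\<lambda>x. (cmod (u x))\<^sup>2 + (cmod (v x))\<^sup>2) summable_on A"
    using assms by (intro summable_on_add ell2_summable)
  show "norm (cnj (u x) * v x) \<le> (cmod (u x))\<^sup>2 + (cmod (v x))\<^sup>2" for x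
    using sum_squares_bound[of "cmod (u x)" "cmod (v x)"]
      mult_nonneg_nonneg[of "cmod (u x)" "cmod (v x)"]
    unfolding norm_mult complex_mod_cnj using norm_ge_zero[of "u x"] norm_ge_zero[of "v x"] by argo
qed auto

lemma ell2_lin:
  assumes "u \<in> ell2 A" "v \<in> ell2 A"
  shows "(\<lambda>x. a * u x + b * v x) \<in> ell2 A"
proof -
  have "(\<lambda>x. (cmod (a * u x + b * v x))\<^sup>2) summable_on A"
  proof (rule summable_on_comparison_test)
    show "(\<lambda>x. 2 * (cmod a)\<^sup>2 * (cmod (u x))\<^sup>2 + 2 * (cmod b)\<^sup>2 * (cmod (v x))\<^sup>2) summable_on A"
      using assms by (intro summable_on_add summable_on_cmult_right ell2_summable)
    fix x
    have "cmod (a * u x + b * v x) \<le> cmod a * cmod (u x) + cmod b * cmod (v x)"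
      by (metis norm_mult norm_triangle_ineq)
    then have "(cmod (a * u x + b * v x))\<^sup>2 \<le> (cmod a * cmod (u x) + cmod b * cmod (v x))\<^sup>2"
      by (intro power_mono) auto
    also have "\<dots> \<le> 2 * (cmod a)\<^sup>2 * (cmod (u x))\<^sup>2 + 2 * (cmod b)\<^sup>2 * (cmod (v x))\<^sup>2"
      using sum_squares_bound[of "cmod a * cmod (u x)" "cmod b * cmod (v x)"]
      by (simp add: power2_sum power_mult_distrib)
    finally show "(cmod (a * u x + b * v x))\<^sup>2 \<le>
      2 * (cmod a)\<^sup>2 * (cmod (u x))\<^sup>2 + 2 * (cmod b)\<^sup>2 * (cmod (v x))\<^sup>2" .
  qed auto
  then show ?thesis using assms by (auto simp: ell2_def)
qed

lemma ell2_norm_nonneg [simp]: "0 \<le> ell2_norm A v"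
  by (simp add: ell2_norm_def infsum_nonneg)

lemma ell2_norm_square: "(ell2_norm A v)\<^sup>2 = (\<Sum>\<^sub>\<infinity>x\<in>A. (cmod (v x))\<^sup>2)"
  by (simp add: ell2_norm_def infsum_nonneg)

lemma ell2_inner_self:
  assumes "u \<in> ell2 A"
  shows "ell2_inner A u u = of_real ((ell2_norm A u)\<^sup>2)"
proof -
  have "((\<lambda>x. complex_of_real ((cmod (u x))\<^sup>2)) has_sum of_real ((ell2_norm A u)\<^sup>2)) A"
    using ell2_summable[OF assms] unfolding ell2_norm_square
    by (intro has_sum_of_real has_sum_infsum)
  then have "((\<lambda>x. cnj (u x) * u x) has_sum of_real ((ell2_norm A u)\<^sup>2)) A"
    by (simp add: complex_norm_square mult.commute del: of_real_power)
  then show ?thesis by (auto simp: ell2_inner_def intro: infsumI)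
qed

interpretation ell2: psd_form "ell2 A" "\<lambda>a u b v x. a * u x + b * v x" "ell2_inner A" for A
proof
  fix u v w :: "'a \<Rightarrow> complex" and a b :: complex
  assume u: "u \<in> ell2 A"
  show "0 \<le> Re (ell2_inner A u u)" using u by (simp add: ell2_inner_self)
  assume v: "v \<in> ell2 A"
  show "(\<lambda>x. a * u x + b * v x) \<in> ell2 A" using u v by (rule ell2_lin)
  show "ell2_inner A v u = cnj (ell2_inner A u v)"
    unfolding ell2_inner_def by (subst infsum_cnj[symmetric]) (simp add: mult.commute)
  assume w: "w \<in> ell2 A"
  have "ell2_inner A w (\<lambda>x. a * u x + b * v x) =
      (\<Sum>\<^sub>\<infinity>x\<in>A. a * (cnj (w x) * u x) + b * (cnj (w x) * v x))"
    unfolding ell2_inner_def by (simp add: algebra_simps)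
  also have "\<dots> = (\<Sum>\<^sub>\<infinity>x\<in>A. a * (cnj (w x) * u x)) + (\<Sum>\<^sub>\<infinity>x\<in>A. b * (cnj (w x) * v x))"
    using u v w by (intro infsum_add summable_on_cmult_right ell2_prod_summable)
  finally show "ell2_inner A w (\<lambda>x. a * u x + b * v x) = a * ell2_inner A w u + b * ell2_inner A w v"
    using u v w by (simp add: ell2_inner_def infsum_cmult_right ell2_prod_summable)
qed

declare ell2.lin_in [simp del, rule del]

lemma ell2_zero [simp, intro]: "(\<lambda>_. 0) \<in> ell2 A"
  by (simp add: ell2_def)

lemma ell2_diff [intro]: "u \<in> ell2 A \<Longrightarrow> v \<in> ell2 A \<Longrightarrow> (\<lambda>x. u x - v x) \<in> ell2 A"
  using ell2_lin[of u A v 1 "- 1"] by simp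

lemma ell2_scale [intro]: "u \<in> ell2 A \<Longrightarrow> (\<lambda>x. a * u x) \<in> ell2 A"
  using ell2_lin[of u A u a 0] by simp

lemma ell2_inner_diff_right:
  "w \<in> ell2 A \<Longrightarrow> u \<in> ell2 A \<Longrightarrow> v \<in> ell2 A \<Longrightarrow>
    ell2_inner A w (\<lambda>x. u x - v x) = ell2_inner A w u - ell2_inner A w v"
  using ell2.ip_lin[of w A u v 1 "- 1"] by simp

lemma ell2_inner_diff_left:
  "w \<in> ell2 A \<Longrightarrow> u \<in> ell2 A \<Longrightarrow> v \<in> ell2 A \<Longrightarrow>
    ell2_inner A (\<lambda>x. u x - v x) w = ell2_inner A u w - ell2_inner A v w"
  using ell2.lin_ip[of w A u v 1 "- 1"] by simp

lemma ell2_inner_scale_right: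
  "w \<in> ell2 A \<Longrightarrow> u \<in> ell2 A \<Longrightarrow> ell2_inner A w (\<lambda>x. a * u x) = a * ell2_inner A w u"
  using ell2.ip_lin[of w A u u a 0] by simp

lemma ell2_inner_Cauchy_Schwarz:
  assumes "u \<in> ell2 A" "v \<in> ell2 A"
  shows "cmod (ell2_inner A u v) \<le> ell2_norm A u * ell2_norm A v"
proof (rule power2_le_imp_le)
  show "(cmod (ell2_inner A u v))\<^sup>2 \<le> (ell2_norm A u * ell2_norm A v)\<^sup>2"
    using ell2.Cauchy_Schwarz[OF assms]
    unfolding ell2_inner_self[OF assms(1)] ell2_inner_self[OF assms(2)] Re_complex_of_real power_mult_distrib .
qed simp

lemma ell2_norm_lin_square:
  assumes "u \<in> ell2 A" "v \<in> ell2 A"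
  shows "(ell2_norm A (\<lambda>x. a * u x + b * v x))\<^sup>2 =
    (cmod a)\<^sup>2 * (ell2_norm A u)\<^sup>2 + (cmod b)\<^sup>2 * (ell2_norm A v)\<^sup>2 +
    2 * Re (cnj a * b * ell2_inner A u v)"
  using ell2.ip_lin_self[OF assms, of a b]
  unfolding ell2_inner_self[OF assms(1)] ell2_inner_self[OF assms(2)]
    ell2_inner_self[OF ell2_lin[OF assms]] Re_complex_of_real .

lemma ell2_norm_diff_square:
  assumes "u \<in> ell2 A" "v \<in> ell2 A"
  shows "(ell2_norm A (\<lambda>x. u x - v x))\<^sup>2 =
    (ell2_norm A u)\<^sup>2 + (ell2_norm A v)\<^sup>2 - 2 * Re (ell2_inner A u v)"
  using ell2_norm_lin_square[OF assms, of 1 "- 1"] by simp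

lemma ell2_norm_scale: "u \<in> ell2 A \<Longrightarrow> ell2_norm A (\<lambda>x. a * u x) = cmod a * ell2_norm A u"
  using ell2_norm_lin_square[of u A u a 0]
  by - (rule power2_eq_imp_eq, simp_all add: power_mult_distrib)

lemma ell2_norm_triangle:
  assumes "u \<in> ell2 A" "v \<in> ell2 A"
  shows "ell2_norm A (\<lambda>x. u x + v x) \<le> ell2_norm A u + ell2_norm A v"
proof (rule power2_le_imp_le)
  have "Re (ell2_inner A u v) \<le> ell2_norm A u * ell2_norm A v"
    using ell2_inner_Cauchy_Schwarz[OF assms] complex_Re_le_cmod order_trans by blast
  then show "(ell2_norm A (\<lambda>x. u x + v x))\<^sup>2 \<le> (ell2_norm A u + ell2_norm A v)\<^sup>2"
    using ell2_norm_lin_square[OF assms, of 1 1] by (simp add: power2_sum)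
qed simp

lemma ell2_norm_lin_le:
  assumes "u \<in> ell2 A" "v \<in> ell2 A"
  shows "(ell2_norm A (\<lambda>x. c * u x + d * v x))\<^sup>2 \<le>
    2 * (cmod c)\<^sup>2 * (ell2_norm A u)\<^sup>2 + 2 * (cmod d)\<^sup>2 * (ell2_norm A v)\<^sup>2"
proof -
  have "ell2_norm A (\<lambda>x. c * u x + d * v x) \<le> cmod c * ell2_norm A u + cmod d * ell2_norm A v"
    using ell2_norm_triangle[OF ell2_scale[OF assms(1)] ell2_scale[OF assms(2)]] assms
    by (simp add: ell2_norm_scale)
  then have "(ell2_norm A (\<lambda>x. c * u x + d * v x))\<^sup>2 \<le> (cmod c * ell2_norm A u + cmod d * ell2_norm A v)\<^sup>2"
    by (intro power_mono) auto
  also have "\<dots> \<le> 2 * (cmod c)\<^sup>2 * (ell2_norm A u)\<^sup>2 + 2 * (cmod d)\<^sup>2 * (ell2_norm A v)\<^sup>2"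
    using sum_squares_bound[of "cmod c * ell2_norm A u" "cmod d * ell2_norm A v"]
    by (simp add: power2_sum power_mult_distrib)
  finally show ?thesis .
qed

lemma ell2_norm_minus_commute: "ell2_norm A (\<lambda>x. u x - v x) = ell2_norm A (\<lambda>x. v x - u x)"
  by (simp add: ell2_norm_def norm_minus_commute)

lemma ell2_sum_le_norm:
  assumes "u \<in> ell2 A" "finite F" "F \<subseteq> A"
  shows "(\<Sum>x\<in>F. (cmod (u x))\<^sup>2) \<le> (ell2_norm A u)\<^sup>2"
  unfolding ell2_norm_square using assms by (intro finite_sum_le_infsum ell2_summable) auto

lemma ell2_cmod_le_norm:
  assumes "u \<in> ell2 A"
  shows "cmod (u x) \<le> ell2_norm A u"
proof (cases "x \<in> A")
  case True
  then show ?thesis using ell2_sum_le_norm[of u A "{x}"] assms by - (rule power2_le_imp_le, auto)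
qed (use ell2_outside[OF assms] in auto)

lemma ell2_norm_eq_0D: "u \<in> ell2 A \<Longrightarrow> ell2_norm A u = 0 \<Longrightarrow> u x = 0"
  using ell2_cmod_le_norm[of u A x] by simp

lemma ell2I_bounded:
  assumes "\<And>x. x \<notin> A \<Longrightarrow> u x = 0" "c \<ge> 0"
    and bound: "\<And>F. finite F \<Longrightarrow> F \<subseteq> A \<Longrightarrow> (\<Sum>x\<in>F. (cmod (u x))\<^sup>2) \<le> c\<^sup>2"
  shows "u \<in> ell2 A" "ell2_norm A u \<le> c"
proof -
  have "(\<lambda>x. (cmod (u x))\<^sup>2) summable_on A"
    using bound by (intro nonneg_bdd_above_summable_on) (auto intro!: bdd_aboveI)
  then show "u \<in> ell2 A" using assms by (simp add: ell2_def)
  then show "ell2_norm A u \<le> c"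
    using \<open>c \<ge> 0\<close> bound ell2_summable
    by - (rule power2_le_imp_le, auto simp: ell2_norm_square intro!: infsum_le_finite_sums)
qed

lemma ell2_sum:
  assumes "finite T" "\<And>t. t \<in> T \<Longrightarrow> f t \<in> ell2 A"
  shows "(\<lambda>x. \<Sum>t\<in>T. c t * f t x) \<in> ell2 A"
  using assms
proof (induction T rule: finite_induct)
  case (insert t T)
  then show ?case using ell2_lin[of "f t" A "\<lambda>x. \<Sum>t\<in>T. c t * f t x" "c t" 1] by simp
qed simp

lemma ell2_inner_sum_left:
  assumes "finite T" "\<And>t. t \<in> T \<Longrightarrow> f t \<in> ell2 A" "d \<in> ell2 A"
  shows "ell2_inner A (\<lambda>x. \<Sum>t\<in>T. c t * f t x) d = (\<Sum>t\<in>T. cnj (c t) * ell2_inner A (f t) d)"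
  using assms
proof (induction T rule: finite_induct)
  case (insert t T)
  then show ?case
    using ell2.lin_ip[of d A "f t" "\<lambda>x. \<Sum>t\<in>T. c t * f t x" "c t" 1] by (simp add: ell2_sum)
qed (simp add: ell2_inner_def)

definition delta :: "'x \<Rightarrow> 'x \<Rightarrow> complex" where
  "delta x = (\<lambda>y. if y = x then 1 else 0)"

lemma ell2_finite_support:
  assumes "\<And>x. x \<notin> F \<Longrightarrow> u x = 0" "finite F" "F \<subseteq> A"
  shows "u \<in> ell2 A"
proof -
  have "(\<lambda>x. (cmod (u x))\<^sup>2) summable_on A"
    using assms by (intro finite_nonzero_values_imp_summable_on) (auto intro: finite_subset[of _ F])
  then show ?thesis using assms by (auto simp: ell2_def)
qed

lemma delta_in [simp, intro]: "x \<in> A \<Longrightarrow> delta x \<in> ell2 A"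
  by (rule ell2_finite_support[of "{x}"]) (auto simp: delta_def)

lemma ell2_inner_delta:
  assumes "x \<in> A"
  shows "ell2_inner A (delta x) v = v x"
proof -
  have "ell2_inner A (delta x) v = (\<Sum>\<^sub>\<infinity>y\<in>{x}. cnj (delta x y) * v y)"
    unfolding ell2_inner_def using assms by (intro infsum_cong_neutral) (auto simp: delta_def)
  then show ?thesis by (simp add: delta_def)
qed

lemma ell2_eqI:
  assumes "u \<in> ell2 A" "v \<in> ell2 A" "\<And>w. w \<in> ell2 A \<Longrightarrow> ell2_inner A w u = ell2_inner A w v"
  shows "u = v"
proof
  fix x
  show "u x = v x"
    using assms(3)[of "delta x"] ell2_outside[OF assms(1), of x] ell2_outside[OF assms(2), of x]
    by (cases "x \<in> A") (auto simp: ell2_inner_delta)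
qed

subsection \<open>Completeness\<close>

text \<open>The limit is given as an explicit pointwise \<open>lim\<close>. Norm convergence follows
  because the bound on each finite partial sum survives the pointwise limit in
  \<open>m\<close>.\<close>

lemma ell2_complete:
  assumes f: "\<And>n::nat. f n \<in> ell2 A"
    and Cauchy: "\<And>e. e > 0 \<Longrightarrow> \<exists>N. \<forall>m\<ge>N. \<forall>n\<ge>N. ell2_norm A (\<lambda>x. f m x - f n x) \<le> e"
  defines "w \<equiv> \<lambda>x. lim (\<lambda>n. f n x)"
  shows "w \<in> ell2 A" "(\<lambda>n. ell2_norm A (\<lambda>x. f n x - w x)) \<longlonglongrightarrow> 0" "(\<lambda>n. f n x) \<longlonglongrightarrow> w x"
proof -
  have lim: "(\<lambda>n. f n x) \<longlonglongrightarrow> w x" for x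
  proof -
    have "Cauchy (\<lambda>n. f n x)"
    proof (rule metric_CauchyI)
      fix e :: real assume "e > 0"
      then obtain N where N: "\<forall>m\<ge>N. \<forall>n\<ge>N. ell2_norm A (\<lambda>x. f m x - f n x) \<le> e / 2"
        using Cauchy[of "e / 2"] by auto
      have "dist (f m x) (f n x) < e" if "m \<ge> N" "n \<ge> N" for m n
      proof -
        have "dist (f m x) (f n x) \<le> ell2_norm A (\<lambda>x. f m x - f n x)"
          using ell2_cmod_le_norm[OF ell2_diff[OF f[of m] f[of n]], of x] by (simp add: dist_norm)
        also have "\<dots> \<le> e / 2" using N that by blast
        finally show ?thesis using \<open>e > 0\<close> by simp
      qed
      then show "\<exists>M. \<forall>m\<ge>M. \<forall>n\<ge>M. dist (f m x) (f n x) < e" by blast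
    qed
    then show ?thesis by (simp add: Cauchy_convergent_iff convergent_LIMSEQ_iff w_def)
  qed
  then show "(\<lambda>n. f n x) \<longlonglongrightarrow> w x" .
  have close: "\<exists>N. \<forall>n\<ge>N. (\<lambda>x. f n x - w x) \<in> ell2 A \<and> ell2_norm A (\<lambda>x. f n x - w x) \<le> e"
    if "e > 0" for e
  proof -
    obtain N where N: "\<forall>m\<ge>N. \<forall>n\<ge>N. ell2_norm A (\<lambda>x. f m x - f n x) \<le> e"
      using Cauchy[OF \<open>e > 0\<close>] by auto
    have "(\<lambda>x. f n x - w x) \<in> ell2 A \<and> ell2_norm A (\<lambda>x. f n x - w x) \<le> e" if n: "n \<ge> N" for n
    proof -
      have "(\<Sum>x\<in>F. (cmod (f n x - w x))\<^sup>2) \<le> e\<^sup>2" if F: "finite F" "F \<subseteq> A" for F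
      proof (rule LIMSEQ_le_const2)
        show "(\<lambda>m. \<Sum>x\<in>F. (cmod (f n x - f m x))\<^sup>2) \<longlonglongrightarrow> (\<Sum>x\<in>F. (cmod (f n x - w x))\<^sup>2)"
          by (intro tendsto_intros lim)
        have "(\<Sum>x\<in>F. (cmod (f n x - f m x))\<^sup>2) \<le> e\<^sup>2" if "m \<ge> N" for m
        proof -
          have "(\<Sum>x\<in>F. (cmod (f n x - f m x))\<^sup>2) \<le> (ell2_norm A (\<lambda>x. f n x - f m x))\<^sup>2"
            using ell2_sum_le_norm[OF ell2_diff[OF f f] F] .
          also have "\<dots> \<le> e\<^sup>2" using N n that by (intro power_mono) auto
          finally show ?thesis .
        qed
        then show "\<exists>N. \<forall>m\<ge>N. (\<Sum>x\<in>F. (cmod (f n x - f m x))\<^sup>2) \<le> e\<^sup>2" by blast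
      qed
      moreover have "f n x - w x = 0" if "x \<notin> A" for x
        using ell2_outside[OF f that] lim[of x] by (simp add: LIMSEQ_const_iff)
      ultimately show ?thesis
        using ell2I_bounded[of A "\<lambda>x. f n x - w x" e] \<open>e > 0\<close> by auto
    qed
    then show ?thesis by blast
  qed
  obtain N where "(\<lambda>x. f N x - w x) \<in> ell2 A" using close[of 1] by auto
  from ell2_diff[OF f[of N] this] show "w \<in> ell2 A" by simp
  show "(\<lambda>n. ell2_norm A (\<lambda>x. f n x - w x)) \<longlonglongrightarrow> 0"
  proof (rule LIMSEQ_I)
    fix r :: real assume "r > 0"
    then obtain N where N: "\<And>n. n \<ge> N \<Longrightarrow> ell2_norm A (\<lambda>x. f n x - w x) \<le> r / 2"
      using close[of "r / 2"] by auto
    have "ell2_norm A (\<lambda>x. f n x - w x) < r" if "n \<ge> N" for n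
      using N[OF that] \<open>r > 0\<close> by linarith
    then show "\<exists>N. \<forall>n\<ge>N. norm (ell2_norm A (\<lambda>x. f n x - w x) - 0) < r"
      by auto
  qed
qed

lemma ell2_inner_tendsto:
  assumes u: "u \<in> ell2 A" and f: "\<And>n. f n \<in> ell2 A" and w: "w \<in> ell2 A"
    and lim: "(\<lambda>n. ell2_norm A (\<lambda>x. f n x - w x)) \<longlonglongrightarrow> 0"
  shows "(\<lambda>n. ell2_inner A u (f n)) \<longlonglongrightarrow> ell2_inner A u w"
proof -
  have "(\<lambda>n. ell2_inner A u (f n) - ell2_inner A u w) \<longlonglongrightarrow> 0"
  proof (rule Lim_null_comparison)
    show "(\<lambda>n. ell2_norm A u * ell2_norm A (\<lambda>x. f n x - w x)) \<longlonglongrightarrow> 0"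
      using tendsto_mult_right_zero[OF lim] by simp
    show "\<forall>\<^sub>F n in sequentially. cmod (ell2_inner A u (f n) - ell2_inner A u w)
        \<le> ell2_norm A u * ell2_norm A (\<lambda>x. f n x - w x)"
      using ell2_inner_Cauchy_Schwarz[OF u ell2_diff[OF f w]]
      by (simp add: ell2_inner_diff_right[OF u f w])
  qed
  then show ?thesis by (simp add: LIM_zero_iff)
qed

lemma ell2_limit_unique:
  assumes f: "\<And>n. f n \<in> ell2 A" and v: "v \<in> ell2 A" and w: "w \<in> ell2 A"
    and "(\<lambda>n. ell2_norm A (\<lambda>x. f n x - v x)) \<longlonglongrightarrow> 0" "(\<lambda>n. ell2_norm A (\<lambda>x. f n x - w x)) \<longlonglongrightarrow> 0"
  shows "v = w"
  using assms by (intro ell2_eqI[of _ A]) (auto intro: LIMSEQ_unique[OF ell2_inner_tendsto ell2_inner_tendsto])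

subsection \<open>Orthogonal projections\<close>

text \<open>Uniqueness holds for any set \<open>U\<close>: two candidates are tested against
  \<open>w\<close> and \<open>w'\<close> themselves, which already makes their difference orthogonal
  to itself.\<close>

lemma ell2_projI:
  assumes U: "U \<subseteq> ell2 A" and v: "v \<in> ell2 A" and w: "w \<in> U"
    and orth: "\<And>u. u \<in> U \<Longrightarrow> ell2_inner A u (\<lambda>x. v x - w x) = 0"
  shows "ell2_proj A U v = w"
  unfolding ell2_proj_def
proof (rule the_equality)
  fix w' assume w': "w' \<in> U \<and> (\<forall>u\<in>U. ell2_inner A u (\<lambda>x. v x - w' x) = 0)"
  have in2: "w \<in> ell2 A" "w' \<in> ell2 A" using U w w' by auto
  have "ell2_inner A u w = ell2_inner A u w'" if "u \<in> U" for u
  proof -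
    have "u \<in> ell2 A" using that U by auto
    moreover have "ell2_inner A u (\<lambda>x. v x - w' x) = 0" using w' that by blast
    ultimately show ?thesis using orth[OF that] in2 v by (simp add: ell2_inner_diff_right)
  qed
  from this[OF w] this[of w'] have "ell2_inner A (\<lambda>x. w' x - w x) (\<lambda>x. w' x - w x) = 0"
    using w' in2 by (simp add: ell2_inner_diff_right ell2_inner_diff_left ell2_diff)
  then have "ell2_norm A (\<lambda>x. w' x - w x) = 0"
    using in2 by (simp add: ell2_inner_self ell2_diff)
  then show "w' = w" using ell2_norm_eq_0D[OF ell2_diff[OF in2(2,1)]] by auto
qed (use w orth in auto)

text \<open>Stands in for closedness of the subspace: it is what makes the description in
  \<open>ell2_proj\<close> meaningful. Each instance below comes with a concrete formula or limit
  for the projection, which measurability requires anyway.\<close>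

definition ell2_has_proj :: "'x set \<Rightarrow> ('x \<Rightarrow> complex) set \<Rightarrow> bool" where
  "ell2_has_proj A U \<longleftrightarrow> U \<subseteq> ell2 A \<and>
     (\<forall>v\<in>ell2 A. \<exists>w\<in>U. \<forall>u\<in>U. ell2_inner A u (\<lambda>x. v x - w x) = 0)"

lemma ell2_has_projI:
  assumes "U \<subseteq> ell2 A" "\<And>v. v \<in> ell2 A \<Longrightarrow> p v \<in> U"
    and "\<And>v u. v \<in> ell2 A \<Longrightarrow> u \<in> U \<Longrightarrow> ell2_inner A u (\<lambda>x. v x - p v x) = 0"
  shows "ell2_has_proj A U"
  unfolding ell2_has_proj_def
proof (intro conjI ballI)
  show "\<exists>w\<in>U. \<forall>u\<in>U. ell2_inner A u (\<lambda>x. v x - w x) = 0" if "v \<in> ell2 A" for v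
    by (rule bexI[of _ "p v"]) (simp_all add: assms that)
qed (rule assms(1))

lemma ell2_proj:
  assumes "ell2_has_proj A U" "v \<in> ell2 A"
  shows "ell2_proj A U v \<in> U" "u \<in> U \<Longrightarrow> ell2_inner A u (\<lambda>x. v x - ell2_proj A U v x) = 0"
proof -
  obtain w where w: "w \<in> U" "\<forall>u\<in>U. ell2_inner A u (\<lambda>x. v x - w x) = 0"
    using assms by (auto simp: ell2_has_proj_def)
  then have "ell2_proj A U v = w" using assms by (intro ell2_projI) (auto simp: ell2_has_proj_def)
  then show "ell2_proj A U v \<in> U" "u \<in> U \<Longrightarrow> ell2_inner A u (\<lambda>x. v x - ell2_proj A U v x) = 0"
    using w by auto
qed

lemma ell2_proj_in: "ell2_has_proj A U \<Longrightarrow> v \<in> ell2 A \<Longrightarrow> ell2_proj A U v \<in> ell2 A"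
  using ell2_proj(1) by (auto simp: ell2_has_proj_def)

lemma ell2_inner_proj:
  assumes "ell2_has_proj A U" "v \<in> ell2 A" "u \<in> U"
  shows "ell2_inner A u (ell2_proj A U v) = ell2_inner A u v"
proof -
  have "u \<in> ell2 A" using assms by (auto simp: ell2_has_proj_def)
  then show ?thesis
    using ell2_proj(2)[OF assms] ell2_proj_in[OF assms(1,2)] assms(2)
    by (simp add: ell2_inner_diff_right)
qed

lemma ell2_proj_id: "ell2_has_proj A U \<Longrightarrow> u \<in> U \<Longrightarrow> ell2_proj A U u = u"
  by (rule ell2_projI) (auto simp: ell2_has_proj_def ell2_inner_def)

lemma ell2_proj_sym:
  assumes "ell2_has_proj A U" "u \<in> ell2 A" "v \<in> ell2 A"
  shows "ell2_inner A (ell2_proj A U u) v = ell2_inner A u (ell2_proj A U v)"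
  using assms ell2_inner_proj[OF assms(1,3) ell2_proj(1)[OF assms(1,2)]]
    ell2_inner_proj[OF assms(1,2) ell2_proj(1)[OF assms(1,3)]]
    ell2.ip_cnj[of u A "ell2_proj A U v"] ell2.ip_cnj[of "ell2_proj A U u" A "ell2_proj A U v"]
  by (metis complex_cnj_cnj ell2_proj_in)

lemma ell2_norm_proj:
  assumes "ell2_has_proj A U" "v \<in> ell2 A"
  shows "ell2_inner A v (ell2_proj A U v) = of_real ((ell2_norm A (ell2_proj A U v))\<^sup>2)"
    "ell2_norm A (ell2_proj A U v) \<le> ell2_norm A v"
    "(ell2_norm A (\<lambda>x. v x - ell2_proj A U v x))\<^sup>2 = (ell2_norm A v)\<^sup>2 - (ell2_norm A (ell2_proj A U v))\<^sup>2"
proof -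
  let ?p = "ell2_proj A U v"
  have p: "?p \<in> ell2 A" using assms by (rule ell2_proj_in)
  have "ell2_inner A ?p v = ell2_inner A ?p ?p"
    using ell2_inner_proj[OF assms ell2_proj(1)[OF assms]] by simp
  then show eq: "ell2_inner A v ?p = of_real ((ell2_norm A ?p)\<^sup>2)"
    using ell2.ip_cnj[of ?p A v] p assms by (simp add: ell2_inner_self)
  then show pyth: "(ell2_norm A (\<lambda>x. v x - ?p x))\<^sup>2 = (ell2_norm A v)\<^sup>2 - (ell2_norm A ?p)\<^sup>2"
    using p assms by (simp add: ell2_norm_diff_square)
  have "(ell2_norm A ?p)\<^sup>2 \<le> (ell2_norm A v)\<^sup>2"
    using pyth zero_le_power2[of "ell2_norm A (\<lambda>x. v x - ?p x)"] by linarith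
  then show "ell2_norm A ?p \<le> ell2_norm A v" by (rule power2_le_imp_le) simp
qed

lemma ell2_proj_scale:
  assumes proj: "ell2_has_proj A U" and U: "\<And>u. u \<in> U \<Longrightarrow> (\<lambda>x. c * u x) \<in> U" and v: "v \<in> ell2 A"
  shows "ell2_proj A U (\<lambda>x. c * v x) = (\<lambda>x. c * ell2_proj A U v x)"
proof (rule ell2_projI)
  show "U \<subseteq> ell2 A" using proj by (simp add: ell2_has_proj_def)
  show "(\<lambda>x. c * v x) \<in> ell2 A" using v by (rule ell2_scale)
  show "(\<lambda>x. c * ell2_proj A U v x) \<in> U" using U ell2_proj(1)[OF proj v] .
  fix u assume u: "u \<in> U"
  then have u2: "u \<in> ell2 A" using proj by (auto simp: ell2_has_proj_def)
  have "(\<lambda>x. c * v x - c * ell2_proj A U v x) = (\<lambda>x. c * (v x - ell2_proj A U v x))"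
    by (simp add: algebra_simps)
  then show "ell2_inner A u (\<lambda>x. c * v x - c * ell2_proj A U v x) = 0"
    using ell2_inner_scale_right[OF u2 ell2_diff[OF v ell2_proj_in[OF proj v]], of c] ell2_proj(2)[OF proj v u]
    by simp
qed

section \<open>Even powers of symmetric contractions\<close>

locale sym_contraction =
  fixes A :: "'x set" and V :: "('x \<Rightarrow> complex) \<Rightarrow> 'x \<Rightarrow> complex"
  assumes V_in: "u \<in> ell2 A \<Longrightarrow> V u \<in> ell2 A"
    and V_diff: "u \<in> ell2 A \<Longrightarrow> v \<in> ell2 A \<Longrightarrow> V (\<lambda>x. u x - v x) = (\<lambda>x. V u x - V v x)"
    and V_sym: "u \<in> ell2 A \<Longrightarrow> v \<in> ell2 A \<Longrightarrow> ell2_inner A (V u) v = ell2_inner A u (V v)"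
    and V_norm: "u \<in> ell2 A \<Longrightarrow> ell2_norm A (V u) \<le> ell2_norm A u"
begin

lemma V_pow_in: "u \<in> ell2 A \<Longrightarrow> (V ^^ k) u \<in> ell2 A"
  by (induction k) (auto simp: V_in)

lemma V_pow_sym:
  "u \<in> ell2 A \<Longrightarrow> v \<in> ell2 A \<Longrightarrow> ell2_inner A ((V ^^ k) u) v = ell2_inner A u ((V ^^ k) v)"
proof (induction k arbitrary: v)
  case (Suc k)
  then show ?case by (simp add: V_sym V_pow_in V_in) (simp add: funpow_swap1)
qed simp

text \<open>\<open>\<parallel>V\<^sup>2\<^sup>m u - V\<^sup>2\<^sup>n u\<parallel>\<^sup>2\<close> is a second difference of the decreasing sequence \<open>\<parallel>V\<^sup>k u\<parallel>\<^sup>2\<close>.\<close>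

lemma V_pow_Cauchy:
  assumes u: "u \<in> ell2 A" and e: "e > 0"
  shows "\<exists>N. \<forall>m\<ge>N. \<forall>n\<ge>N. ell2_norm A (\<lambda>x. (V ^^ (2 * m)) u x - (V ^^ (2 * n)) u x) \<le> e"
proof -
  define b where "b k = (ell2_norm A ((V ^^ k) u))\<^sup>2" for k
  have "decseq b"
    unfolding decseq_Suc_iff b_def using u by (auto intro!: power_mono V_norm V_pow_in)
  moreover have "0 \<le> b k" for k by (simp add: b_def)
  ultimately have "convergent b"
    by (metis Bseq_monoseq_convergent decseq_imp_monoseq decseq_bounded)
  then have "Cauchy b" by (rule convergent_Cauchy)
  \<comment> \<open>The second difference splits into two differences of values of \<open>b\<close>,
    each of which may use up half of \<open>e\<^sup>2\<close>.\<close>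
  then obtain N where N: "\<And>m n. m \<ge> N \<Longrightarrow> n \<ge> N \<Longrightarrow> dist (b m) (b n) < e\<^sup>2 / 2"
    using e unfolding Cauchy_def by (metis half_gt_zero zero_less_power)
  have "ell2_norm A (\<lambda>x. (V ^^ (2 * m)) u x - (V ^^ (2 * n)) u x) \<le> e" if "m \<ge> N" "n \<ge> N" for m n
  proof (rule power2_le_imp_le)
    have "(V ^^ (2 * m)) ((V ^^ (2 * n)) u) = (V ^^ (2 * m + 2 * n)) u" by (simp add: funpow_add)
    also have "2 * m + 2 * n = (m + n) + (m + n)" by simp
    also have "(V ^^ \<dots>) u = (V ^^ (m + n)) ((V ^^ (m + n)) u)" by (subst funpow_add) simp
    finally have "ell2_inner A ((V ^^ (2 * m)) u) ((V ^^ (2 * n)) u) =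
        ell2_inner A u ((V ^^ (m + n)) ((V ^^ (m + n)) u))"
      using u by (simp add: V_pow_sym V_pow_in)
    also have "\<dots> = of_real (b (m + n))"
      using V_pow_sym[OF u V_pow_in[OF u], of "m + n" "m + n"] ell2_inner_self[OF V_pow_in[OF u], of "m + n"]
      by (simp add: b_def)
    finally have "(ell2_norm A (\<lambda>x. (V ^^ (2 * m)) u x - (V ^^ (2 * n)) u x))\<^sup>2 =
        b (2 * m) + b (2 * n) - 2 * b (m + n)"
      using u by (simp add: ell2_norm_diff_square V_pow_in b_def)
    also have "\<dots> \<le> e\<^sup>2"
      using N[of "2 * m" "m + n"] N[of "2 * n" "m + n"] that by (simp add: dist_real_def abs_if split: if_splits)
    finally show "(ell2_norm A (\<lambda>x. (V ^^ (2 * m)) u x - (V ^^ (2 * n)) u x))\<^sup>2 \<le> e\<^sup>2" .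
  qed (use e in simp)
  then show ?thesis by blast
qed

text \<open>Even powers, since an eigenvalue -1 of \<open>V\<close> would make the sequence of all
  powers oscillate.\<close>

definition V_lim :: "('x \<Rightarrow> complex) \<Rightarrow> 'x \<Rightarrow> complex" where
  "V_lim u = (\<lambda>x. lim (\<lambda>k. (V ^^ (2 * k)) u x))"

lemma V_lim:
  assumes u: "u \<in> ell2 A"
  shows "V_lim u \<in> ell2 A"
    and "(\<lambda>k. ell2_norm A (\<lambda>x. (V ^^ (2 * k)) u x - V_lim u x)) \<longlonglongrightarrow> 0"
  using ell2_complete[of "\<lambda>k. (V ^^ (2 * k)) u" A, OF V_pow_in[OF u] V_pow_Cauchy[OF u]]
  by (auto simp: V_lim_def)

lemma V_V_lim:
  assumes u: "u \<in> ell2 A"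
  shows "V (V (V_lim u)) = V_lim u"
proof (rule ell2_limit_unique[of "\<lambda>k. (V ^^ (2 * Suc k)) u"])
  note w = V_lim[OF u]
  show "(V ^^ (2 * Suc k)) u \<in> ell2 A" for k using u by (rule V_pow_in)
  show "V_lim u \<in> ell2 A" "V (V (V_lim u)) \<in> ell2 A" using w by (auto intro!: V_in)
  show "(\<lambda>k. ell2_norm A (\<lambda>x. (V ^^ (2 * Suc k)) u x - V_lim u x)) \<longlonglongrightarrow> 0"
    using LIMSEQ_Suc[OF w(2)] .
  show "(\<lambda>k. ell2_norm A (\<lambda>x. (V ^^ (2 * Suc k)) u x - V (V (V_lim u)) x)) \<longlonglongrightarrow> 0"
  proof (rule tendsto_sandwich[OF _ _ tendsto_const w(2)])
    show "\<forall>\<^sub>F k in sequentially. ell2_norm A (\<lambda>x. (V ^^ (2 * Suc k)) u x - V (V (V_lim u)) x)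
        \<le> ell2_norm A (\<lambda>x. (V ^^ (2 * k)) u x - V_lim u x)"
    proof (rule always_eventually, rule allI)
      fix k
      let ?d = "\<lambda>x. (V ^^ (2 * k)) u x - V_lim u x"
      have d: "?d \<in> ell2 A" using V_pow_in[OF u] w(1) by (rule ell2_diff)
      have "(\<lambda>x. (V ^^ (2 * Suc k)) u x - V (V (V_lim u)) x) = V (V ?d)"
        using V_pow_in[OF u, of "2 * k"] w(1) by (simp add: V_diff V_in)
      then show "ell2_norm A (\<lambda>x. (V ^^ (2 * Suc k)) u x - V (V (V_lim u)) x) \<le> ell2_norm A ?d"
        using V_norm[OF V_in[OF d]] V_norm[OF d] by simp
    qed
  qed auto
qed

lemma V_lim_orth:
  assumes u: "u \<in> ell2 A" and z: "z \<in> ell2 A" "V z = z"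
  shows "ell2_inner A z (\<lambda>x. u x - V_lim u x) = 0"
proof -
  have "(V ^^ k) z = z" for k using z by (induction k) auto
  then have "ell2_inner A z ((V ^^ (2 * k)) u) = ell2_inner A z u" for k
    using V_pow_sym[OF z(1) u, of "2 * k"] by simp
  moreover have "(\<lambda>k. ell2_inner A z ((V ^^ (2 * k)) u)) \<longlonglongrightarrow> ell2_inner A z (V_lim u)"
    using V_lim[OF u] V_pow_in[OF u] z(1) by (intro ell2_inner_tendsto)
  ultimately have "ell2_inner A z u = ell2_inner A z (V_lim u)"
    by (simp add: LIMSEQ_const_iff)
  then show ?thesis using u z V_lim(1)[OF u] by (simp add: ell2_inner_diff_right)
qed

end

section \<open>Kernels of selfadjoint operators\<close>

locale ell2_selfadjoint =
  fixes A :: "'x set" and D :: "('x \<Rightarrow> complex) \<Rightarrow> 'x \<Rightarrow> complex" and L :: real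
  assumes D_in: "u \<in> ell2 A \<Longrightarrow> D u \<in> ell2 A"
    and D_sym: "u \<in> ell2 A \<Longrightarrow> v \<in> ell2 A \<Longrightarrow> ell2_inner A (D u) v = ell2_inner A u (D v)"
    and D_norm: "u \<in> ell2 A \<Longrightarrow> (ell2_norm A (D u))\<^sup>2 \<le> L * (ell2_norm A u)\<^sup>2"
    and L: "0 \<le> L"
begin

text \<open>An everywhere defined symmetric map is linear, because the inner product separates
  points.\<close>

lemma D_lin:
  assumes "u \<in> ell2 A" "v \<in> ell2 A"
  shows "D (\<lambda>x. a * u x + b * v x) = (\<lambda>x. a * D u x + b * D v x)"
proof (rule ell2_eqI)
  fix w assume w: "w \<in> ell2 A"
  have "ell2_inner A w (D (\<lambda>x. a * u x + b * v x)) = ell2_inner A (D w) (\<lambda>x. a * u x + b * v x)"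
    using w assms by (simp add: D_sym ell2_lin)
  also have "\<dots> = ell2_inner A w (\<lambda>x. a * D u x + b * D v x)"
    using w assms by (simp add: ell2.ip_lin D_in D_sym)
  finally show "ell2_inner A w (D (\<lambda>x. a * u x + b * v x)) =
      ell2_inner A w (\<lambda>x. a * D u x + b * D v x)" .
qed (use assms in \<open>auto intro!: D_in ell2_lin\<close>)

lemma D_diff: "u \<in> ell2 A \<Longrightarrow> v \<in> ell2 A \<Longrightarrow> D (\<lambda>x. u x - v x) = (\<lambda>x. D u x - D v x)"
  using D_lin[of u v 1 "- 1"] by simp

text \<open>\<open>L\<close> bounds the square of \<open>D\<close> and 1 bounds the cutoff; the
  factor 2 comes from estimating the square of a sum. With this divisor \<open>M\<close> the
  operator \<open>T = D\<^sup>2 + \<theta>\<close> satisfies \<open>\<parallel>T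
  u\<parallel>\<^sup>2 \<le> M * \<langle>u, T u\<rangle>\<close>, which makes
  \<open>1 - T / M\<close> a contraction.\<close>

definition damping :: "('x \<Rightarrow> real) \<Rightarrow> ('x \<Rightarrow> complex) \<Rightarrow> 'x \<Rightarrow> complex" where
  "damping \<theta> u = (\<lambda>x. u x - (D (D u) x + of_real (\<theta> x) * u x) / of_real (2 * (L + 1)))"

definition ker :: "('x \<Rightarrow> real) \<Rightarrow> ('x \<Rightarrow> complex) set" where
  "ker \<theta> = {u \<in> ell2 A. D u = (\<lambda>_. 0) \<and> (\<forall>x. \<theta> x \<noteq> 0 \<longrightarrow> u x = 0)}"

context
  fixes \<theta> :: "'x \<Rightarrow> real"
  assumes \<theta>: "\<And>x. 0 \<le> \<theta> x" "\<And>x. \<theta> x \<le> 1"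
begin

lemma theta_in: "u \<in> ell2 A \<Longrightarrow> (\<lambda>x. of_real (\<theta> x) * u x) \<in> ell2 A"
  and theta_norm: "u \<in> ell2 A \<Longrightarrow>
    (ell2_norm A (\<lambda>x. of_real (\<theta> x) * u x))\<^sup>2 \<le> Re (ell2_inner A u (\<lambda>x. of_real (\<theta> x) * u x))"
proof -
  assume u: "u \<in> ell2 A"
  have "(\<lambda>x. (cmod (of_real (\<theta> x) * u x))\<^sup>2) summable_on A"
    using ell2_summable[OF u]
  proof (rule summable_on_comparison_test)
    show "(cmod (of_real (\<theta> x) * u x))\<^sup>2 \<le> (cmod (u x))\<^sup>2" for x
      using \<theta>[of x] by (intro power_mono) (auto simp: norm_mult mult_left_le_one_le)
  qed auto
  then show in2: "(\<lambda>x. of_real (\<theta> x) * u x) \<in> ell2 A" using u by (auto simp: ell2_def)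
  have "Re (ell2_inner A u (\<lambda>x. of_real (\<theta> x) * u x)) = (\<Sum>\<^sub>\<infinity>x\<in>A. Re (cnj (u x) * (of_real (\<theta> x) * u x)))"
    unfolding ell2_inner_def using u in2 by (intro infsum_Re[symmetric] ell2_prod_summable)
  moreover have "(\<lambda>x. Re (cnj (u x) * (of_real (\<theta> x) * u x))) summable_on A"
    using ell2_prod_summable[OF u in2] by (rule summable_on_Re)
  moreover have "(cmod (of_real (\<theta> x) * u x))\<^sup>2 \<le> Re (cnj (u x) * (of_real (\<theta> x) * u x))" for x
  proof -
    have "(cmod (of_real (\<theta> x) * u x))\<^sup>2 = \<theta> x * (\<theta> x * (cmod (u x))\<^sup>2)"
      by (simp add: norm_mult power_mult_distrib power2_eq_square)
    also have "\<dots> \<le> \<theta> x * (cmod (u x))\<^sup>2" using \<theta>[of x] by (intro mult_left_le_one_le) auto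
    also have "\<dots> = Re (cnj (u x) * (of_real (\<theta> x) * u x))"
      unfolding cmod_power2 by (simp add: power2_eq_square algebra_simps)
    finally show ?thesis .
  qed
  ultimately show "(ell2_norm A (\<lambda>x. of_real (\<theta> x) * u x))\<^sup>2 \<le> Re (ell2_inner A u (\<lambda>x. of_real (\<theta> x) * u x))"
    unfolding ell2_norm_square using ell2_summable[OF in2] by (simp add: infsum_mono)
qed

lemma theta_sym:
  "ell2_inner A (\<lambda>x. of_real (\<theta> x) * u x) v = ell2_inner A u (\<lambda>x. of_real (\<theta> x) * v x)"
  by (simp add: ell2_inner_def algebra_simps)

text \<open>Contractivity with an explicit loss. The loss dominates both \<open>D u\<close> and the
  cutoff of \<open>u\<close>, so a vector that keeps its norm lies in
  \<open>ker \<theta>\<close>.\<close>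

lemma damping_norm:
  assumes u: "u \<in> ell2 A"
  shows "(ell2_norm A (damping \<theta> u))\<^sup>2 \<le> (ell2_norm A u)\<^sup>2 - ((ell2_norm A (D u))\<^sup>2 +
    Re (ell2_inner A u (\<lambda>x. of_real (\<theta> x) * u x))) / (2 * (L + 1))"
proof -
  define M where "M = 2 * (L + 1)"
  have M: "M > 0" using L by (simp add: M_def)
  define t where "t = (\<lambda>x. of_real (\<theta> x) * u x)"
  define T where "T = (\<lambda>x. D (D u) x + t x)"
  define q where "q = (ell2_norm A (D u))\<^sup>2 + Re (ell2_inner A u t)"
  have t: "t \<in> ell2 A" using theta_in[OF u] by (simp add: t_def)
  have DD: "D (D u) \<in> ell2 A" using u by (intro D_in)
  have T: "T \<in> ell2 A" using ell2_lin[OF DD t, of 1 1] by (simp add: T_def)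
  have "ell2_inner A u T = ell2_inner A u (D (D u)) + ell2_inner A u t"
    using ell2.ip_lin[OF u DD t, of 1 1] by (simp add: T_def)
  also have "ell2_inner A u (D (D u)) = of_real ((ell2_norm A (D u))\<^sup>2)"
    using u by (simp add: D_sym[symmetric] D_in ell2_inner_self)
  finally have uT: "Re (ell2_inner A u T) = q" by (simp add: q_def)
  have "(ell2_norm A T)\<^sup>2 \<le> (ell2_norm A (D (D u)) + ell2_norm A t)\<^sup>2"
    unfolding T_def using DD t by (intro power_mono ell2_norm_triangle) auto
  also have "\<dots> \<le> 2 * ((ell2_norm A (D (D u)))\<^sup>2 + (ell2_norm A t)\<^sup>2)"
    using sum_squares_bound[of "ell2_norm A (D (D u))" "ell2_norm A t"] by (simp add: power2_sum)
  also have "(ell2_norm A (D (D u)))\<^sup>2 \<le> (L + 1) * (ell2_norm A (D u))\<^sup>2"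
    using D_norm[OF D_in[OF u]] by (rule order_trans) (intro mult_right_mono, auto)
  also have "(ell2_norm A t)\<^sup>2 \<le> (L + 1) * Re (ell2_inner A u t)"
  proof -
    have "(ell2_norm A t)\<^sup>2 \<le> Re (ell2_inner A u t)" using theta_norm[OF u] by (simp add: t_def)
    moreover from this have "0 \<le> Re (ell2_inner A u t)" by (rule order_trans[rotated]) simp
    then have "1 * Re (ell2_inner A u t) \<le> (L + 1) * Re (ell2_inner A u t)"
      using L by (intro mult_right_mono) auto
    ultimately show ?thesis by simp
  qed
  finally have TT: "(ell2_norm A T)\<^sup>2 \<le> M * q" by (simp add: M_def q_def algebra_simps)
  have "damping \<theta> u = (\<lambda>x. 1 * u x + of_real (- 1 / M) * T x)"
    by (simp add: damping_def T_def t_def M_def divide_simps)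
  then have "(ell2_norm A (damping \<theta> u))\<^sup>2 =
      (ell2_norm A u)\<^sup>2 + (ell2_norm A T)\<^sup>2 / M\<^sup>2 - 2 * q / M"
    using ell2_norm_lin_square[OF u T, of 1 "of_real (- 1 / M)"] uT M
    by (simp add: norm_divide power_divide del: of_real_divide)
  also have "(ell2_norm A T)\<^sup>2 / M\<^sup>2 \<le> M * q / M\<^sup>2" using TT by (intro divide_right_mono) auto
  also have "M * q / M\<^sup>2 = q / M" using M by (simp add: power2_eq_square)
  finally have "(ell2_norm A (damping \<theta> u))\<^sup>2 \<le> (ell2_norm A u)\<^sup>2 - q / M" by simp
  then show ?thesis unfolding M_def q_def t_def .
qed

interpretation damp: sym_contraction A "damping \<theta>"
proof
  fix u v assume u: "u \<in> ell2 A"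
  define T where "T w = (\<lambda>x. 1 * D (D w) x + 1 * (of_real (\<theta> x) * w x))" for w
  have form: "damping \<theta> w = (\<lambda>x. 1 * w x + of_real (- 1 / (2 * (L + 1))) * T w x)" for w
    by (simp add: damping_def T_def divide_simps)
  have T: "w \<in> ell2 A \<Longrightarrow> T w \<in> ell2 A" for w
    unfolding T_def by (intro ell2_lin D_in theta_in)
  show in2: "damping \<theta> u \<in> ell2 A" unfolding form using u by (intro ell2_lin T)
  show "ell2_norm A (damping \<theta> u) \<le> ell2_norm A u"
  proof (rule power2_le_imp_le)
    have "0 \<le> Re (ell2_inner A u (\<lambda>x. of_real (\<theta> x) * u x))"
      using theta_norm[OF u] by (rule order_trans[rotated]) simp
    then have "0 \<le> ((ell2_norm A (D u))\<^sup>2 +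
      Re (ell2_inner A u (\<lambda>x. of_real (\<theta> x) * u x))) / (2 * (L + 1))" using L by simp
    then show "(ell2_norm A (damping \<theta> u))\<^sup>2 \<le> (ell2_norm A u)\<^sup>2" using damping_norm[OF u] by linarith
  qed simp
  assume v: "v \<in> ell2 A"
  show "damping \<theta> (\<lambda>x. u x - v x) = (\<lambda>x. damping \<theta> u x - damping \<theta> v x)"
    using u v by (simp add: damping_def D_diff D_in algebra_simps diff_divide_distrib add_divide_distrib)
  have "ell2_inner A (T u) v = cnj 1 * ell2_inner A (D (D u)) v + cnj 1 * ell2_inner A (\<lambda>x. of_real (\<theta> x) * u x) v"
    unfolding T_def using u v by (intro ell2.lin_ip D_in theta_in)
  also have "\<dots> = 1 * ell2_inner A u (D (D v)) + 1 * ell2_inner A u (\<lambda>x. of_real (\<theta> x) * v x)"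
    using u v by (simp add: D_sym D_in theta_sym)
  also have "\<dots> = ell2_inner A u (T v)"
    unfolding T_def using u v by (intro ell2.ip_lin[symmetric] D_in theta_in)
  finally have T_sym: "ell2_inner A (T u) v = ell2_inner A u (T v)" .
  show "ell2_inner A (damping \<theta> u) v = ell2_inner A u (damping \<theta> v)"
    unfolding form ell2.ip_lin[OF u v T[OF v]] ell2.lin_ip[OF v u T[OF u]] T_sym
      complex_cnj_complex_of_real complex_cnj_one ..
qed

text \<open>Elements of \<open>ker \<theta>\<close> are fixed by the damping. Conversely the limit
  \<open>w\<close> of the even powers is fixed by two damping steps, so neither step may lose norm,
  and \<open>damping_norm\<close> puts \<open>w\<close> into the kernel.\<close>

lemma ker_has_proj: "ell2_has_proj A (ker \<theta>)"
  and damping_tendsto: "u \<in> ell2 A \<Longrightarrow>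
    (\<lambda>k. ell2_norm A (\<lambda>x. (damping \<theta> ^^ (2 * k)) u x - ell2_proj A (ker \<theta>) u x)) \<longlonglongrightarrow> 0"
proof -
  have orth: "ell2_inner A z (\<lambda>x. u x - damp.V_lim u x) = 0" if "u \<in> ell2 A" "z \<in> ker \<theta>" for u z
  proof (rule damp.V_lim_orth)
    have "D (\<lambda>x. 0) = (\<lambda>x. 0)" using D_lin[of "\<lambda>_. 0" "\<lambda>_. 0" 0 0] by simp
    moreover have "complex_of_real (\<theta> x) * z x = 0" for x using that by (cases "\<theta> x = 0") (auto simp: ker_def)
    ultimately have "damping \<theta> z x = z x" for x
      using that unfolding damping_def ker_def by simp
    then show "damping \<theta> z = z" ..
  qed (use that in \<open>auto simp: ker_def\<close>)
  have mem: "damp.V_lim u \<in> ker \<theta>" if u: "u \<in> ell2 A" for u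
  proof -
    define w where "w = damp.V_lim u"
    have w: "w \<in> ell2 A" using damp.V_lim(1)[OF u] by (simp add: w_def)
    define t where "t = (\<lambda>x. of_real (\<theta> x) * w x)"
    have t: "t \<in> ell2 A" using theta_in[OF w] by (simp add: t_def)
    have "ell2_norm A w \<le> ell2_norm A (damping \<theta> w)"
      using damp.V_norm[OF damp.V_in[OF w]] damp.V_V_lim[OF u] by (simp add: w_def)
    then have "(ell2_norm A w)\<^sup>2 \<le> (ell2_norm A (damping \<theta> w))\<^sup>2" by (intro power_mono) auto
    then have "((ell2_norm A (D w))\<^sup>2 + Re (ell2_inner A w t)) / (2 * (L + 1)) \<le> 0"
      using damping_norm[OF w] unfolding t_def by linarith
    then have le: "(ell2_norm A (D w))\<^sup>2 + Re (ell2_inner A w t) \<le> 0"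
      using L by (simp add: divide_le_0_iff)
    have tn: "(ell2_norm A t)\<^sup>2 \<le> Re (ell2_inner A w t)" using theta_norm[OF w] by (simp add: t_def)
    have "(ell2_norm A (D w))\<^sup>2 \<le> 0" "(ell2_norm A t)\<^sup>2 \<le> 0"
      using le tn zero_le_power2[of "ell2_norm A t"] zero_le_power2[of "ell2_norm A (D w)"] by linarith+
    then have "ell2_norm A (D w) = 0" "ell2_norm A t = 0" by auto
    then have "D w x = 0" "t x = 0" for x
      using ell2_norm_eq_0D[OF D_in[OF w]] ell2_norm_eq_0D[OF t] by auto
    then show ?thesis using w unfolding ker_def w_def[symmetric] by (auto simp: t_def)
  qed
  have sub: "ker \<theta> \<subseteq> ell2 A" by (auto simp: ker_def)
  show "ell2_has_proj A (ker \<theta>)" unfolding ell2_has_proj_def using sub mem orth by blast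
  assume u: "u \<in> ell2 A"
  have "ell2_proj A (ker \<theta>) u = damp.V_lim u"
    using sub u mem[OF u] orth[OF u] by (rule ell2_projI)
  then show "(\<lambda>k. ell2_norm A (\<lambda>x. (damping \<theta> ^^ (2 * k)) u x - ell2_proj A (ker \<theta>) u x)) \<longlonglongrightarrow> 0"
    using damp.V_lim(2)[OF u] by simp
qed

end

end

section \<open>Projections onto increasing unions\<close>

text \<open>By Pythagoras the squared distance between two of the projections is the difference of
  their squared norms. These increase and are bounded by that of \<open>v\<close>, so the
  projections form a Cauchy sequence.\<close>

lemma ell2_proj_chain_limit:
  fixes U :: "nat \<Rightarrow> ('x \<Rightarrow> complex) set"
  assumes proj: "\<And>n. ell2_has_proj A (U n)" and mono: "\<And>m n. m \<le> n \<Longrightarrow> U m \<subseteq> U n" and v: "v \<in> ell2 A"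
  defines "w \<equiv> \<lambda>x. lim (\<lambda>n. ell2_proj A (U n) v x)"
  shows "w \<in> ell2 A" "(\<lambda>n. ell2_norm A (\<lambda>x. ell2_proj A (U n) v x - w x)) \<longlonglongrightarrow> 0"
    "\<And>n u. u \<in> U n \<Longrightarrow> ell2_inner A u (\<lambda>x. v x - w x) = 0"
proof -
  define p where "p n = ell2_proj A (U n) v" for n
  have p: "p n \<in> ell2 A" "p n \<in> U n" for n
    using ell2_proj_in[OF proj v] ell2_proj(1)[OF proj v] by (auto simp: p_def)
  have diff: "(ell2_norm A (\<lambda>x. p n x - p m x))\<^sup>2 = (ell2_norm A (p n))\<^sup>2 - (ell2_norm A (p m))\<^sup>2"
    if "m \<le> n" for m n
  proof -
    have pm: "p m \<in> U n" using p(2)[of m] mono[OF that] by blast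
    have "ell2_inner A (p m) (p n) = ell2_inner A (p m) (p m)"
      using ell2_inner_proj[OF proj v pm] ell2_inner_proj[OF proj v p(2)[of m]] by (simp add: p_def)
    then have "ell2_inner A (p m) (p n) = of_real ((ell2_norm A (p m))\<^sup>2)"
      using p by (simp add: ell2_inner_self)
    then have "Re (ell2_inner A (p n) (p m)) = (ell2_norm A (p m))\<^sup>2"
      using ell2.ip_cnj[OF p(1)[of m] p(1)[of n]] by simp
    then show ?thesis using p by (simp add: ell2_norm_diff_square)
  qed
  define b where "b n = (ell2_norm A (p n))\<^sup>2" for n
  have "incseq b"
  proof (rule incseq_SucI)
    show "b n \<le> b (Suc n)" for n
      using diff[of n "Suc n"] zero_le_power2[of "ell2_norm A (\<lambda>x. p (Suc n) x - p n x)"] by (simp add: b_def)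
  qed
  moreover have "b n \<le> (ell2_norm A v)\<^sup>2" for n
    using ell2_norm_proj(2)[OF proj v] by (auto simp: b_def p_def intro!: power_mono)
  ultimately have "convergent b"
    by (meson incseq_convergent convergent_def)
  then have "Cauchy b" by (rule convergent_Cauchy)
  have Cau: "\<exists>N. \<forall>m\<ge>N. \<forall>n\<ge>N. ell2_norm A (\<lambda>x. p m x - p n x) \<le> e" if "e > 0" for e
  proof -
    obtain N where N: "\<And>m n. m \<ge> N \<Longrightarrow> n \<ge> N \<Longrightarrow> dist (b m) (b n) < e\<^sup>2"
      using \<open>Cauchy b\<close> \<open>e > 0\<close> unfolding Cauchy_def by (metis zero_less_power)
    have "ell2_norm A (\<lambda>x. p m x - p n x) \<le> e" if "m \<ge> N" "n \<ge> N" for m n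
    proof (rule power2_le_imp_le)
      show "(ell2_norm A (\<lambda>x. p m x - p n x))\<^sup>2 \<le> e\<^sup>2"
      proof (cases "m \<le> n")
        case True
        then show ?thesis using diff[OF True] N[OF that] ell2_norm_minus_commute[of A "p m" "p n"]
          by (simp add: b_def dist_real_def)
      next
        case False
        then show ?thesis using diff[of n m] N[OF that] by (simp add: b_def dist_real_def)
      qed
    qed (use \<open>e > 0\<close> in simp)
    then show ?thesis by blast
  qed
  have weq: "w = (\<lambda>x. lim (\<lambda>n. p n x))" by (simp add: w_def p_def)
  show w: "w \<in> ell2 A" unfolding weq by (rule ell2_complete(1)[OF p(1) Cau])
  have lim: "(\<lambda>n. ell2_norm A (\<lambda>x. p n x - w x)) \<longlonglongrightarrow> 0"
    unfolding weq by (rule ell2_complete(2)[OF p(1) Cau])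
  then show "(\<lambda>n. ell2_norm A (\<lambda>x. ell2_proj A (U n) v x - w x)) \<longlonglongrightarrow> 0" unfolding p_def .
  show "ell2_inner A u (\<lambda>x. v x - w x) = 0" if u: "u \<in> U n" for u n
  proof -
    have u2: "u \<in> ell2 A" using u proj by (auto simp: ell2_has_proj_def)
    have "ell2_inner A u (p m) = ell2_inner A u v" if "m \<ge> n" for m
      using ell2_inner_proj[OF proj v, of u m] mono[OF that] u by (auto simp: p_def)
    then have "(\<lambda>m. ell2_inner A u (p m)) \<longlonglongrightarrow> ell2_inner A u v"
      by (intro tendsto_eventually eventually_sequentiallyI)
    moreover have "(\<lambda>m. ell2_inner A u (p m)) \<longlonglongrightarrow> ell2_inner A u w"
      using u2 p(1) w lim by (intro ell2_inner_tendsto)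
    ultimately have "ell2_inner A u v = ell2_inner A u w" by (rule LIMSEQ_unique)
    then show ?thesis using u2 v w by (simp add: ell2_inner_diff_right)
  qed
qed

section \<open>The dimension estimate\<close>

lemma delta_proj_diag:
  assumes "ell2_has_proj A K" "x \<in> A"
  shows "ell2_proj A K (delta x) x = of_real ((ell2_norm A (ell2_proj A K (delta x)))\<^sup>2)"
  using ell2_norm_proj(1)[OF assms(1) delta_in[OF assms(2)]] ell2_inner_delta[OF assms(2)] by simp

text \<open>The left hand side is the trace of the compression of the projection to \<open>\<Lambda>\<close>. Each point of
  \<open>B\<close> allows to split off a one-dimensional summand from \<open>K\<close>, namely the orthogonal complement of
  the elements of \<open>K\<close> that vanish at this point.\<close>

lemma trace_le_card:
  assumes "finite B" "B \<subseteq> A" "finite \<Lambda>" "\<Lambda> \<subseteq> A" "ell2_has_proj A K"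
    and "\<And>u v a b. u \<in> K \<Longrightarrow> v \<in> K \<Longrightarrow> (\<lambda>x. a * u x + b * v x) \<in> K"
    and "\<And>k. k \<in> K \<Longrightarrow> (\<forall>x\<in>B. k x = 0) \<Longrightarrow> \<forall>x\<in>\<Lambda>. k x = 0"
  shows "(\<Sum>x\<in>\<Lambda>. Re (ell2_proj A K (delta x) x)) \<le> card B"
  using assms
proof (induction B arbitrary: K rule: finite_induct)
  case empty
  have "ell2_proj A K (delta x) x = 0" if "x \<in> \<Lambda>" for x
    using empty.prems(6)[of "ell2_proj A K (delta x)"] ell2_proj(1)[OF empty.prems(4) delta_in] that empty.prems(3)
    by blast
  then show ?case by simp
next
  case (insert p B)
  note lin = insert.prems(5) and proj = insert.prems(4)
  have pA: "p \<in> A" using insert.prems by simp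
  \<comment> \<open>The vector that represents evaluation at \<open>p\<close> on \<open>K\<close>.
    Its orthogonal complement in \<open>K\<close> is \<open>K'\<close>, and its squared norm
    \<open>c\<close> vanishes exactly when this evaluation is trivial on \<open>K\<close>.\<close>
  define r where "r = ell2_proj A K (delta p)"
  define c where "c = (ell2_norm A r)\<^sup>2"
  define K' where "K' = {k \<in> K. k p = 0}"
  have r: "r \<in> K" "r \<in> ell2 A"
    using ell2_proj(1)[OF proj delta_in[OF pA]] proj by (auto simp: r_def ell2_has_proj_def)
  have rr: "ell2_inner A r r = of_real c" using r by (simp add: ell2_inner_self c_def)
  have rp: "ell2_inner A r k = k p" if "k \<in> K" for k
  proof -
    have k: "k \<in> ell2 A" using that proj by (auto simp: ell2_has_proj_def)
    have "ell2_inner A r k = ell2_inner A (delta p) (ell2_proj A K k)"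
      unfolding r_def using proj pA k by (intro ell2_proj_sym) auto
    also have "ell2_proj A K k = k" using proj that by (rule ell2_proj_id)
    finally show ?thesis using pA by (simp add: ell2_inner_delta)
  qed
  have van: "\<forall>x\<in>\<Lambda>. k x = 0" if "k \<in> K'" "\<forall>x\<in>B. k x = 0" for k
    by (rule insert.prems(6)) (use that in \<open>auto simp: K'_def\<close>)
  have lin': "u \<in> K' \<Longrightarrow> v \<in> K' \<Longrightarrow> (\<lambda>x. a * u x + b * v x) \<in> K'" for u v a b
    using lin[of u v a b] by (simp add: K'_def)
  have sub: "K' \<subseteq> ell2 A" using proj by (auto simp: K'_def ell2_has_proj_def)
  show ?case
  proof (cases "c = 0")
    case True
    have "r x = 0" for x
      using True ell2_norm_eq_0D[OF r(2)] by (simp add: c_def)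
    then have "K' = K" using rp by (auto simp: K'_def ell2_inner_def)
    then have van': "\<forall>x\<in>\<Lambda>. k x = 0" if "k \<in> K" "\<forall>x\<in>B. k x = 0" for k
      using that van by blast
    have "B \<subseteq> A" using insert.prems(1) by simp
    from insert.IH[OF this insert.prems(2-5) van'] have "(\<Sum>x\<in>\<Lambda>. Re (ell2_proj A K (delta x) x)) \<le> card B" .
    then show ?thesis using insert.hyps by simp
  next
    case False
    then have c: "c > 0" by (simp add: c_def)
    define q where "q v = (\<lambda>x. 1 * ell2_proj A K v x + (- ell2_inner A r v / of_real c) * r x)" for v
    have q_in: "q v \<in> K'" and q_orth: "k \<in> K' \<Longrightarrow> ell2_inner A k (\<lambda>x. v x - q v x) = 0"
      if v: "v \<in> ell2 A" for v k
    proof -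
      have pv: "ell2_proj A K v \<in> K" using ell2_proj(1)[OF proj v] .
      have "ell2_inner A r (ell2_proj A K v) = ell2_inner A r v"
        using ell2_inner_proj[OF proj v r(1)] .
      moreover have "r p = of_real c" using rp[OF r(1)] rr by simp
      ultimately have "q v p = 0" using rp[OF pv] c by (simp add: q_def)
      moreover have "q v \<in> K" unfolding q_def by (rule lin[OF pv r(1)])
      ultimately show "q v \<in> K'" by (simp add: K'_def)
      assume k: "k \<in> K'"
      then have k2: "k \<in> ell2 A" "k \<in> K" using sub by (auto simp: K'_def)
      have pv2: "ell2_proj A K v \<in> ell2 A" using ell2_proj_in[OF proj v] .
      have "ell2_inner A k r = 0"
        using ell2.ip_cnj[OF r(2) k2(1)] rp[OF k2(2)] k by (simp add: K'_def)
      then have "ell2_inner A k (q v) = ell2_inner A k v"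
        unfolding q_def using k2 r pv2 ell2_inner_proj[OF proj v k2(2)] by (subst ell2.ip_lin) auto
      moreover have "q v \<in> ell2 A" using \<open>q v \<in> K'\<close> sub by auto
      ultimately show "ell2_inner A k (\<lambda>x. v x - q v x) = 0"
        using k2 v by (simp add: ell2_inner_diff_right)
    qed
    have proj': "ell2_has_proj A K'"
      unfolding ell2_has_proj_def using sub q_in q_orth by blast
    have q_eq: "ell2_proj A K' v = q v" if "v \<in> ell2 A" for v
      using sub that q_in[OF that] q_orth[OF that] by (rule ell2_projI)
    have diag: "Re (ell2_proj A K (delta x) x) = Re (ell2_proj A K' (delta x) x) + (cmod (r x))\<^sup>2 / c"
      if x: "x \<in> \<Lambda>" for x
    proof -
      have xA: "x \<in> A" using x insert.prems by auto
      have "ell2_inner A r (delta x) = cnj (r x)"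
        using ell2.ip_cnj[OF delta_in[OF xA] r(2)] xA by (simp add: ell2_inner_delta)
      then have "ell2_proj A K' (delta x) x = ell2_proj A K (delta x) x - cnj (r x) * r x / of_real c"
        using xA by (simp add: q_eq q_def)
      also have "cnj (r x) * r x = of_real ((cmod (r x))\<^sup>2)"
        by (metis complex_norm_square mult.commute)
      finally show ?thesis by (simp flip: of_real_divide)
    qed
    have "(\<Sum>x\<in>\<Lambda>. Re (ell2_proj A K (delta x) x)) =
        (\<Sum>x\<in>\<Lambda>. Re (ell2_proj A K' (delta x) x)) + (\<Sum>x\<in>\<Lambda>. (cmod (r x))\<^sup>2) / c"
      by (simp add: diag sum.distrib sum_divide_distrib)
    also have "(\<Sum>x\<in>\<Lambda>. Re (ell2_proj A K' (delta x) x)) \<le> card B"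
    proof (rule insert.IH)
      show "B \<subseteq> A" using insert.prems(1) by simp
    qed (fact insert.prems(2) insert.prems(3) proj' lin' van)+
    \<comment> \<open>The part of the trace over \<Lambda> that belongs to the one-dimensional
      projection onto \<open>r\<close> is at most its full trace 1.\<close>
    also have "(\<Sum>x\<in>\<Lambda>. (cmod (r x))\<^sup>2) / c \<le> 1"
      using ell2_sum_le_norm[OF r(2) insert.prems(2,3)] c by (simp add: c_def)
    finally show ?thesis using insert.hyps by simp
  qed
qed

section \<open>Separated sets\<close>

abbreviation separated :: "real \<Rightarrow> 'a::metric_space set \<Rightarrow> bool" where
  "separated r T \<equiv> pairwise (\<lambda>x y. r \<le> dist x y) T"

lemma compact_separated_bound:
  fixes K :: "'a::metric_space set"
  assumes "compact K" "r > 0"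
  obtains n where "\<forall>T. T \<subseteq> K \<and> separated r T \<longrightarrow> finite T \<and> card T \<le> n"
proof -
  have "K \<subseteq> (\<Union>c\<in>K. ball c (r / 2))" using assms by auto
  then obtain C where C: "C \<subseteq> K" "finite C" "K \<subseteq> (\<Union>c\<in>C. ball c (r / 2))"
    by (rule compactE_image[OF \<open>compact K\<close> open_ball])
  have "finite T \<and> card T \<le> card C" if T: "T \<subseteq> K" "separated r T" for T
  proof -
    have "\<exists>c\<in>C. dist c t < r / 2" if "t \<in> T" for t
      using subsetD[OF C(3) subsetD[OF T(1) that]] by auto
    then obtain f where f: "\<And>t. t \<in> T \<Longrightarrow> f t \<in> C \<and> dist (f t) t < r / 2" by metis
    have "inj_on f T"
    proof (rule inj_onI, rule ccontr)
      fix s t assume st: "s \<in> T" "t \<in> T" "f s = f t" "s \<noteq> t"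
      then have "r \<le> dist s t" using T(2) by (auto simp: pairwise_def)
      also have "\<dots> \<le> dist (f s) s + dist (f t) t" using st(3) by (metis dist_commute dist_triangle)
      also have "\<dots> < r" using f[OF st(1)] f[OF st(2)] by simp
      finally show False by simp
    qed
    moreover have "f ` T \<subseteq> C" using f by auto
    ultimately show ?thesis
      using card_inj_on_le[of f T C] inj_on_finite[of f T C] C(2) by blast
  qed
  then show thesis by (intro that) blast
qed

text \<open>A separated subset of greatest cardinality cannot be enlarged, so every point of
  \<open>S\<close> is close to it. The uniform bound on cardinalities ensures that one
  exists.\<close>

lemma maximal_separated:
  fixes S :: "'a::metric_space set"
  assumes bound: "\<forall>T. T \<subseteq> S \<and> separated r T \<longrightarrow> finite T \<and> card T \<le> n" and "r > 0"
  obtains G where "G \<subseteq> S" "finite G" "separated r G" "\<forall>s\<in>S. \<exists>g\<in>G. dist s g < r"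
proof -
  define Q where "Q T \<longleftrightarrow> T \<subseteq> S \<and> separated r T" for T
  have "Q {}" by (simp add: Q_def)
  moreover have "\<forall>T. Q T \<longrightarrow> card T < Suc n" using bound by (auto simp: Q_def le_imp_less_Suc)
  ultimately obtain G where G: "Q G" "\<And>T. Q T \<Longrightarrow> card T \<le> card G"
    using ex_has_greatest_nat[of Q "{}" card "Suc n"] by blast
  have fin: "finite G" using G bound by (simp add: Q_def)
  have "\<exists>g\<in>G. dist s g < r" if s: "s \<in> S" for s
  proof (rule ccontr)
    assume "\<not> ?thesis"
    then have far: "\<And>g. g \<in> G \<Longrightarrow> r \<le> dist s g" by force
    then have "s \<notin> G" using \<open>r > 0\<close> by force
    moreover have "Q (insert s G)"
      using G(1) s far by (auto simp: Q_def pairwise_insert dist_commute)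
    ultimately show False using G(2)[of "insert s G"] fin by simp
  qed
  then show thesis using that G fin by (auto simp: Q_def)
qed

section \<open>Geometry of the action\<close>

locale amenable_action =
  fixes act :: "'g::{topological_group_add,metric_space} \<Rightarrow>
                'x::{metric_space,second_countable_topology} \<Rightarrow> 'x"
    and haar :: "'g measure"
    and F :: "'x set"
    and a b :: real
  assumes left_inv: "\<forall>g h k :: 'g. dist (g + h) (g + k) = dist h k"
    and precompact: "\<forall>(g :: 'g) r. compact (closure (ball g r))"
    and haar: "haar_measure haar"
    and unimod: "unimodular haar"
    and amen: "amenable haar"
    and action: "continuous_isometric_action act"
    and fund: "fundamental_domain act F"
    and rough: "rough_isometry a b (group_coordinate act F)"
begin

lemma act_0 [simp]: "act 0 x = x"
  and act_add: "act (g + h) x = act g (act h x)"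
  and act_dist [simp]: "dist (act g x) (act g y) = dist x y"
  and act_continuous: "continuous_on UNIV (\<lambda>(g, x). act g x)"
  using action by (auto simp: continuous_isometric_action_def)

lemma act_minus [simp]: "act (- g) (act g x) = x" "act g (act (- g) x) = x"
  by (simp_all flip: act_add)

lemma continuous_act: "continuous_on S (act g)"
proof -
  have "continuous_on S (Pair g)" by (intro continuous_intros)
  then show ?thesis using continuous_on_compose2[OF act_continuous, of S "Pair g"] by simp
qed

abbreviation coord :: "'x \<Rightarrow> 'g" where
  "coord \<equiv> group_coordinate act F"

lemma fund_unique: "\<exists>!p. snd p \<in> F \<and> x = act (fst p) (snd p)"
proof -
  have "\<exists>!(g, x0). x0 \<in> F \<and> x = act g x0" using fund unfolding fundamental_domain_def by blast
  then show ?thesis unfolding case_prod_unfold .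
qed

lemma coord_unique:
  assumes "x \<in> act g ` F"
  shows "coord x = g"
  unfolding group_coordinate_def
proof (rule the_equality)
  show "x \<in> act g ` F" by (rule assms)
  fix h assume "x \<in> act h ` F"
  then obtain y z where yz: "y \<in> F" "x = act g y" "z \<in> F" "x = act h z" using assms by blast
  have "(h, z) = (g, y)" by (rule ex1E[OF fund_unique[of x]]) (use yz in \<open>metis fst_conv snd_conv\<close>)
  then show "h = g" by simp
qed

lemma coord_mem: "x \<in> act (coord x) ` F"
proof -
  obtain p where "snd p \<in> F" "x = act (fst p) (snd p)" using fund_unique[of x] by blast
  then have "x \<in> act (fst p) ` F" by blast
  then show ?thesis using coord_unique[of x "fst p"] by simp
qed

lemma coord_act: "coord (act g x) = g + coord x"
proof (rule coord_unique)
  obtain y where y: "x = act (coord x) y" "y \<in> F" using coord_mem by blast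
  then have "act g x = act (g + coord x) y" by (metis act_add)
  then show "act g x \<in> act (g + coord x) ` F" using y(2) by blast
qed

lemma a: "a \<ge> 1" and b: "b \<ge> 0"
  and coord_le: "dist (coord x) (coord y) \<le> a * (dist x y + b)"
  and dist_le_coord: "dist x y \<le> a * dist (coord x) (coord y) + b"
proof -
  show a: "a \<ge> 1" and "b \<ge> 0" using rough by (auto simp: rough_isometry_def)
  show "dist x y \<le> a * dist (coord x) (coord y) + b" using rough by (auto simp: rough_isometry_def)
  have "1 / a * dist (coord x) (coord y) - b \<le> dist x y" using rough by (auto simp: rough_isometry_def)
  then show "dist (coord x) (coord y) \<le> a * (dist x y + b)" using a by (simp add: field_simps)
qed

lemma compact_cball_group: "compact (cball (g :: 'g) r)"
proof -
  have "cball g r \<subseteq> ball g (r + 1)" by auto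
  also have "\<dots> \<subseteq> closure (ball g (r + 1))" by (rule closure_subset)
  finally have "cball g r = closure (ball g (r + 1)) \<inter> cball g r" by blast
  then show ?thesis using precompact compact_Int_closed[OF _ closed_cball] by metis
qed

text \<open>The coordinates of a ball are confined to a ball of the group by the rough isometry, so
  the ball is contained in the image of a compact product under the action map.\<close>

lemma compact_cball_space: "compact (cball (p :: 'x) r)"
proof -
  define C where "C = cball (coord p) (a * (r + b)) \<times> closure F"
  have "compact C"
    unfolding C_def using fund compact_cball_group
    by (intro compact_Times) (auto simp: fundamental_domain_def)
  then have "compact ((\<lambda>(g, x). act g x) ` C)"
    by (intro compact_continuous_image continuous_on_subset[OF act_continuous]) auto
  moreover have "cball p r \<subseteq> (\<lambda>(g, x). act g x) ` C"
  proof
    fix x assume "x \<in> cball p r"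
    then have "dist p x \<le> r" by simp
    then have "a * (dist p x + b) \<le> a * (r + b)" using a by (intro mult_left_mono) auto
    then have "coord x \<in> cball (coord p) (a * (r + b))" using coord_le[of p x] by simp
    moreover obtain y where "y \<in> F" "x = act (coord x) y" using coord_mem[of x] by auto
    moreover from this have "y \<in> closure F" using closure_subset by blast
    ultimately show "x \<in> (\<lambda>(g, x). act g x) ` C"
      by (intro image_eqI[of _ _ "(coord x, y)"]) (auto simp: C_def)
  qed
  ultimately show ?thesis by (metis closed_cball compact_Int_closed inf.absorb2)
qed

lemma bounded_subset_cball_space: "bounded S \<Longrightarrow> \<exists>K. compact K \<and> S \<subseteq> (K :: 'x set)"
  using compact_cball_space bounded_subset_cball by meson

lemma finite_separated_bounded:
  assumes "separated 1 (A :: 'x set)" "bounded B"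
  shows "finite (A \<inter> B)"
proof -
  obtain K where "compact K" "B \<subseteq> K" using bounded_subset_cball_space[OF assms(2)] by blast
  obtain n where n: "\<forall>T. T \<subseteq> K \<and> separated 1 T \<longrightarrow> finite T \<and> card T \<le> n"
    by (rule compact_separated_bound[OF \<open>compact K\<close> zero_less_one])
  have "A \<inter> B \<subseteq> K" using \<open>B \<subseteq> K\<close> by blast
  moreover have "separated 1 (A \<inter> B)" using assms(1) by (rule pairwise_subset) simp
  ultimately show ?thesis using n by blast
qed

subsection \<open>Foelner sets\<close>

lemma dist_minus_left: "dist (- x) (g :: 'g) = dist 0 (x + g)"
  using left_inv[rule_format, of x "- x" g] by simp

lemma sets_haar [simp]: "sets haar = sets borel" and space_haar [simp]: "space haar = UNIV"
  using haar sets_eq_imp_space_eq[of haar borel] by (auto simp: haar_measure_def)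

lemma measurable_haar [simp]: "measurable haar N = measurable borel N"
  by (rule measurable_cong_sets) simp_all

definition vol :: "real \<Rightarrow> real" where
  "vol r = measure haar (ball 0 r)"

text \<open>The inverse of the ball of radius \<open>r\<close> around \<open>g\<close>. Balls of the
  left-invariant metric are left translates of each other, so their inverses are right translates of
  the ball around 0.\<close>

definition tile :: "real \<Rightarrow> 'g \<Rightarrow> 'g set" where
  "tile r g = {x. dist (- x) g < r}"

lemma translation_measurable: "(\<lambda>x. x + (g :: 'g)) \<in> borel_measurable borel"
  by (intro borel_measurable_continuous_onI continuous_intros)

lemma tile_eq: "tile r g = (\<lambda>x. x + g) -` ball 0 r"
  by (auto simp: tile_def dist_minus_left)

lemma tile_open: "open (tile r g)"
  unfolding tile_eq by (intro open_vimage open_ball continuous_intros)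

lemma compact_finite_haar: "compact K \<Longrightarrow> emeasure haar K < \<infinity>"
  using haar by (auto simp: haar_measure_def)

lemma emeasure_ball: "emeasure haar (ball 0 r) = ennreal (vol r)"
proof -
  have "emeasure haar (ball 0 r) \<le> emeasure haar (cball 0 r)"
    by (intro emeasure_mono) auto
  also have "\<dots> < \<infinity>" using compact_finite_haar[OF compact_cball_group] .
  finally show ?thesis by (simp add: vol_def emeasure_eq_ennreal_measure)
qed

text \<open>This is the only place where unimodularity enters.\<close>

lemma emeasure_tile: "emeasure haar (tile r g) = ennreal (vol r)"
proof -
  have "emeasure haar (tile r g) = emeasure (distr haar borel (\<lambda>x. x + g)) (ball 0 r)"
    using translation_measurable by (subst emeasure_distr) (auto simp: tile_eq)
  also have "distr haar borel (\<lambda>x. x + g) = haar" using unimod by (simp add: unimodular_def)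
  finally show ?thesis by (simp add: emeasure_ball)
qed

text \<open>If the ball were null, then so would be all tiles of this radius. Finitely many of them
  cover any compact ball, so the whole group would be null.\<close>

lemma vol_pos:
  assumes "r > 0"
  shows "vol r > 0"
proof (rule ccontr)
  assume "\<not> vol r > 0"
  then have "ennreal (vol r) = 0" by (simp add: ennreal_neg)
  then have null: "tile r g \<in> null_sets haar" for g
    using emeasure_tile tile_open by (intro null_setsI) auto
  have "cball 0 (real n) \<in> null_sets haar" for n
  proof -
    have "cball 0 (real n) \<subseteq> (\<Union>g. tile r g)"
    proof
      fix x :: 'g
      have "x \<in> tile r (- x)" using assms by (simp add: tile_def)
      then show "x \<in> (\<Union>g. tile r g)" by blast
    qed
    then obtain C where C: "C \<subseteq> UNIV" "finite C" "cball 0 (real n) \<subseteq> (\<Union>g\<in>C. tile r g)"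
      by (rule compactE_image[OF compact_cball_group tile_open])
    have "(\<Union>g\<in>C. tile r g) \<in> null_sets haar"
      using C(2) null by (intro null_sets_UN' countable_finite)
    then show ?thesis by (rule null_sets_subset) (use C in auto)
  qed
  then have "(\<Union>n. cball 0 (real n)) \<in> null_sets haar" by (intro null_sets_UN)
  moreover have "(\<Union>n. cball (0 :: 'g) (real n)) = UNIV" using real_arch_simple by auto
  ultimately show False using haar by (auto simp: haar_measure_def null_sets_def)
qed

text \<open>The metric is invariant under left translations, the Foelner sets \<open>S\<close> are almost invariant
  under left translations as well, so it is \<open>T = - S\<close> that has small metric boundary.\<close>

lemma Foelner:
  assumes \<rho>: "\<rho> > 0" and \<epsilon>: "\<epsilon> > 0" and r: "r \<ge> 0"
  obtains T G where "bounded T" "G \<subseteq> T" "finite G" "G \<noteq> {}" "separated \<rho> G"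
    and "\<forall>P. finite P \<and> separated 1 P \<and> (\<forall>x\<in>P. \<forall>t\<in>T. 1 / 2 \<le> dist x t) \<and>
      (\<forall>x\<in>P. \<exists>t\<in>T. dist x (t :: 'g) \<le> r) \<longrightarrow> real (card P) \<le> \<epsilon> * real (card G)"
proof -
  \<comment> \<open>A tile of radius 1/2 around a point within \<open>r\<close> of \<open>T\<close>
    then lies in the translate \<open>K S\<close>.\<close>
  define K where "K = cball (0 :: 'g) (r + 1 / 2)"
  \<comment> \<open>The ratio of volumes converts between measure and cardinality:
    \<open>card P\<close> is counted by disjoint tiles of radius 1/2, \<open>card G\<close> by
    covering tiles of radius \<rho>.\<close>
  define \<epsilon>' where "\<epsilon>' = \<epsilon> * vol (1 / 2) / vol \<rho>"
  have v: "vol (1 / 2) > 0" "vol \<rho> > 0" using \<rho> by (auto intro: vol_pos)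
  have "\<epsilon>' > 0" using \<epsilon> v by (simp add: \<epsilon>'_def)
  moreover have "compact K" "K \<noteq> {}" using compact_cball_group r by (auto simp: K_def)
  ultimately obtain S where S: "compact S"
    "emeasure haar (sym_diff {k + x |k x. k \<in> K \<and> x \<in> S} S) < ennreal \<epsilon>' * emeasure haar S"
    using amen unfolding amenable_def by blast
  define T where "T = uminus ` S"
  have T: "compact T" unfolding T_def using S(1) by (intro compact_continuous_image continuous_intros)
  obtain n where n: "\<forall>Q. Q \<subseteq> T \<and> separated \<rho> Q \<longrightarrow> finite Q \<and> card Q \<le> n"
    by (rule compact_separated_bound[OF T \<rho>])
  obtain G where G: "G \<subseteq> T" "finite G" "separated \<rho> G" "\<forall>t\<in>T. \<exists>g\<in>G. dist t g < \<rho>"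
    by (rule maximal_separated[OF n \<rho>])
  have KS: "compact {k + x |k x. k \<in> K \<and> x \<in> S}"
  proof -
    have "{k + x |k x. k \<in> K \<and> x \<in> S} = (\<lambda>(k, x). k + x) ` (K \<times> S)" by auto
    moreover have "compact ((\<lambda>(k, x). k + x) ` (K \<times> S))"
      using \<open>compact K\<close> S(1)
      by (intro compact_continuous_image compact_Times) (auto simp: case_prod_unfold intro!: continuous_intros)
    ultimately show ?thesis by simp
  qed
  have S_borel: "S \<in> sets haar" using S(1) by (simp add: borel_closed compact_imp_closed)
  have KS_borel: "sym_diff {k + x |k x. k \<in> K \<and> x \<in> S} S \<in> sets haar"
    using S(1) KS by (intro sets.Un sets.Diff) (simp_all add: borel_closed compact_imp_closed)
  \<comment> \<open>Maximality of \<open>G\<close> makes the tiles of radius \<rho> cover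
    \<open>S\<close>, so \<open>card G\<close> bounds the measure of \<open>S\<close> from
    above.\<close>
  have "S \<subseteq> (\<Union>g\<in>G. tile \<rho> g)" using G(4) by (auto simp: T_def tile_def)
  then have "emeasure haar S \<le> emeasure haar (\<Union>g\<in>G. tile \<rho> g)"
    by (rule emeasure_mono) (use G(2) tile_open in auto)
  also have "\<dots> \<le> (\<Sum>g\<in>G. emeasure haar (tile \<rho> g))"
    using G(2) tile_open by (intro emeasure_subadditive_finite) auto
  also have "\<dots> = ennreal (real (card G) * vol \<rho>)"
    by (simp add: emeasure_tile ennreal_mult' ennreal_of_nat_eq_real_of_nat)
  finally have mS: "emeasure haar S \<le> ennreal (real (card G) * vol \<rho>)" .
  show thesis
  proof (rule that[of T G])
    show "bounded T" using T by (rule compact_imp_bounded)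
    \<comment> \<open>The strict Foelner inequality forces \<open>S\<close> to have positive
      measure.\<close>
    show "G \<noteq> {}" using mS S(2) by auto
    show "\<forall>P. finite P \<and> separated 1 P \<and> (\<forall>x\<in>P. \<forall>t\<in>T. 1 / 2 \<le> dist x t) \<and>
      (\<forall>x\<in>P. \<exists>t\<in>T. dist x t \<le> r) \<longrightarrow> real (card P) \<le> \<epsilon> * real (card G)"
    proof (intro allI impI; elim conjE)
      fix P :: "'g set"
      assume P: "finite P" "separated 1 P" "\<forall>x\<in>P. \<forall>t\<in>T. 1 / 2 \<le> dist x t"
        "\<forall>x\<in>P. \<exists>t\<in>T. dist x t \<le> r"
      have disj: "disjoint_family_on (tile (1 / 2)) P"
        unfolding disjoint_family_on_def
      proof (intro ballI impI, rule ccontr)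
        fix p q assume pq: "p \<in> P" "q \<in> P" "p \<noteq> q" "tile (1 / 2) p \<inter> tile (1 / 2) q \<noteq> {}"
        then obtain x where "dist (- x) p < 1 / 2" "dist (- x) q < 1 / 2" by (auto simp: tile_def)
        then have "dist p q < 1" using dist_triangle3[of p q "- x"] by simp
        moreover have "1 \<le> dist p q" using P(2) pq by (auto simp: pairwise_def)
        ultimately show False by simp
      qed
      have "(\<Union>p\<in>P. tile (1 / 2) p) \<subseteq> {k + x |k x. k \<in> K \<and> x \<in> S} - S"
      proof safe
        fix p x assume px: "p \<in> P" "x \<in> tile (1 / 2) p"
        obtain s where s: "s \<in> S" "dist p (- s) \<le> r" using P(4) px(1) by (auto simp: T_def)
        have "dist (- x) (- s) \<le> dist (- x) p + dist p (- s)" by (rule dist_triangle)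
        also have "\<dots> \<le> r + 1 / 2" using px s by (simp add: tile_def)
        finally have "x - s \<in> K" using dist_minus_left[of x "- s"] by (simp add: K_def)
        then show "\<exists>k y. x = k + y \<and> k \<in> K \<and> y \<in> S" using s(1) by (intro exI[of _ "x - s"] exI[of _ s]) simp
      next
        fix p x assume px: "p \<in> P" "x \<in> tile (1 / 2) p" "x \<in> S"
        then have "1 / 2 \<le> dist p (- x)" using P(3) by (auto simp: T_def)
        then show False using px(2) by (simp add: tile_def dist_commute)
      qed
      then have sub: "(\<Union>p\<in>P. tile (1 / 2) p) \<subseteq> sym_diff {k + x |k x. k \<in> K \<and> x \<in> S} S" by blast
      have "ennreal (real (card P) * vol (1 / 2)) = (\<Sum>p\<in>P. emeasure haar (tile (1 / 2) p))"
        by (simp add: emeasure_tile ennreal_mult' ennreal_of_nat_eq_real_of_nat)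
      also have "\<dots> = emeasure haar (\<Union>p\<in>P. tile (1 / 2) p)"
        using P(1) disj tile_open by (intro sum_emeasure) auto
      also have "\<dots> \<le> emeasure haar (sym_diff {k + x |k x. k \<in> K \<and> x \<in> S} S)"
        using sub KS_borel by (rule emeasure_mono)
      also have "\<dots> \<le> ennreal \<epsilon>' * emeasure haar S" using S(2) by simp
      also have "\<dots> \<le> ennreal \<epsilon>' * ennreal (real (card G) * vol \<rho>)" using mS by (intro mult_left_mono) auto
      also have "\<dots> = ennreal (\<epsilon>' * (real (card G) * vol \<rho>))"
        using \<open>\<epsilon>' > 0\<close> v by (intro ennreal_mult[symmetric]) auto
      finally have "real (card P) * vol (1 / 2) \<le> \<epsilon>' * (real (card G) * vol \<rho>)"
        using \<open>\<epsilon>' > 0\<close> v by (subst (asm) ennreal_le_iff) auto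
      also have "\<dots> = \<epsilon> * real (card G) * vol (1 / 2)" using v by (simp add: \<epsilon>'_def)
      finally show "real (card P) \<le> \<epsilon> * real (card G)" using v by simp
    qed
  qed (use G in auto)
qed

text \<open>Transfer of the Foelner sets from the group to the space: \<Lambda> consists of the
  points whose coordinate is close to \<open>T\<close>. Since \<open>coord\<close> respects
  distances only up to the constants of the rough isometry, the radii have to absorb them.\<close>

lemma Foelner_space:
  fixes p :: 'x
  assumes \<epsilon>: "\<epsilon> > 0"
  obtains G \<Lambda> where "finite G" "G \<noteq> {}" "bounded \<Lambda>"
    and "\<And>g h. g \<in> G \<Longrightarrow> h \<in> G \<Longrightarrow> g \<noteq> h \<Longrightarrow> 1 \<le> dist (act g p) (act h p)"
    and "\<And>g. g \<in> G \<Longrightarrow> ball (act g p) (1 / 2) \<subseteq> \<Lambda>"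
    and "\<And>A. separated 1 A \<Longrightarrow>
      finite {x \<in> A. x \<notin> \<Lambda> \<and> (\<exists>y\<in>\<Lambda>. dist x y < R)} \<and>
      real (card {x \<in> A. x \<notin> \<Lambda> \<and> (\<exists>y\<in>\<Lambda>. dist x y < R)}) \<le> \<epsilon> * real (card G)"
proof -
  define c where "c = coord p"
  define \<delta> where "\<delta> = dist 0 c"
  have shift: "dist g (g + c) = \<delta>" for g :: 'g
    using left_inv[rule_format, of g 0 c] by (simp add: \<delta>_def)
  \<comment> \<open>A point within 1/2 of \<open>act g p\<close> has a coordinate within
    \<open>a * (1 / 2 + b)\<close> of \<open>g + c\<close>, and \<open>g + c\<close> is at distance
    \<delta> from \<open>g\<close>. The last 1/2 keeps the coordinates of points outside \<Lambda>
    at distance at least 1/2 from \<open>T\<close>, as \<open>Foelner\<close> demands.\<close>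
  define r0 where "r0 = a * (1 / 2 + b) + \<delta> + 1 / 2"
  \<comment> \<open>Bounds the distance from \<open>T\<close> of the coordinates of points within
    \<open>R\<close> of \<Lambda>. The maximum takes care of negative \<open>R\<close>.\<close>
  define r1 where "r1 = a * (max R 0 + b) + r0"
  \<comment> \<open>Passing from \<open>g\<close> to the coordinate of \<open>act g p\<close> costs
    \<delta> at either end; the remaining separation \<open>a * (1 + b)\<close> of coordinates
    forces distance 1 in the space.\<close>
  define \<rho> where "\<rho> = a * (1 + b) + 2 * \<delta>"
  have pos: "\<rho> > 0" "r0 \<ge> 1 / 2" "r1 \<ge> 0"
    using a b unfolding \<rho>_def r1_def r0_def \<delta>_def by (auto intro!: add_pos_nonneg add_nonneg_nonneg)
  \<comment> \<open>Translation by \<open>- q\<close> moves all points with coordinate within 1 of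
    \<open>q\<close> into this ball, so \<open>N\<close> bounds the number of separated points in
    such a cluster, uniformly in \<open>q\<close>.\<close>
  define C where "C = cball p (a * (1 + \<delta>) + b)"
  have "compact C" unfolding C_def by (rule compact_cball_space)
  then obtain N where N: "\<forall>T. T \<subseteq> C \<and> separated 1 T \<longrightarrow> finite T \<and> card T \<le> N"
    by (rule compact_separated_bound[OF _ zero_less_one])
  have "\<epsilon> / (N + 1) > 0" using \<epsilon> by simp
  then obtain T G where T: "bounded T" and G: "G \<subseteq> T" "finite G" "G \<noteq> {}" "separated \<rho> G"
    and P: "\<forall>P. finite P \<and> separated 1 P \<and> (\<forall>x\<in>P. \<forall>t\<in>T. 1 / 2 \<le> dist x t) \<and>
      (\<forall>x\<in>P. \<exists>t\<in>T. dist x (t :: 'g) \<le> r1) \<longrightarrow> real (card P) \<le> \<epsilon> / (N + 1) * real (card G)"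
    by (rule Foelner[OF pos(1) _ pos(3)])
  define \<Lambda> where "\<Lambda> = {x. \<exists>t\<in>T. dist (coord x) t \<le> r0}"
  show thesis
  proof (rule that[of G \<Lambda>])
    show "bounded \<Lambda>"
    proof -
      obtain \<tau> where \<tau>: "\<And>t. t \<in> T \<Longrightarrow> dist c t \<le> \<tau>" using T by (meson bounded_any_center)
      have "dist p x \<le> a * (r0 + \<tau>) + b" if "x \<in> \<Lambda>" for x
      proof -
        obtain t where t: "t \<in> T" "dist (coord x) t \<le> r0" using \<open>x \<in> \<Lambda>\<close> by (auto simp: \<Lambda>_def)
        have "dist (coord p) (coord x) \<le> r0 + \<tau>"
          using dist_triangle2[of c "coord x" t] t(2) \<tau>[OF t(1)] by (simp add: c_def)
        then have "a * dist (coord p) (coord x) \<le> a * (r0 + \<tau>)" using a by (intro mult_left_mono) auto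
        then show ?thesis using dist_le_coord[of p x] by linarith
      qed
      then show ?thesis unfolding bounded_def by blast
    qed
    show "1 \<le> dist (act g p) (act h p)" if gh: "g \<in> G" "h \<in> G" "g \<noteq> h" for g h
    proof -
      have "\<rho> \<le> dist g h" using G(4) gh by (auto simp: pairwise_def)
      also have "\<dots> \<le> dist g (g + c) + dist (g + c) (h + c) + dist h (h + c)"
        using dist_triangle[of g h "g + c"] dist_triangle2[of "g + c" h "h + c"] by simp
      finally have "a * (1 + b) \<le> dist (g + c) (h + c)" by (simp add: shift \<rho>_def)
      also have "\<dots> \<le> a * (dist (act g p) (act h p) + b)"
        using coord_le[of "act g p" "act h p"] by (simp add: coord_act c_def)
      finally show ?thesis using a by simp
    qed
    show "ball (act g p) (1 / 2) \<subseteq> \<Lambda>" if g: "g \<in> G" for g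
    proof
      fix x assume "x \<in> ball (act g p) (1 / 2)"
      then have "dist (act g p) x \<le> 1 / 2" by simp
      then have "a * (dist (act g p) x + b) \<le> a * (1 / 2 + b)" using a by (intro mult_left_mono) auto
      then have "dist (g + c) (coord x) \<le> a * (1 / 2 + b)"
        using coord_le[of "act g p" x] by (simp add: coord_act c_def)
      then have "dist (coord x) g \<le> r0"
        using dist_triangle[of g "coord x" "g + c"] by (simp add: shift r0_def dist_commute)
      then show "x \<in> \<Lambda>" using g G(1) by (auto simp: \<Lambda>_def)
    qed
    then obtain g0 where "g0 \<in> T" using G by auto
    fix A :: "'x set" assume A: "separated 1 A"
    define Z where "Z = {x \<in> A. x \<notin> \<Lambda> \<and> (\<exists>y\<in>\<Lambda>. dist x y < R)}"
    have "bounded {x. \<exists>y\<in>\<Lambda>. dist x y < R}"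
    proof -
      obtain e where "\<And>y. y \<in> \<Lambda> \<Longrightarrow> dist p y \<le> e" using \<open>bounded \<Lambda>\<close> by (meson bounded_any_center)
      then have "dist p x \<le> e + R" if "y \<in> \<Lambda>" "dist x y < R" for x y
        using dist_triangle2[of p x y] that by fastforce
      then show ?thesis unfolding bounded_def by blast
    qed
    then have "finite (A \<inter> {x. \<exists>y\<in>\<Lambda>. dist x y < R})" using A by (intro finite_separated_bounded)
    then have finZ: "finite Z" by (rule rev_finite_subset) (auto simp: Z_def)
    \<comment> \<open>Points of \<open>Z\<close> may share their coordinates or have close ones. The
      Foelner estimate is therefore applied to a maximal 1-separated set \<open>P\<close> of
      coordinates, and each element of \<open>P\<close> accounts for at most \<open>N\<close> points
      of \<open>Z\<close>.\<close>
    have "\<forall>Q. Q \<subseteq> coord ` Z \<and> separated 1 Q \<longrightarrow> finite Q \<and> card Q \<le> card (coord ` Z)"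
      using finZ by (meson card_mono finite_imageI finite_subset)
    then obtain P where P': "P \<subseteq> coord ` Z" "finite P" "separated 1 P"
      "\<forall>s\<in>coord ` Z. \<exists>q\<in>P. dist s q < 1"
      by (rule maximal_separated[OF _ zero_less_one])
    have cardP: "real (card P) \<le> \<epsilon> / (N + 1) * real (card G)"
    proof (rule P[rule_format], intro conjI ballI)
      fix q assume "q \<in> P"
      then obtain x where x: "x \<in> Z" "q = coord x" using P' by auto
      show "1 / 2 \<le> dist q t" if "t \<in> T" for t
        using x pos(2) that unfolding Z_def \<Lambda>_def by force
      obtain y t where y: "dist x y < R" "t \<in> T" "dist (coord y) t \<le> r0"
        using x by (auto simp: Z_def \<Lambda>_def)
      have "a * (dist x y + b) \<le> a * (max R 0 + b)" using y a by (intro mult_left_mono) auto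
      then have "dist q t \<le> r1"
        using coord_le[of x y] dist_triangle[of q t "coord y"] y x by (simp add: r1_def)
      then show "\<exists>t\<in>T. dist q t \<le> r1" using y by blast
    qed (use P' in auto)
    have cl: "card {x \<in> Z. dist (coord x) q < 1} \<le> N" for q
    proof -
      have "card (act (- q) ` {x \<in> Z. dist (coord x) q < 1}) \<le> N"
      proof (rule N[rule_format, THEN conjunct2], intro conjI)
        show "act (- q) ` {x \<in> Z. dist (coord x) q < 1} \<subseteq> C"
        proof clarify
          fix x assume x: "dist (coord x) q < 1"
          have "dist (coord (act (- q) x)) 0 = dist (coord x) q"
            using left_inv[rule_format, of q "- q + coord x" 0] by (simp add: coord_act)
          then have "dist c (coord (act (- q) x)) \<le> 1 + \<delta>"
            using x dist_triangle3[of c "coord (act (- q) x)" 0] by (simp add: \<delta>_def dist_commute)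
          then have "a * dist c (coord (act (- q) x)) \<le> a * (1 + \<delta>)" using a by (intro mult_left_mono) auto
          then show "act (- q) x \<in> C" using dist_le_coord[of p "act (- q) x"] by (simp add: C_def c_def)
        qed
        show "separated 1 (act (- q) ` {x \<in> Z. dist (coord x) q < 1})"
          using A by (auto simp: pairwise_def Z_def)
      qed
      moreover have "inj_on (act (- q)) {x \<in> Z. dist (coord x) q < 1}"
        by (rule inj_on_inverseI[of _ "act q"]) simp
      ultimately show ?thesis by (simp add: card_image)
    qed
    have "Z = (\<Union>q\<in>P. {x \<in> Z. dist (coord x) q < 1})" using P'(4) by auto
    then have "card Z \<le> (\<Sum>q\<in>P. card {x \<in> Z. dist (coord x) q < 1})"
      using card_UN_le[OF P'(2), of "\<lambda>q. {x \<in> Z. dist (coord x) q < 1}"] by simp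
    also have "\<dots> \<le> card P * N" using cl sum_bounded_above[of P _ N] by simp
    finally have "real (card Z) \<le> real (card P) * N" by (metis of_nat_le_iff of_nat_mult)
    also have "\<dots> \<le> (\<epsilon> / (N + 1) * real (card G)) * N" using cardP by (intro mult_right_mono) auto
    also have "\<dots> = \<epsilon> * real (card G) * (N / (N + 1))" by simp
    also have "\<dots> \<le> \<epsilon> * real (card G) * 1" using \<epsilon> by (intro mult_left_mono) auto
    finally show "finite {x \<in> A. x \<notin> \<Lambda> \<and> (\<exists>y\<in>\<Lambda>. dist x y < R)} \<and>
        real (card {x \<in> A. x \<notin> \<Lambda> \<and> (\<exists>y\<in>\<Lambda>. dist x y < R)}) \<le> \<epsilon> * real (card G)"
      using finZ by (simp add: Z_def)
  qed (use G in auto)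
qed

end

section \<open>Finite range operators on a single configuration\<close>

lemma closed_span_orth:
  assumes S: "S \<subseteq> ell2 A" and d: "d \<in> ell2 A" and orth: "\<And>s. s \<in> S \<Longrightarrow> ell2_inner A s d = 0"
    and u: "u \<in> closed_span A S"
  shows "ell2_inner A u d = 0"
proof -
  have u2: "u \<in> ell2 A" using u by (simp add: closed_span_def)
  have "cmod (ell2_inner A u d) \<le> e * ell2_norm A d" if e: "e > 0" for e
  proof -
    obtain T c where T: "finite T" "T \<subseteq> S" "ell2_norm A (\<lambda>x. u x - (\<Sum>t\<in>T. c t * t x)) < e"
      using u e unfolding closed_span_def by blast
    define v where "v = (\<lambda>x. \<Sum>t\<in>T. c t * t x)"
    have T2: "t \<in> ell2 A" "ell2_inner A t d = 0" if "t \<in> T" for t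
      using that T(2) S orth by blast+
    have v: "v \<in> ell2 A" unfolding v_def using T(1) T2(1) by (rule ell2_sum)
    have "ell2_inner A v d = (\<Sum>t\<in>T. cnj (c t) * ell2_inner A t d)"
      unfolding v_def using T(1) T2(1) d by (rule ell2_inner_sum_left)
    then have v0: "ell2_inner A v d = 0" using T2(2) by simp
    have "cmod (ell2_inner A u d) = cmod (ell2_inner A (\<lambda>x. u x - v x) d)"
      using u2 v v0 d by (simp add: ell2_inner_diff_left)
    also have "\<dots> \<le> ell2_norm A (\<lambda>x. u x - v x) * ell2_norm A d"
      using u2 v d by (intro ell2_inner_Cauchy_Schwarz ell2_diff)
    also have "\<dots> \<le> e * ell2_norm A d" using T(3) by (intro mult_right_mono) (auto simp: v_def)
    finally show ?thesis .
  qed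
  note bound = this
  have "cmod (ell2_inner A u d) \<le> 0 + e" if "e > 0" for e
  proof -
    have "cmod (ell2_inner A u d) \<le> e / (ell2_norm A d + 1) * ell2_norm A d"
      using that by (intro bound) (simp add: add_nonneg_pos)
    also have "\<dots> \<le> e"
      using that mult_left_mono[of "ell2_norm A d" "ell2_norm A d + 1" e]
      by (simp add: divide_le_eq add_nonneg_pos)
    finally show ?thesis by simp
  qed
  then have "cmod (ell2_inner A u d) \<le> 0" by (rule field_le_epsilon)
  then show ?thesis by simp
qed

text \<open>These properties hold on the whole support. Symmetry of the matrix will be available
  only for almost every configuration and is added in a separate locale.\<close>

locale hopping_operator =
  fixes \<iota> :: "complex \<Rightarrow> 'c" and \<omega> :: "('x::metric_space, 'c) conf" and C R lam :: real
  assumes sep: "separated 1 (fst \<omega>)"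
    and proper: "\<And>p r. compact (cball (p :: 'x) r)"
    and bound: "\<And>v. finite {x. v x \<noteq> 0} \<Longrightarrow> {x. v x \<noteq> 0} \<subseteq> fst \<omega> \<Longrightarrow>
        hamiltonian \<iota> \<omega> v \<in> ell2 (fst \<omega>) \<and>
        ell2_norm (fst \<omega>) (hamiltonian \<iota> \<omega> v) \<le> C * ell2_norm (fst \<omega>) v"
    and hop: "\<And>x y. x \<in> fst \<omega> \<Longrightarrow> y \<in> fst \<omega> \<Longrightarrow> R \<le> dist x y \<Longrightarrow> matrix_element \<iota> \<omega> x y = 0"
    and C: "C \<ge> 0" and R: "R > 0"
begin

abbreviation "A \<equiv> fst \<omega>"
abbreviation "H \<equiv> hamiltonian \<iota> \<omega>"
abbreviation "m \<equiv> matrix_element \<iota> \<omega>"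

lemma finite_bounded:
  assumes "bounded B"
  shows "finite (A \<inter> B)"
proof -
  obtain p :: 'x and r where "B \<subseteq> cball p r" using assms bounded_subset_cball by blast
  then have sub: "A \<inter> B \<subseteq> cball p r" by blast
  obtain n where n: "\<forall>T. T \<subseteq> cball p r \<and> separated 1 T \<longrightarrow> finite T \<and> card T \<le> n"
    by (rule compact_separated_bound[OF proper zero_less_one])
  have "separated 1 (A \<inter> B)" using sep by (rule pairwise_subset) simp
  then show ?thesis using n sub by blast
qed

lemma H_eq:
  assumes "x \<in> A" "finite S" "S \<subseteq> A" "\<And>y. y \<in> A \<Longrightarrow> dist x y < R \<Longrightarrow> v y \<noteq> 0 \<Longrightarrow> y \<in> S"
  shows "H v x = (\<Sum>y\<in>S. m x y * v y)"
proof -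
  have "(\<Sum>\<^sub>\<infinity>y\<in>A. m x y * v y) = (\<Sum>\<^sub>\<infinity>y\<in>S. m x y * v y)"
  proof (rule infsum_cong_neutral)
    show "m x y * v y = 0" if "y \<in> A - S" for y
      using that assms(4)[of y] hop[OF assms(1), of y] by (cases "dist x y < R") auto
  qed (use assms in auto)
  then show ?thesis using assms by (simp add: hamiltonian_def)
qed

lemma H_eq_ball: "x \<in> A \<Longrightarrow> H v x = (\<Sum>y\<in>A \<inter> ball x R. m x y * v y)"
  by (rule H_eq) (auto intro: finite_bounded)

lemma H_outside: "x \<notin> A \<Longrightarrow> H v x = 0"
  by (simp add: hamiltonian_def)

lemma H_lin: "H (\<lambda>x. a * u x + b * v x) = (\<lambda>x. a * H u x + b * H v x)"
proof
  show "H (\<lambda>x. a * u x + b * v x) x = a * H u x + b * H v x" for x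
    by (cases "x \<in> A") (simp_all add: H_eq_ball H_outside sum_distrib_left sum.distrib algebra_simps)
qed

text \<open>Boundedness is assumed for finitely supported functions. By finite range, the values of
  \<open>H v\<close> on a finite set \<open>F\<close> depend only on finitely many values of
  \<open>v\<close>, so truncating \<open>v\<close> near \<open>F\<close> transfers the bound to all
  partial sums.\<close>

lemma H_ell2:
  assumes v: "v \<in> ell2 A"
  shows "H v \<in> ell2 A" "ell2_norm A (H v) \<le> C * ell2_norm A v"
proof -
  have "(\<Sum>x\<in>F. (cmod (H v x))\<^sup>2) \<le> (C * ell2_norm A v)\<^sup>2" if F: "finite F" "F \<subseteq> A" for F
  proof -
    define S where "S = (\<Union>x\<in>F. A \<inter> ball x R)"
    have S: "finite S" "S \<subseteq> A" using F by (auto simp: S_def intro: finite_bounded)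
    define v' where "v' x = (if x \<in> S then v x else 0)" for x
    have supp: "finite {x. v' x \<noteq> 0}" "{x. v' x \<noteq> 0} \<subseteq> A"
      using S by (auto simp: v'_def intro: finite_subset[OF _ S(1)] split: if_splits)
    have Hv': "H v' \<in> ell2 A" "ell2_norm A (H v') \<le> C * ell2_norm A v'"
      using bound[OF supp] by auto
    have "v' \<in> ell2 A" using S by (intro ell2_finite_support[of S]) (auto simp: v'_def)
    have "(ell2_norm A v')\<^sup>2 = (\<Sum>\<^sub>\<infinity>x\<in>S. (cmod (v x))\<^sup>2)"
      unfolding ell2_norm_square using S by (intro infsum_cong_neutral) (auto simp: v'_def)
    also have "\<dots> = (\<Sum>x\<in>S. (cmod (v x))\<^sup>2)" using S by simp
    also have "\<dots> \<le> (ell2_norm A v)\<^sup>2" using ell2_sum_le_norm[OF v S] .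
    finally have v'_le: "ell2_norm A v' \<le> ell2_norm A v" by (rule power2_le_imp_le) simp
    have "H v' x = H v x" if "x \<in> F" for x
      using that F by (simp add: H_eq_ball subset_iff) (auto intro!: sum.cong simp: v'_def S_def)
    then have "(\<Sum>x\<in>F. (cmod (H v x))\<^sup>2) = (\<Sum>x\<in>F. (cmod (H v' x))\<^sup>2)" by simp
    also have "\<dots> \<le> (ell2_norm A (H v'))\<^sup>2" using ell2_sum_le_norm[OF Hv'(1) F] .
    also have "\<dots> \<le> (C * ell2_norm A v)\<^sup>2"
      using Hv'(2) mult_left_mono[OF v'_le C] by (intro power_mono) auto
    finally show ?thesis .
  qed
  then show "H v \<in> ell2 A" "ell2_norm A (H v) \<le> C * ell2_norm A v"
    using ell2I_bounded[of A "H v" "C * ell2_norm A v"] C by (simp_all add: H_outside)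
qed

end

section \<open>Hermitian hopping matrices and their eigenspaces\<close>

lemma Re_cnj_mult: "Re (cnj z * z) = (cmod z)\<^sup>2"
  by (metis Re_complex_of_real complex_norm_square mult.commute)

locale hermitian_hopping = hopping_operator \<iota> \<omega> C R lam
  for \<iota> :: "complex \<Rightarrow> 'c" and \<omega> :: "('x::metric_space, 'c) conf" and C R lam :: real +
  assumes herm: "\<And>x y. x \<in> A \<Longrightarrow> y \<in> A \<Longrightarrow> m y x = cnj (m x y)"
begin

text \<open>Hermitian matrix elements give symmetry on the functions \<open>delta x\<close>,
  linearity extends it to finitely supported functions, and boundedness of \<open>H\<close> controls
  the error of approximating \<open>u\<close> by these.\<close>

lemma H_sym:
  assumes u: "u \<in> ell2 A" and v: "v \<in> ell2 A"
  shows "ell2_inner A (H u) v = ell2_inner A u (H v)"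
proof -
  have delta: "ell2_inner A (H (delta x)) v = H v x" if x: "x \<in> A" for x
  proof -
    have Hd: "H (delta x) y = m y x" if "y \<in> A" for y
      using H_eq[of y "{x}" "delta x"] x that by (auto simp: delta_def split: if_splits)
    have "ell2_inner A (H (delta x)) v = (\<Sum>\<^sub>\<infinity>y\<in>A. m x y * v y)"
      unfolding ell2_inner_def using Hd herm[OF x] by (intro infsum_cong) simp
    then show ?thesis using x by (simp add: hamiltonian_def)
  qed
  have "ell2_inner A (H v) u = ell2_inner A v (H u)"
  proof -
    have "cmod (ell2_inner A (H v) u - ell2_inner A v (H u)) \<le> 0 + e" if "e > 0" for e
    proof -
      \<comment> \<open>A remainder of norm at most \<open>e'\<close> changes the two inner products
        by at most \<open>2 * C * ell2_norm A v * e'\<close> in total; the summand 1 keeps the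
        divisor positive.\<close>
      define e' where "e' = e / (2 * C * ell2_norm A v + 1)"
      have pos: "2 * C * ell2_norm A v + 1 > 0" using C by (simp add: add_nonneg_pos)
      then have e': "e' > 0" using that by (simp add: e'_def)
      have "((\<lambda>x. (cmod (u x))\<^sup>2) has_sum (ell2_norm A u)\<^sup>2) A"
        unfolding ell2_norm_square using ell2_summable[OF u] by (rule has_sum_infsum)
      then obtain F where F: "finite F" "F \<subseteq> A" "dist (\<Sum>x\<in>F. (cmod (u x))\<^sup>2) ((ell2_norm A u)\<^sup>2) \<le> e'\<^sup>2"
        using has_sum_finite_approximation[of _ _ _ "e'\<^sup>2"] e' by (metis zero_less_power)
      define w where "w x = (if x \<in> F then u x else 0)" for x
      define r where "r = (\<lambda>x. u x - w x)"
      have w: "w \<in> ell2 A" using F by (intro ell2_finite_support[of F]) (auto simp: w_def)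
      have r: "r \<in> ell2 A" unfolding r_def using u w by (rule ell2_diff)
      have "ell2_inner A u w = (\<Sum>\<^sub>\<infinity>x\<in>F. cnj (u x) * u x)"
        unfolding ell2_inner_def using F by (intro infsum_cong_neutral) (auto simp: w_def)
      moreover have "(ell2_norm A w)\<^sup>2 = (\<Sum>\<^sub>\<infinity>x\<in>F. (cmod (u x))\<^sup>2)"
        unfolding ell2_norm_square using F by (intro infsum_cong_neutral) (auto simp: w_def)
      ultimately have uw: "Re (ell2_inner A u w) = (\<Sum>x\<in>F. (cmod (u x))\<^sup>2)"
        "(ell2_norm A w)\<^sup>2 = (\<Sum>x\<in>F. (cmod (u x))\<^sup>2)"
        using F(1) by (simp_all only: infsum_finite Re_sum Re_cnj_mult)
      have "(ell2_norm A r)\<^sup>2 = (ell2_norm A u)\<^sup>2 - (\<Sum>x\<in>F. (cmod (u x))\<^sup>2)"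
        unfolding r_def using uw by (simp add: ell2_norm_diff_square[OF u w])
      also have "\<dots> \<le> e'\<^sup>2" using F(3) by (simp add: dist_real_def)
      finally have r_le: "ell2_norm A r \<le> e'" by (rule power2_le_imp_le) (use e' in simp)
      have wT: "w = (\<lambda>x. \<Sum>t\<in>F. u t * delta t x)"
        using F by (auto simp: w_def delta_def fun_eq_iff if_distrib cong: if_cong)
      have Hw: "H (\<lambda>x. \<Sum>t\<in>F'. u t * delta t x) = (\<lambda>x. \<Sum>t\<in>F'. u t * H (delta t) x)"
        if "finite F'" for F'
        using that
      proof (induction F' rule: finite_induct)
        case empty
        then show ?case using H_lin[of 0 u 0 u] by simp
      next
        case (insert t F')
        then show ?case using H_lin[of "u t" "delta t" 1 "\<lambda>x. \<Sum>t\<in>F'. u t * delta t x"] by simp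
      qed
      have "ell2_inner A (H v) w = ell2_inner A v (H w)"
      proof -
        have F': "t \<in> A" if "t \<in> F" for t using F that by auto
        have "ell2_inner A w (H v) = (\<Sum>t\<in>F. cnj (u t) * ell2_inner A (delta t) (H v))"
          unfolding wT using F(1) delta_in[OF F'] H_ell2(1)[OF v] by (rule ell2_inner_sum_left)
        also have "\<dots> = (\<Sum>t\<in>F. cnj (u t) * ell2_inner A (H (delta t)) v)"
          using F' by (simp add: ell2_inner_delta delta)
        also have "\<dots> = ell2_inner A (H w) v"
          unfolding wT Hw[OF F(1)]
          using F(1) H_ell2(1)[OF delta_in[OF F']] v by (rule ell2_inner_sum_left[symmetric])
        finally have "ell2_inner A w (H v) = ell2_inner A (H w) v" .
        then show ?thesis
          using ell2.ip_cnj[OF w H_ell2(1)[OF v]] ell2.ip_cnj[OF H_ell2(1)[OF w] v] by simp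
      qed
      moreover have "H u = (\<lambda>x. 1 * H r x + 1 * H w x)"
        using H_lin[of 1 r 1 w] by (simp add: r_def)
      moreover have "ell2_inner A v (\<lambda>x. 1 * H r x + 1 * H w x) = ell2_inner A v (H r) + ell2_inner A v (H w)"
        using ell2.ip_lin[OF v H_ell2(1)[OF r] H_ell2(1)[OF w], of 1 1] by simp
      moreover have "ell2_inner A (H v) u = ell2_inner A (H v) r + ell2_inner A (H v) w"
        using ell2.ip_lin[OF H_ell2(1)[OF v] r w, of 1 1] by (simp add: r_def)
      ultimately have "ell2_inner A (H v) u - ell2_inner A v (H u) =
          ell2_inner A (H v) r - ell2_inner A v (H r)" by simp
      then have "cmod (ell2_inner A (H v) u - ell2_inner A v (H u)) \<le>
          cmod (ell2_inner A (H v) r) + cmod (ell2_inner A v (H r))"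
        using norm_triangle_ineq4 by metis
      also have "\<dots> \<le> (C * ell2_norm A v) * e' + ell2_norm A v * (C * e')"
      proof (rule add_mono)
        show "cmod (ell2_inner A (H v) r) \<le> (C * ell2_norm A v) * e'"
          using ell2_inner_Cauchy_Schwarz[OF H_ell2(1)[OF v] r]
            mult_mono[OF H_ell2(2)[OF v] r_le] C by force
        have "ell2_norm A (H r) \<le> C * e'"
          using H_ell2(2)[OF r] mult_left_mono[OF r_le C] by simp
        then show "cmod (ell2_inner A v (H r)) \<le> ell2_norm A v * (C * e')"
          using ell2_inner_Cauchy_Schwarz[OF v H_ell2(1)[OF r]]
            mult_left_mono[of "ell2_norm A (H r)" "C * e'" "ell2_norm A v"] by force
      qed
      also have "\<dots> = (2 * C * ell2_norm A v) * e'" by simp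
      also have "\<dots> \<le> (2 * C * ell2_norm A v + 1) * e'" using e' by (intro mult_right_mono) auto
      also have "\<dots> = e" using pos by (simp add: e'_def)
      finally show ?thesis by simp
    qed
    then have "cmod (ell2_inner A (H v) u - ell2_inner A v (H u)) \<le> 0" by (rule field_le_epsilon)
    then show ?thesis by simp
  qed
  then show ?thesis
    using ell2.ip_cnj[OF u H_ell2(1)[OF v]] ell2.ip_cnj[OF H_ell2(1)[OF u] v] by simp
qed

definition D :: "('x \<Rightarrow> complex) \<Rightarrow> 'x \<Rightarrow> complex" where
  "D v = (\<lambda>x. H v x - of_real lam * v x)"

sublocale sa: ell2_selfadjoint A D "(C + \<bar>lam\<bar>)\<^sup>2"
proof
  fix u v assume u: "u \<in> ell2 A"
  have lu: "(\<lambda>x. of_real lam * u x) \<in> ell2 A" using u by (rule ell2_scale)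
  show "D u \<in> ell2 A" unfolding D_def using H_ell2(1)[OF u] lu by (rule ell2_diff)
  have "ell2_norm A (\<lambda>x. 1 * H u x + (- of_real lam * u x)) \<le>
      ell2_norm A (\<lambda>x. 1 * H u x) + ell2_norm A (\<lambda>x. - of_real lam * u x)"
    using H_ell2(1)[OF u] u by (intro ell2_norm_triangle ell2_scale)
  also have "\<dots> \<le> C * ell2_norm A u + \<bar>lam\<bar> * ell2_norm A u"
    using H_ell2(2)[OF u] ell2_norm_scale[OF u, of "- of_real lam"] by simp
  finally have "ell2_norm A (D u) \<le> (C + \<bar>lam\<bar>) * ell2_norm A u"
    by (simp add: D_def algebra_simps)
  then show "(ell2_norm A (D u))\<^sup>2 \<le> (C + \<bar>lam\<bar>)\<^sup>2 * (ell2_norm A u)\<^sup>2"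
    by (metis ell2_norm_nonneg power_mono power_mult_distrib)
  assume v: "v \<in> ell2 A"
  have "ell2_inner A (D u) v = ell2_inner A (H u) v - ell2_inner A (\<lambda>x. of_real lam * u x) v"
    unfolding D_def using v H_ell2(1)[OF u] lu by (rule ell2_inner_diff_left)
  also have "ell2_inner A (\<lambda>x. of_real lam * u x) v = ell2_inner A u (\<lambda>x. of_real lam * v x)"
    by (simp add: ell2_inner_def algebra_simps)
  also have "ell2_inner A (H u) v = ell2_inner A u (H v)" using u v by (rule H_sym)
  also have "ell2_inner A u (H v) - ell2_inner A u (\<lambda>x. of_real lam * v x) = ell2_inner A u (D v)"
    unfolding D_def using u H_ell2(1)[OF v] ell2_scale[OF v] by (rule ell2_inner_diff_right[symmetric])
  finally show "ell2_inner A (D u) v = ell2_inner A u (D v)" .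
qed simp

text \<open>The zero cutoff imposes no condition on the support, so the damping construction covers
  the full eigenspace as well.\<close>

abbreviation "eigenspace \<equiv> sa.ker (\<lambda>_. 0)"

lemma eigenspace_iff: "u \<in> eigenspace \<longleftrightarrow> u \<in> ell2 A \<and> H u = (\<lambda>x. of_real lam * u x)"
  by (simp add: sa.ker_def D_def fun_eq_iff)

text \<open>It vanishes exactly on the closed ball of radius \<open>n\<close> around
  \<open>p\<close>, hence \<open>sa.ker (cutoff p n)\<close> consists of the solutions supported
  there. Continuity is what makes multiplication by it respect measurable sections.\<close>

definition cutoff :: "'x \<Rightarrow> nat \<Rightarrow> 'x \<Rightarrow> real" where
  "cutoff p n = (\<lambda>x. min 1 (max 0 (dist p x - real n)))"

lemma cutoff: "0 \<le> cutoff p n x" "cutoff p n x \<le> 1" "cutoff p n x \<noteq> 0 \<longleftrightarrow> real n < dist p x"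
  by (auto simp: cutoff_def)

abbreviation "solutions \<equiv> compact_solutions \<iota> lam \<omega>"

lemma solutions_eq: "solutions = (\<Union>n. sa.ker (cutoff p n))"
proof (intro equalityI subsetI)
  fix u assume u: "u \<in> solutions"
  then obtain K where K: "compact K" "{x. u x \<noteq> 0} \<subseteq> K" by (auto simp: compact_solutions_def)
  obtain r where "\<And>x. x \<in> K \<Longrightarrow> dist p x \<le> r" using compact_imp_bounded[OF K(1)] by (meson bounded_any_center)
  moreover obtain n where "r \<le> real n" using real_arch_simple by blast
  ultimately have "u \<in> sa.ker (cutoff p n)"
    using u K(2) unfolding sa.ker_def cutoff(3) by (force simp: D_def compact_solutions_def fun_eq_iff)
  then show "u \<in> (\<Union>n. sa.ker (cutoff p n))" by blast
next
  fix u assume "u \<in> (\<Union>n. sa.ker (cutoff p n))"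
  then obtain n where u: "u \<in> sa.ker (cutoff p n)" by blast
  then have "{x. u x \<noteq> 0} \<subseteq> cball p (real n)"
    unfolding sa.ker_def cutoff(3) by (auto simp: not_less[symmetric])
  then have "\<exists>K. compact K \<and> {x. u x \<noteq> 0} \<subseteq> K" using proper by blast
  then show "u \<in> solutions" using u by (simp add: sa.ker_def compact_solutions_def D_def fun_eq_iff)
qed

lemma solutions_eigenspace: "solutions \<subseteq> eigenspace"
  using solutions_eq[of undefined] by (auto simp: sa.ker_def)

abbreviation "comp_space \<equiv> closed_span A solutions"

text \<open>Each projection onto \<open>sa.ker (cutoff p n)\<close> is itself a compactly supported
  solution, so the limit lies in the closed span. The remainder is orthogonal to every kernel in the
  chain, hence to their closed span.\<close>

lemma comp_space_has_proj: "ell2_has_proj A comp_space"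
  and comp_proj_tendsto: "v \<in> ell2 A \<Longrightarrow>
    (\<lambda>n. ell2_norm A (\<lambda>x. ell2_proj A (sa.ker (cutoff p n)) v x - ell2_proj A comp_space v x)) \<longlonglongrightarrow> 0"
proof -
  let ?U = "\<lambda>n. sa.ker (cutoff p n)"
  let ?w = "\<lambda>v x. lim (\<lambda>n. ell2_proj A (?U n) v x)"
  have proj: "ell2_has_proj A (?U n)" for n using cutoff(1,2) by (rule sa.ker_has_proj)
  have mono: "?U k \<subseteq> ?U n" if "k \<le> n" for k n
    unfolding sa.ker_def cutoff(3) using that by force
  note lim = ell2_proj_chain_limit[of A ?U, OF proj mono]
  have sub: "comp_space \<subseteq> ell2 A" by (auto simp: closed_span_def)
  have mem: "?w v \<in> comp_space" if v: "v \<in> ell2 A" for v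
    unfolding closed_span_def
  proof (intro CollectI conjI allI impI)
    show "?w v \<in> ell2 A" using lim(1)[OF _ v] by simp
    fix e :: real assume "e > 0"
    then obtain n where "ell2_norm A (\<lambda>x. ell2_proj A (?U n) v x - ?w v x) < e"
      using LIMSEQ_D[OF lim(2)[OF _ v] \<open>e > 0\<close>] by fastforce
    moreover have "ell2_proj A (?U n) v \<in> solutions"
      using ell2_proj(1)[OF proj v] solutions_eq by blast
    ultimately show "\<exists>T c. finite T \<and> T \<subseteq> solutions \<and> ell2_norm A (\<lambda>x. ?w v x - (\<Sum>u\<in>T. c u * u x)) < e"
      by (intro exI[of _ "{ell2_proj A (?U n) v}"] exI[of _ "\<lambda>_. 1"]) (simp add: ell2_norm_minus_commute)
  qed
  have orth: "ell2_inner A u (\<lambda>x. v x - ?w v x) = 0" if v: "v \<in> ell2 A" and u: "u \<in> comp_space" for u v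
  proof (rule closed_span_orth[OF _ _ _ u])
    show "solutions \<subseteq> ell2 A" by (auto simp: compact_solutions_def)
    show "(\<lambda>x. v x - ?w v x) \<in> ell2 A" using v mem[OF v] sub by (intro ell2_diff) auto
    show "ell2_inner A s (\<lambda>x. v x - ?w v x) = 0" if "s \<in> solutions" for s
      using that lim(3)[OF _ v] unfolding solutions_eq[of p] by auto
  qed
  show "ell2_has_proj A comp_space"
    by (rule ell2_has_projI[where p = ?w, OF sub mem orth])
  assume v: "v \<in> ell2 A"
  have "ell2_proj A comp_space v = ?w v" using sub v mem[OF v] orth[OF v] by (rule ell2_projI)
  then show "(\<lambda>n. ell2_norm A (\<lambda>x. ell2_proj A (?U n) v x - ell2_proj A comp_space v x)) \<longlonglongrightarrow> 0"
    using lim(2)[OF _ v] by simp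
qed

lemma eigenspace_has_proj: "ell2_has_proj A eigenspace"
  by (rule sa.ker_has_proj) auto

lemma eigenspace_closed_lin: "u \<in> eigenspace \<Longrightarrow> v \<in> eigenspace \<Longrightarrow> (\<lambda>x. a * u x + b * v x) \<in> eigenspace"
  by (simp add: sa.ker_def ell2_lin sa.D_lin fun_eq_iff)

text \<open>The eigenspace is closed, expressed through its projection: the component of
  \<open>u\<close> orthogonal to it is orthogonal to all solutions, therefore to \<open>u\<close>,
  therefore to itself.\<close>

lemma comp_space_eigenspace: "comp_space \<subseteq> eigenspace"
proof
  fix u assume u: "u \<in> comp_space"
  have u2: "u \<in> ell2 A" using u by (simp add: closed_span_def)
  have p2: "ell2_proj A eigenspace u \<in> ell2 A" using eigenspace_has_proj u2 by (rule ell2_proj_in)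
  define d where "d = (\<lambda>x. u x - ell2_proj A eigenspace u x)"
  have d: "d \<in> ell2 A" unfolding d_def using u2 p2 by (rule ell2_diff)
  have "ell2_inner A u d = 0"
  proof (rule closed_span_orth[OF _ d _ u])
    show "solutions \<subseteq> ell2 A" by (auto simp: compact_solutions_def)
    show "ell2_inner A s d = 0" if "s \<in> solutions" for s
      unfolding d_def using eigenspace_has_proj u2 by (rule ell2_proj(2)) (use that solutions_eigenspace in blast)
  qed
  moreover have "ell2_inner A (ell2_proj A eigenspace u) d = 0"
    unfolding d_def using ell2_proj(2)[OF eigenspace_has_proj u2 ell2_proj(1)[OF eigenspace_has_proj u2]] .
  ultimately have "ell2_inner A d d = 0"
    using ell2_inner_diff_left[OF d u2 p2] by (simp add: d_def)
  then have "ell2_norm A d = 0" using d by (simp add: ell2_inner_self)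
  then have "u = ell2_proj A eigenspace u" using ell2_norm_eq_0D[OF d] by (simp add: d_def fun_eq_iff)
  then show "u \<in> eigenspace" using ell2_proj(1)[OF eigenspace_has_proj u2] by simp
qed

section \<open>The orthogonal complement of the compactly supported solutions in the
  eigenspace\<close>

definition defect :: "('x \<Rightarrow> complex) set" where
  "defect = {u \<in> eigenspace. \<forall>s\<in>solutions. ell2_inner A s u = 0}"

text \<open>Since \<open>comp_space\<close> is contained in \<open>eigenspace\<close>, the
  projection onto the relative complement is a difference. Both terms are limits of damping
  iterations, so this formula also yields its measurability.\<close>

lemma defect_has_proj: "ell2_has_proj A defect"
  and defect_proj: "v \<in> ell2 A \<Longrightarrow>
    ell2_proj A defect v = (\<lambda>x. ell2_proj A eigenspace v x - ell2_proj A comp_space v x)"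
proof -
  let ?q = "\<lambda>v x. ell2_proj A eigenspace v x - ell2_proj A comp_space v x"
  have sub: "defect \<subseteq> ell2 A" by (auto simp: defect_def sa.ker_def)
  have mem: "?q v \<in> defect" and orth: "u \<in> defect \<Longrightarrow> ell2_inner A u (\<lambda>x. v x - ?q v x) = 0"
    if v: "v \<in> ell2 A" for u v
  proof -
    note p = ell2_proj_in[OF eigenspace_has_proj v] ell2_proj_in[OF comp_space_has_proj v]
    have "?q v \<in> eigenspace"
      using eigenspace_closed_lin[of "ell2_proj A eigenspace v" "ell2_proj A comp_space v" 1 "- 1"]
        ell2_proj(1)[OF eigenspace_has_proj v] ell2_proj(1)[OF comp_space_has_proj v] comp_space_eigenspace by auto
    moreover have "ell2_inner A s (?q v) = 0" if s: "s \<in> solutions" for s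
    proof -
      have s2: "s \<in> ell2 A" using s by (simp add: compact_solutions_def)
      have "s \<in> comp_space"
        unfolding closed_span_def
      proof (intro CollectI conjI allI impI s2)
        show "\<exists>T c. finite T \<and> T \<subseteq> solutions \<and> ell2_norm A (\<lambda>x. s x - (\<Sum>u\<in>T. c u * u x)) < e"
          if "e > 0" for e :: real
          using s that by (intro exI[of _ "{s}"] exI[of _ "\<lambda>_. 1"]) (simp add: ell2_norm_def)
      qed
      then show ?thesis
        using s solutions_eigenspace s2 p ell2_inner_proj[OF eigenspace_has_proj v, of s]
          ell2_inner_proj[OF comp_space_has_proj v, of s]
        by (auto simp: ell2_inner_diff_right)
    qed
    ultimately show "?q v \<in> defect" by (simp add: defect_def)
    assume u: "u \<in> defect"
    then have u2: "u \<in> ell2 A" "u \<in> eigenspace" using sub by (auto simp: defect_def)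
    have pc: "ell2_inner A (ell2_proj A comp_space v) u = 0"
    proof (rule closed_span_orth)
      show "solutions \<subseteq> ell2 A" by (auto simp: compact_solutions_def)
      show "ell2_proj A comp_space v \<in> comp_space" using ell2_proj(1)[OF comp_space_has_proj v] .
    qed (use u u2 in \<open>auto simp: defect_def\<close>)
    have "ell2_inner A u (?q v) = ell2_inner A u v"
      using u2 p pc ell2.ip_cnj[OF p(2) u2(1)] ell2_inner_proj[OF eigenspace_has_proj v u2(2)]
      by (simp add: ell2_inner_diff_right)
    then show "ell2_inner A u (\<lambda>x. v x - ?q v x) = 0"
      using u2 v p by (simp add: ell2_inner_diff_right[OF u2(1)] ell2_diff)
  qed
  show "ell2_has_proj A defect" by (rule ell2_has_projI[where p = ?q, OF sub mem orth])
  show "ell2_proj A defect v = ?q v" if v: "v \<in> ell2 A"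
    using sub v mem[OF v] orth[OF v] by (rule ell2_projI)
qed

text \<open>If \<open>k\<close> vanishes on the outer boundary \<open>B\<close> of \<open>\<Lambda>\<close>, then its restriction \<open>u\<close> to \<open>\<Lambda>\<close> is a
  compactly supported solution, so \<open>\<parallel>u\<parallel>\<^sup>2 = \<langle>u, k\<rangle> = 0\<close>.\<close>

lemma defect_trace_le:
  assumes \<Lambda>: "bounded \<Lambda>" and B: "finite {x \<in> A. x \<notin> \<Lambda> \<and> (\<exists>y\<in>\<Lambda>. dist x y < 2 * R)}"
  shows "(\<Sum>x\<in>A \<inter> \<Lambda>. Re (ell2_proj A defect (delta x) x)) \<le>
    card {x \<in> A. x \<notin> \<Lambda> \<and> (\<exists>y\<in>\<Lambda>. dist x y < 2 * R)}"
proof (rule trace_le_card[OF B _ finite_bounded[OF \<Lambda>] _ defect_has_proj])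
  fix u v a b assume uv: "u \<in> defect" "v \<in> defect"
  then have "u \<in> ell2 A" "v \<in> ell2 A" by (auto simp: defect_def sa.ker_def)
  then have "ell2_inner A s (\<lambda>x. a * u x + b * v x) = 0" if "s \<in> solutions" for s
    using uv that by (subst ell2.ip_lin) (auto simp: defect_def compact_solutions_def)
  moreover have "(\<lambda>x. a * u x + b * v x) \<in> eigenspace"
    using uv by (intro eigenspace_closed_lin) (simp_all add: defect_def)
  ultimately show "(\<lambda>x. a * u x + b * v x) \<in> defect" by (simp add: defect_def)
next
  fix k assume k: "k \<in> defect" and van: "\<forall>x\<in>{x \<in> A. x \<notin> \<Lambda> \<and> (\<exists>y\<in>\<Lambda>. dist x y < 2 * R)}. k x = 0"
  have k2: "k \<in> ell2 A" and Hk: "H k x = of_real lam * k x" for x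
    using k by (auto simp: defect_def eigenspace_iff)
  define u where "u x = (if x \<in> \<Lambda> then k x else 0)" for x
  have u2: "u \<in> ell2 A"
    using finite_bounded[OF \<Lambda>] ell2_outside[OF k2] by (intro ell2_finite_support[of "A \<inter> \<Lambda>"]) (auto simp: u_def)
  \<comment> \<open>Restriction to \<Lambda> changes nothing within distance \<open>2 * R\<close> of
    \<Lambda>, because \<open>k\<close> vanishes on the strip.\<close>
  have near: "k y = u y" if "y \<in> A" "z \<in> \<Lambda>" "dist y z < 2 * R" for y z
    using van that by (auto simp: u_def)
  have "H u x = of_real lam * u x" for x
  proof (cases "x \<in> A")
    case True
    show ?thesis
    proof (cases "x \<in> \<Lambda>")
      case inside: True
      have "k y = u y" if "y \<in> A \<inter> ball x R" for y
        using that near[of y x] inside R by (simp add: dist_commute)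
      then have "H u x = H k x" using True by (simp add: H_eq_ball)
      then show ?thesis using Hk inside by (simp add: u_def)
    next
      case outside: False
      show ?thesis
      proof (cases "\<exists>z\<in>A \<inter> ball x R. z \<in> \<Lambda>")
        case False
        then have "u y = 0" if "y \<in> A \<inter> ball x R" for y using that by (auto simp: u_def)
        then show ?thesis using True outside by (simp add: H_eq_ball u_def)
      next
        case ex: True
        then obtain z where z: "z \<in> \<Lambda>" "dist x z < R" by auto
        \<comment> \<open>This is why the strip has twice the range: \<open>x\<close> is within
          \<open>R\<close> of \<Lambda>, and \<open>H\<close> at \<open>x\<close> sees points at a
          further distance below \<open>R\<close>.\<close>
        have "k y = u y" if "y \<in> A \<inter> ball x R" for y
          using that near[of y z] z dist_triangle3[of y z x] by (simp add: dist_commute)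
        then have "H u x = H k x" using True by (simp add: H_eq_ball)
        moreover have "k x = u x" using near[of x z] True z R by simp
        ultimately show ?thesis using Hk by simp
      qed
    qed
  next
    case False
    then show ?thesis using ell2_outside[OF u2] by (simp add: H_outside)
  qed
  moreover have "\<exists>K. compact K \<and> {x. u x \<noteq> 0} \<subseteq> K"
  proof -
    obtain p :: 'x and r where "\<Lambda> \<subseteq> cball p r" using \<Lambda> bounded_subset_cball by blast
    then have "{x. u x \<noteq> 0} \<subseteq> cball p r" by (auto simp: u_def)
    then show ?thesis using proper by blast
  qed
  ultimately have "u \<in> solutions" using u2 by (simp add: compact_solutions_def fun_eq_iff)
  then have "ell2_inner A u k = 0" using k by (simp add: defect_def)
  moreover have "ell2_inner A u k = ell2_inner A u u"
    unfolding ell2_inner_def by (intro infsum_cong) (simp add: u_def)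
  ultimately have "ell2_norm A u = 0" using u2 by (simp add: ell2_inner_self)
  then show "\<forall>x\<in>A \<inter> \<Lambda>. k x = 0" using ell2_norm_eq_0D[OF u2] by (metis IntD2 u_def)
qed auto

text \<open>A diagonal entry of a projection is the squared norm of its column, so a vanishing
  diagonal annihilates the whole projection.\<close>

lemma eigenspace_eq_comp_space:
  assumes "\<And>x. x \<in> A \<Longrightarrow> ell2_proj A defect (delta x) x = 0"
  shows "eigenspace = comp_space"
proof
  have Q: "ell2_proj A defect (delta x) y = 0" if "x \<in> A" for x y
  proof (rule ell2_norm_eq_0D[where u = "ell2_proj A defect (delta x)" and A = A])
    show "ell2_proj A defect (delta x) \<in> ell2 A" using ell2_proj_in[OF defect_has_proj] that by auto
    show "ell2_norm A (ell2_proj A defect (delta x)) = 0"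
      using delta_proj_diag[OF defect_has_proj that] assms[OF that] by simp
  qed
  show "eigenspace \<subseteq> comp_space"
  proof
    fix u assume u: "u \<in> eigenspace"
    then have u2: "u \<in> ell2 A" by (simp add: eigenspace_iff)
    have "ell2_proj A defect u x = 0" if x: "x \<in> A" for x
    proof -
      have "ell2_proj A defect u x = ell2_inner A (delta x) (ell2_proj A defect u)"
        using x by (simp add: ell2_inner_delta)
      also have "\<dots> = ell2_inner A (ell2_proj A defect (delta x)) u"
        using ell2_proj_sym[OF defect_has_proj delta_in[OF x] u2] by simp
      also have "\<dots> = 0" using Q[OF x] by (simp add: ell2_inner_def)
      finally show ?thesis .
    qed
    then have "ell2_proj A eigenspace u x = ell2_proj A comp_space u x" for x
      using defect_proj[OF u2] ell2_outside[OF ell2_proj_in[OF eigenspace_has_proj u2]]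
        ell2_outside[OF ell2_proj_in[OF comp_space_has_proj u2]]
      by (cases "x \<in> A") (auto simp: fun_eq_iff)
    moreover have "ell2_proj A eigenspace u = u" using eigenspace_has_proj u by (rule ell2_proj_id)
    ultimately have "u = ell2_proj A comp_space u" by (simp add: fun_eq_iff)
    then show "u \<in> comp_space" using ell2_proj(1)[OF comp_space_has_proj u2] by simp
  qed
qed (rule comp_space_eigenspace)

end

section \<open>A countable partition into small pieces\<close>

lemma dense_sequence:
  obtains d :: "nat \<Rightarrow> 'x::{metric_space,second_countable_topology}"
  where "\<forall>x. \<forall>e>0. \<exists>n. dist (d n) x < e"
proof -
  obtain D :: "'x set" where D: "countable D" "\<And>X. open X \<Longrightarrow> X \<noteq> {} \<Longrightarrow> \<exists>d\<in>D. d \<in> X"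
    using countable_dense_setE by blast
  have "D \<noteq> {}" using D(2)[of UNIV] by auto
  have "\<exists>n. dist (from_nat_into D n) x < e" if "e > 0" for x e
  proof -
    have "\<exists>y\<in>D. y \<in> ball x e" by (rule D(2)) (use that in auto)
    then obtain y where y: "y \<in> D" "y \<in> ball x e" by blast
    then obtain n where "from_nat_into D n = y" using from_nat_into_surj[OF D(1)] by blast
    then show ?thesis using y(2) by (metis dist_commute mem_ball)
  qed
  then show thesis by (intro that[of "from_nat_into D"]) blast
qed

text \<open>The squares of the functions form a partition of unity, telescoping as
  \<open>\<Sum>\<^sub>n\<^sub><\<^sub>N \<psi>\<^sub>n\<^sup>2 = 1 - \<Prod>\<^sub>n\<^sub><\<^sub>N (1 - u\<^sub>n)\<close> for bump functions \<open>u\<^sub>n\<close> around the points of a dense sequence.\<close>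

lemma square_partition:
  obtains \<psi> :: "nat \<Rightarrow> 'x::{metric_space,second_countable_topology} \<Rightarrow> real"
  where "\<And>n. continuous_on UNIV (\<psi> n)" "\<And>n. \<exists>p. \<forall>x. \<psi> n x \<noteq> 0 \<longrightarrow> dist p x < 1 / 2"
    "\<And>x. (\<lambda>n. (\<psi> n x)\<^sup>2) sums 1"
proof -
  obtain d :: "nat \<Rightarrow> 'x" where d: "\<forall>x. \<forall>e>0. \<exists>n. dist (d n) x < e"
    by (rule dense_sequence)
  \<comment> \<open>Equal to 1 within distance 1/4 of \<open>d n\<close> and to 0 from distance 1/2
    on. The first makes the partial products vanish eventually, the second gives the small
    supports.\<close>
  define u where "u n x = min 1 (max 0 (2 - 4 * dist (d n) x))" for n x
  define w where "w n x = u n x * (\<Prod>k<n. 1 - u k x)" for n x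
  have u: "0 \<le> u n x" "u n x \<le> 1" for n x by (auto simp: u_def)
  have w: "0 \<le> w n x" for n x unfolding w_def using u by (intro mult_nonneg_nonneg prod_nonneg) auto
  have sum: "(\<Sum>n<N. w n x) = 1 - (\<Prod>k<N. 1 - u k x)" for N x
    by (induction N) (simp_all add: w_def algebra_simps)
  show thesis
  proof (rule that[of "\<lambda>n x. sqrt (w n x)"])
    show "continuous_on UNIV (\<lambda>x. sqrt (w n x))" for n
      unfolding w_def u_def by (intro continuous_intros)
    show "\<exists>p. \<forall>x. sqrt (w n x) \<noteq> 0 \<longrightarrow> dist p x < 1 / 2" for n
      by (intro exI[of _ "d n"]) (auto simp: w_def u_def min_def max_def split: if_splits)
    show "(\<lambda>n. (sqrt (w n x))\<^sup>2) sums 1" for x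
    proof -
      obtain m where m: "dist (d m) x < 1 / 4" using d[rule_format, of "1 / 4" x] by auto
      have "(\<Sum>n<N. w n x) = 1" if "N > m" for N
      proof -
        have "(\<Prod>k<N. 1 - u k x) = 0"
          using that m by (intro prod_zero) (auto intro!: bexI[of _ m] simp: u_def)
        then show ?thesis by (simp add: sum)
      qed
      then have "(\<lambda>N. \<Sum>n<N. w n x) \<longlonglongrightarrow> 1"
        by (intro tendsto_eventually eventually_sequentiallyI[of "Suc m"]) auto
      then show ?thesis using w by (simp add: sums_def)
    qed
  qed
qed

lemma separated_unique:
  assumes "separated 1 A" "x \<in> A" "y \<in> A" "dist p x < 1 / 2" "dist p y < 1 / 2"
  shows "x = y"
proof (rule ccontr)
  assume "x \<noteq> y"
  then have "1 \<le> dist x y" using assms by (auto simp: pairwise_def)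
  then show False using dist_triangle3[of x y p] assms by simp
qed

lemma separated_ball:
  assumes "separated 1 A" "x \<in> A" "dist p x < 1 / 2"
  shows "A \<inter> ball p (1 / 2) = {x}"
proof (intro equalityI subsetI)
  fix y assume "y \<in> A \<inter> ball p (1 / 2)"
  then have "y = x" by (intro separated_unique[OF assms(1) _ assms(2) _ assms(3)]) auto
  then show "y \<in> {x}" by simp
qed (use assms in simp)

text \<open>Each support meets the separated set in at most one point, so each inner product is a
  single term; summing over \<open>n\<close> first gives \<open>(cmod (v x))\<^sup>2\<close>. The
  basis of point masses varies with the configuration, whereas the functions \<open>\<psi> n\<close>
  do not: the norm becomes a countable sum of admissible measurable functions.\<close>

lemma ell2_norm_sums:
  assumes A: "separated 1 (A :: 'x::metric_space set)" and v: "v \<in> ell2 A"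
    and small: "\<And>n. \<exists>p. \<forall>x. \<psi> n x \<noteq> 0 \<longrightarrow> dist p x < 1 / 2" and one: "\<And>x. (\<lambda>n. (\<psi> n x)\<^sup>2) sums 1"
  shows "(\<lambda>n. (cmod (ell2_inner A (\<lambda>x. complex_of_real (\<psi> n x)) v))\<^sup>2) sums (ell2_norm A v)\<^sup>2"
proof -
  define f where "f = (\<lambda>(x, n). (\<psi> n x)\<^sup>2 * (cmod (v x))\<^sup>2)"
  have row: "((\<lambda>n. f (x, n)) has_sum (cmod (v x))\<^sup>2) UNIV" for x
    using sums_mult2[OF one[of x], of "(cmod (v x))\<^sup>2"]
    by (intro sums_nonneg_imp_has_sum) (simp_all add: f_def)
  have total: "((\<lambda>x. (cmod (v x))\<^sup>2) has_sum (ell2_norm A v)\<^sup>2) A"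
    unfolding ell2_norm_square using ell2_summable[OF v] by (rule has_sum_infsum)
  have "f summable_on A \<times> UNIV"
    using row has_sum_imp_summable[OF total] by (rule summable_on_SigmaI) (auto simp: f_def)
  with row total have "(f has_sum (ell2_norm A v)\<^sup>2) (A \<times> UNIV)" by (rule has_sum_SigmaI)
  then have swapped: "((\<lambda>(n, x). f (x, n)) has_sum (ell2_norm A v)\<^sup>2) (UNIV \<times> A)"
    by (subst (asm) has_sum_swap)
  have col: "((\<lambda>x. f (x, n)) has_sum (cmod (ell2_inner A (\<lambda>x. complex_of_real (\<psi> n x)) v))\<^sup>2) A" for n
  proof -
    obtain p where p: "\<And>x. \<psi> n x \<noteq> 0 \<Longrightarrow> dist p x < 1 / 2" using small by blast
    show ?thesis
    proof (cases "\<exists>x\<in>A. \<psi> n x \<noteq> 0")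
      case True
      then obtain x where x: "x \<in> A" "\<psi> n x \<noteq> 0" by blast
      have z: "\<psi> n y = 0" if "y \<in> A" "y \<noteq> x" for y
        using separated_unique[OF A x(1) that(1) p[OF x(2)]] p[of y] that(2) by blast
      have "ell2_inner A (\<lambda>x. complex_of_real (\<psi> n x)) v = (\<Sum>\<^sub>\<infinity>y\<in>{x}. cnj (of_real (\<psi> n y)) * v y)"
        unfolding ell2_inner_def using x z by (intro infsum_cong_neutral) auto
      then have eq: "ell2_inner A (\<lambda>x. complex_of_real (\<psi> n x)) v = of_real (\<psi> n x) * v x" by simp
      have "((\<lambda>x. f (x, n)) has_sum f (x, n)) {x}" by (rule has_sum_finiteI) simp_all
      then have "((\<lambda>x. f (x, n)) has_sum f (x, n)) A"
        by (rule has_sum_cong_neutral[THEN iffD1, rotated -1]) (use x z in \<open>auto simp: f_def\<close>)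
      then show ?thesis by (simp add: eq f_def norm_mult power_mult_distrib)
    next
      case False
      then have "ell2_inner A (\<lambda>x. complex_of_real (\<psi> n x)) v = 0"
        unfolding ell2_inner_def by (intro infsum_0) auto
      moreover have "((\<lambda>x. f (x, n)) has_sum 0) A" using False by (intro has_sum_0) (auto simp: f_def)
      ultimately show ?thesis by simp
    qed
  qed
  have "((\<lambda>n. (cmod (ell2_inner A (\<lambda>x. complex_of_real (\<psi> n x)) v))\<^sup>2) has_sum (ell2_norm A v)\<^sup>2) UNIV"
    by (rule has_sum_SigmaD[OF swapped]) (use col in simp)
  then show ?thesis by (rule has_sum_imp_sums)
qed

text \<open>Test functions do not vanish off \<open>A\<close>, so they are not members of
  \<open>ell2 A\<close>. Truncation gives the element that has the same inner products with all
  vectors.\<close>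

definition trunc :: "'x set \<Rightarrow> ('x \<Rightarrow> complex) \<Rightarrow> 'x \<Rightarrow> complex" where
  "trunc A \<phi> = (\<lambda>x. if x \<in> A then \<phi> x else 0)"

lemma ell2_inner_trunc: "ell2_inner A (trunc A \<phi>) v = ell2_inner A \<phi> v"
  unfolding ell2_inner_def by (intro infsum_cong) (simp add: trunc_def)

text \<open>The support is so small that it contains at most one point of a configuration. After
  truncation the bump is a multiple of a single point mass, or zero.\<close>

definition bump :: "'x::metric_space \<Rightarrow> 'x \<Rightarrow> complex" where
  "bump p = (\<lambda>x. complex_of_real (max 0 (1 / 2 - dist p x)))"

lemma trunc_bump:
  assumes "separated 1 A"
  shows "x \<in> A \<Longrightarrow> dist p x < 1 / 2 \<Longrightarrow> trunc A (bump p) = (\<lambda>y. bump p x * delta x y)"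
    and "(\<And>x. x \<in> A \<Longrightarrow> 1 / 2 \<le> dist p x) \<Longrightarrow> trunc A (bump p) = (\<lambda>_. 0)"
proof -
  have zero: "bump p y = 0" if "1 / 2 \<le> dist p y" for y using that by (simp add: bump_def)
  show "trunc A (bump p) = (\<lambda>y. bump p x * delta x y)" if x: "x \<in> A" "dist p x < 1 / 2"
  proof
    fix y
    have "bump p y = 0" if "y \<in> A" "y \<noteq> x"
    proof (rule zero, rule ccontr)
      assume "\<not> 1 / 2 \<le> dist p y"
      then show False using separated_unique[OF assms x(1) that(1) x(2)] that(2) by simp
    qed
    then show "trunc A (bump p) y = bump p x * delta x y"
      using x(1) by (simp add: trunc_def delta_def)
  qed
  show "trunc A (bump p) = (\<lambda>_. 0)" if "\<And>x. x \<in> A \<Longrightarrow> 1 / 2 \<le> dist p x"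
    using zero that by (simp add: trunc_def fun_eq_iff)
qed

section \<open>Random operators\<close>

locale random_operator = amenable_action act haar F a b
  for act :: "'g::{topological_group_add,metric_space} \<Rightarrow>
                'x::{metric_space,second_countable_topology} \<Rightarrow> 'x"
    and haar :: "'g measure" and F :: "'x set" and a b :: real +
  fixes \<iota> :: "complex \<Rightarrow> 'c::t2_space" and \<mu> :: "('x, 'c) conf measure" and C R :: real
  assumes compact_c: "compact (UNIV :: 'c set)"
    and prob: "prob_space \<mu>"
    and regular: "regular_borel_measure vague_topology \<mu>"
    and invariant: "\<forall>g. distr \<mu> \<mu> (act_conf act g) = \<mu>"
    and bounded_op: "\<And>\<omega> v. \<omega> \<in> supp_conf \<mu> \<Longrightarrow> finite {x. v x \<noteq> 0} \<Longrightarrow> {x. v x \<noteq> 0} \<subseteq> fst \<omega> \<Longrightarrow>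
        hamiltonian \<iota> \<omega> v \<in> ell2 (fst \<omega>) \<and>
        ell2_norm (fst \<omega>) (hamiltonian \<iota> \<omega> v) \<le> C * ell2_norm (fst \<omega>) v"
    and finite_range: "\<And>\<omega> x y. \<omega> \<in> supp_conf \<mu> \<Longrightarrow> x \<in> fst \<omega> \<Longrightarrow> y \<in> fst \<omega> \<Longrightarrow>
        R \<le> dist x y \<Longrightarrow> matrix_element \<iota> \<omega> x y = 0"
    and C_nonneg: "C \<ge> 0" and R_pos: "R > 0"
    and selfadj: "selfadjoint_on (sections \<mu>) (sections_inner \<mu>) (direct_integral_op \<mu> (hamiltonian \<iota>))"
begin

sublocale prob_space \<mu> by (rule prob)

abbreviation "\<Omega> \<equiv> supp_conf \<mu>"
abbreviation "M \<equiv> restrict_space \<mu> \<Omega>"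

lemma topspace_vague: "topspace (vague_topology :: ('x, 'c) conf topology) = configurations"
proof -
  have "(\<lambda>_. 0) \<in> Cc" by (simp add: Cc_def)
  then have "{\<omega> \<in> configurations. vague_eval (\<lambda>_. 0) \<omega> \<in> UNIV} \<in>
      {{\<omega> \<in> configurations. vague_eval \<phi> \<omega> \<in> U} |\<phi> U. \<phi> \<in> Cc \<and> open U}" by blast
  then show ?thesis unfolding vague_topology_def topology_generated_by_topspace by auto
qed

lemma space_\<mu>: "space \<mu> = configurations"
  using regular topspace_vague by (simp add: regular_borel_measure_def)

lemma openin_sets: "openin vague_topology U \<Longrightarrow> U \<in> sets \<mu>"
  using regular by (auto simp: regular_borel_measure_def intro: sigma_sets.Basic)

lemma vague_eval_measurable: "\<phi> \<in> Cc \<Longrightarrow> vague_eval \<phi> \<in> borel_measurable \<mu>"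
proof (rule borel_measurableI)
  fix S :: "complex set" assume "\<phi> \<in> Cc" "open S"
  then have "openin vague_topology {\<omega> \<in> configurations. vague_eval \<phi> \<omega> \<in> S}"
    unfolding vague_topology_def by (intro topology_generated_by_Basis) blast
  moreover have "vague_eval \<phi> -` S \<inter> space \<mu> = {\<omega> \<in> configurations. vague_eval \<phi> \<omega> \<in> S}"
    by (auto simp: space_\<mu>)
  ultimately show "vague_eval \<phi> -` S \<inter> space \<mu> \<in> sets \<mu>" by (simp add: openin_sets)
qed

lemma null_open: "\<Omega> \<subseteq> space \<mu>" "openin vague_topology (space \<mu> - \<Omega>)"
proof -
  show "\<Omega> \<subseteq> space \<mu>" by (auto simp: topological_support_def topspace_vague space_\<mu>)
  have sub: "U \<subseteq> configurations" if "openin vague_topology U" for U :: "('x, 'c) conf set"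
    using openin_subset[OF that] by (simp add: topspace_vague)
  have "\<omega> \<in> space \<mu> - \<Omega> \<longleftrightarrow> \<omega> \<in> \<Union>{U. openin vague_topology U \<and> emeasure \<mu> U = 0}" for \<omega>
    unfolding topological_support_def topspace_vague space_\<mu> zero_less_iff_neq_zero using sub by blast
  then have "space \<mu> - \<Omega> = \<Union>{U. openin vague_topology U \<and> emeasure \<mu> U = 0}" by blast
  then show "openin vague_topology (space \<mu> - \<Omega>)" by (metis (no_types, lifting) mem_Collect_eq openin_Union)
qed

lemma support_sets: "\<Omega> \<in> sets \<mu>"
  using openin_sets[OF null_open(2)] null_open(1) by (metis Diff_Diff_Int inf.absorb2 sets.compl_sets)

text \<open>The complement of the support is a union of possibly uncountably many open null sets.
  Inner regularity reduces the claim to compact sets, which finitely many of them cover.\<close>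

lemma support_null: "space \<mu> - \<Omega> \<in> null_sets \<mu>"
proof (rule null_setsI)
  show sets: "space \<mu> - \<Omega> \<in> sets \<mu>" using support_sets by auto
  have "emeasure \<mu> K = 0" if K: "compactin vague_topology K" "K \<subseteq> space \<mu> - \<Omega>" for K
  proof -
    let ?U = "{U. openin vague_topology U \<and> emeasure \<mu> U = 0}"
    have "K \<subseteq> \<Union>?U"
    proof
      fix \<omega> assume "\<omega> \<in> K"
      then have "\<omega> \<in> topspace vague_topology" "\<omega> \<notin> \<Omega>" using K by (auto simp: space_\<mu> topspace_vague)
      then show "\<omega> \<in> \<Union>?U" by (auto simp: topological_support_def zero_less_iff_neq_zero)
    qed
    then obtain \<F> where \<F>: "finite \<F>" "\<F> \<subseteq> ?U" "K \<subseteq> \<Union>\<F>"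
      using K(1) unfolding compactin_def by (metis (no_types, lifting) mem_Collect_eq)
    have "\<Union>\<F> \<in> null_sets \<mu>"
      using \<F>(1,2) openin_sets null_sets_UN'[of \<F> "\<lambda>U. U" \<mu>] by (auto intro: countable_finite)
    moreover from this have "\<Union>\<F> \<in> sets \<mu>" by (rule null_setsD2)
    ultimately show ?thesis using emeasure_mono[OF \<F>(3), of \<mu>] by (simp add: null_setsD1)
  qed
  moreover have "emeasure \<mu> (space \<mu> - \<Omega>) =
      (SUP K\<in>{K. compactin vague_topology K \<and> K \<subseteq> space \<mu> - \<Omega>}. emeasure \<mu> K)"
    using regular sets unfolding regular_borel_measure_def by blast
  ultimately have "emeasure \<mu> (space \<mu> - \<Omega>) \<le> 0" by (metis (no_types, lifting) SUP_least mem_Collect_eq order_refl)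
  then show "emeasure \<mu> (space \<mu> - \<Omega>) = 0" by simp
qed

lemma space_M [simp]: "space M = \<Omega>"
  using null_open(1) by (auto simp: space_restrict_space)

lemma AE_support: "AE \<omega> in \<mu>. \<omega> \<in> \<Omega>"
  using support_null by (rule AE_I') auto

lemma prob_space_M: "prob_space M"
proof (rule prob_space_restrict_space[OF support_sets])
  have "emeasure \<mu> \<Omega> = emeasure \<mu> (space \<mu>)"
    using AE_support support_sets by (intro emeasure_eq_AE) auto
  then show "emeasure \<mu> \<Omega> = 1" by (simp add: emeasure_space_1)
qed

lemma separated_conf: "\<omega> \<in> \<Omega> \<Longrightarrow> separated 1 (fst \<omega>)"
  using null_open(1) by (auto simp: space_\<mu> configurations_def pairwise_def)

lemma hopping: "\<omega> \<in> \<Omega> \<Longrightarrow> hopping_operator \<iota> \<omega> C R"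
  by (rule hopping_operator.intro)
    (use separated_conf compact_cball_space bounded_op finite_range C_nonneg R_pos in auto)

lemma Cc_bounded: "\<phi> \<in> Cc \<Longrightarrow> bounded {x :: 'x. \<phi> x \<noteq> 0}"
  unfolding Cc_def by (auto intro: bounded_subset[OF compact_imp_bounded closure_subset])

lemma CcI:
  assumes "continuous_on UNIV (\<phi> :: 'x \<Rightarrow> complex)" "\<And>x. \<phi> x \<noteq> 0 \<Longrightarrow> dist p x \<le> r"
  shows "\<phi> \<in> Cc"
proof -
  have "closure {x. \<phi> x \<noteq> 0} \<subseteq> cball p r" using assms(2) by (intro closure_minimal) auto
  then have "compact (closure {x. \<phi> x \<noteq> 0})"
    using compact_Int_closed[OF compact_cball_space[of p r] closed_closure] by (metis inf.absorb2)
  then show ?thesis using assms(1) by (simp add: Cc_def)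
qed

lemma bump_Cc: "bump (p :: 'x) \<in> Cc"
proof (rule CcI[of _ p "1 / 2"])
  show "continuous_on UNIV (bump p)" unfolding bump_def by (intro continuous_intros)
qed (auto simp: bump_def max_def split: if_splits)

lemma trunc_in: "\<omega> \<in> \<Omega> \<Longrightarrow> \<phi> \<in> Cc \<Longrightarrow> trunc (fst \<omega>) \<phi> \<in> ell2 (fst \<omega>)"
  by (rule ell2_finite_support[OF _ finite_separated_bounded[OF separated_conf Cc_bounded]])
    (auto simp: trunc_def)

text \<open>The inner product is a sum over the diagonal, which is singled out among all pairs of points
  by a continuous cutoff because distinct points have distance at least 1.\<close>

lemma inner_Cc_measurable:
  assumes \<phi>: "\<phi> \<in> Cc" and \<psi>: "\<psi> \<in> Cc"
  shows "(\<lambda>\<omega>. ell2_inner (fst \<omega>) \<phi> \<psi>) \<in> borel_measurable \<mu>"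
proof -
  define \<Phi> :: "'x \<times> 'x \<times> 'c \<Rightarrow> complex" where
    "\<Phi> = (\<lambda>z. cnj (\<phi> (fst z)) * \<psi> (fst (snd z)) * of_real (max 0 (1 - dist (fst z) (fst (snd z)))))"
  have cont: "continuous_on UNIV \<phi>" "continuous_on UNIV \<psi>" using \<phi> \<psi> by (auto simp: Cc_def)
  have "continuous_on UNIV \<Phi>"
    unfolding \<Phi>_def
    by (intro continuous_intros continuous_on_compose2[OF cont(1)] continuous_on_compose2[OF cont(2)]) auto
  moreover have "compact (closure {z. \<Phi> z \<noteq> 0})"
  proof -
    define K where "K = closure {x. \<phi> x \<noteq> 0} \<times> closure {x. \<psi> x \<noteq> 0} \<times> (UNIV :: 'c set)"
    have K: "compact K" unfolding K_def using \<phi> \<psi> compact_c by (intro compact_Times) (auto simp: Cc_def)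
    have "{z. \<Phi> z \<noteq> 0} \<subseteq> K"
      using closure_subset[of "{x. \<phi> x \<noteq> 0}"] closure_subset[of "{x. \<psi> x \<noteq> 0}"]
      by (auto simp: \<Phi>_def K_def)
    then have "closure {z. \<Phi> z \<noteq> 0} \<subseteq> K" using K by (intro closure_minimal compact_imp_closed)
    then show ?thesis using compact_Int_closed[OF K closed_closure] by (metis inf.absorb2)
  qed
  ultimately have "\<Phi> \<in> Cc" by (simp add: Cc_def)
  then have "vague_eval \<Phi> \<in> borel_measurable \<mu>" by (rule vague_eval_measurable)
  moreover have "vague_eval \<Phi> \<omega> = ell2_inner (fst \<omega>) \<phi> \<psi>" if \<omega>: "\<omega> \<in> space \<mu>" for \<omega>
  proof -
    obtain A h where Ah: "\<omega> = (A, h)" by (cases \<omega>)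
    have sep: "1 \<le> dist x y" if "x \<in> A" "y \<in> A" "x \<noteq> y" for x y
      using \<omega> that by (auto simp: Ah space_\<mu> configurations_def)
    have "vague_eval \<Phi> \<omega> = (\<Sum>\<^sub>\<infinity>(x, y)\<in>A \<times> A. \<Phi> (x, y, h (x, y)))" by (simp add: vague_eval_def Ah)
    also have "\<dots> = (\<Sum>\<^sub>\<infinity>(x, y)\<in>(\<lambda>x. (x, x)) ` A. \<Phi> (x, y, h (x, y)))"
      using sep by (intro infsum_cong_neutral) (force simp: \<Phi>_def max_def)+
    also have "\<dots> = (\<Sum>\<^sub>\<infinity>x\<in>A. cnj (\<phi> x) * \<psi> x)"
      by (subst infsum_reindex) (auto simp: inj_on_def comp_def \<Phi>_def)
    finally show ?thesis by (simp add: Ah ell2_inner_def)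
  qed
  ultimately show ?thesis by (subst measurable_cong[of \<mu> _ "vague_eval \<Phi>"]) auto
qed

subsection \<open>Measurable sections\<close>

text \<open>The measurability half of \<open>sections\<close>, separated from square integrability
  so that norms and inner products can be shown measurable first.\<close>

definition weak_section :: "(('x, 'c) conf \<Rightarrow> 'x \<Rightarrow> complex) \<Rightarrow> bool" where
  "weak_section f \<longleftrightarrow> (\<forall>\<omega>\<in>\<Omega>. f \<omega> \<in> ell2 (fst \<omega>)) \<and>
     (\<forall>\<phi>\<in>Cc. (\<lambda>\<omega>. ell2_inner (fst \<omega>) \<phi> (f \<omega>)) \<in> borel_measurable M)"

lemma weak_section_in: "weak_section f \<Longrightarrow> \<omega> \<in> \<Omega> \<Longrightarrow> f \<omega> \<in> ell2 (fst \<omega>)"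
  by (simp add: weak_section_def)

lemma inner_Cc_lin:
  assumes "\<omega> \<in> \<Omega>" "\<phi> \<in> Cc" "u \<in> ell2 (fst \<omega>)" "v \<in> ell2 (fst \<omega>)"
  shows "ell2_inner (fst \<omega>) \<phi> (\<lambda>x. c * u x + d * v x) =
    c * ell2_inner (fst \<omega>) \<phi> u + d * ell2_inner (fst \<omega>) \<phi> v"
  using ell2.ip_lin[OF trunc_in[OF assms(1,2)] assms(3,4), of c d] by (simp add: ell2_inner_trunc)

lemma weak_section_lin:
  assumes f: "weak_section f" and g: "weak_section g"
    and c: "c \<in> borel_measurable M" and d: "d \<in> borel_measurable M"
  shows "weak_section (\<lambda>\<omega> x. c \<omega> * f \<omega> x + d \<omega> * g \<omega> x)"
  unfolding weak_section_def
proof (intro conjI ballI)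
  show "(\<lambda>x. c \<omega> * f \<omega> x + d \<omega> * g \<omega> x) \<in> ell2 (fst \<omega>)" if "\<omega> \<in> \<Omega>" for \<omega>
    using f g that by (intro ell2_lin weak_section_in)
  fix \<phi> :: "'x \<Rightarrow> complex" assume \<phi>: "\<phi> \<in> Cc"
  have "(\<lambda>\<omega>. c \<omega> * ell2_inner (fst \<omega>) \<phi> (f \<omega>) + d \<omega> * ell2_inner (fst \<omega>) \<phi> (g \<omega>)) \<in> borel_measurable M"
    using f g c d \<phi> by (intro borel_measurable_add borel_measurable_times) (auto simp: weak_section_def)
  then show "(\<lambda>\<omega>. ell2_inner (fst \<omega>) \<phi> (\<lambda>x. c \<omega> * f \<omega> x + d \<omega> * g \<omega> x)) \<in> borel_measurable M"
    by (rule measurable_cong[THEN iffD1, rotated])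
      (use f g \<phi> in \<open>auto simp: inner_Cc_lin weak_section_in\<close>)
qed

lemma norm_measurable:
  assumes f: "weak_section f"
  shows "(\<lambda>\<omega>. (ell2_norm (fst \<omega>) (f \<omega>))\<^sup>2) \<in> borel_measurable M"
proof -
  obtain \<psi> :: "nat \<Rightarrow> 'x \<Rightarrow> real" where \<psi>: "\<And>n. continuous_on UNIV (\<psi> n)"
    "\<And>n. \<exists>p. \<forall>x. \<psi> n x \<noteq> 0 \<longrightarrow> dist p x < 1 / 2" "\<And>x. (\<lambda>n. (\<psi> n x)\<^sup>2) sums 1"
    using square_partition[where 'x = 'x] by metis
  have "(\<lambda>x. complex_of_real (\<psi> n x)) \<in> Cc" for n
  proof -
    obtain p where "\<And>x. \<psi> n x \<noteq> 0 \<Longrightarrow> dist p x < 1 / 2" using \<psi>(2) by blast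
    then show ?thesis using \<psi>(1) by (intro CcI[of _ p "1 / 2"]) (force intro!: continuous_intros)+
  qed
  then have "(\<lambda>\<omega>. ell2_inner (fst \<omega>) (\<lambda>x. complex_of_real (\<psi> n x)) (f \<omega>)) \<in> borel_measurable M" for n
    using f[unfolded weak_section_def] by blast
  then have "(\<lambda>\<omega>. (cmod (ell2_inner (fst \<omega>) (\<lambda>x. complex_of_real (\<psi> n x)) (f \<omega>)))\<^sup>2) \<in> borel_measurable M" for n
    by measurable
  then have "(\<lambda>\<omega>. \<Sum>n. (cmod (ell2_inner (fst \<omega>) (\<lambda>x. complex_of_real (\<psi> n x)) (f \<omega>)))\<^sup>2) \<in> borel_measurable M"
    by (rule borel_measurable_suminf)
  moreover have "(\<Sum>n. (cmod (ell2_inner (fst \<omega>) (\<lambda>x. complex_of_real (\<psi> n x)) (f \<omega>)))\<^sup>2) = (ell2_norm (fst \<omega>) (f \<omega>))\<^sup>2"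
    if "\<omega> \<in> \<Omega>" for \<omega>
    using ell2_norm_sums[OF separated_conf[OF that] weak_section_in[OF f that] \<psi>(2,3)] by (rule sums_unique[symmetric])
  ultimately show ?thesis by (rule measurable_cong[THEN iffD1, rotated]) simp
qed

text \<open>Polarization: the coefficients 1 and \<open>- \<i>\<close> recover the real and the
  imaginary part from norms.\<close>

lemma inner_measurable:
  assumes f: "weak_section f" and g: "weak_section g"
  shows "(\<lambda>\<omega>. ell2_inner (fst \<omega>) (f \<omega>) (g \<omega>)) \<in> borel_measurable M"
proof -
  let ?n = "\<lambda>h \<omega>. (ell2_norm (fst \<omega>) (h \<omega>))\<^sup>2"
  define s where "s c = (\<lambda>\<omega> x. 1 * f \<omega> x + c * g \<omega> x)" for c
  have s: "weak_section (s c)" for c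
    unfolding s_def using f g by (rule weak_section_lin) auto
  have "(\<lambda>\<omega>. Complex ((?n (s 1) \<omega> - ?n f \<omega> - ?n g \<omega>) / 2) ((?n (s (- \<i>)) \<omega> - ?n f \<omega> - ?n g \<omega>) / 2)) \<in> borel_measurable M"
    using norm_measurable[OF s] norm_measurable[OF f] norm_measurable[OF g]
    by (subst borel_measurable_complex_iff) auto
  moreover have "Complex ((?n (s 1) \<omega> - ?n f \<omega> - ?n g \<omega>) / 2) ((?n (s (- \<i>)) \<omega> - ?n f \<omega> - ?n g \<omega>) / 2) =
      ell2_inner (fst \<omega>) (f \<omega>) (g \<omega>)" if "\<omega> \<in> \<Omega>" for \<omega>
    using ell2_norm_lin_square[OF weak_section_in[OF f that] weak_section_in[OF g that], of 1 1]
      ell2_norm_lin_square[OF weak_section_in[OF f that] weak_section_in[OF g that], of 1 "- \<i>"]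
    by (simp add: s_def complex_eq_iff)
  ultimately show ?thesis by (rule measurable_cong[THEN iffD1, rotated]) simp
qed

lemma sections_iff: "f \<in> sections \<mu> \<longleftrightarrow> weak_section f \<and> (\<forall>\<omega>. \<omega> \<notin> \<Omega> \<longrightarrow> f \<omega> = (\<lambda>_. 0)) \<and>
    integrable M (\<lambda>\<omega>. (ell2_norm (fst \<omega>) (f \<omega>))\<^sup>2)"
  by (auto simp: sections_def weak_section_def)

lemma section_in: "f \<in> sections \<mu> \<Longrightarrow> \<omega> \<in> \<Omega> \<Longrightarrow> f \<omega> \<in> ell2 (fst \<omega>)"
  by (simp add: sections_def)

lemma section_weak: "f \<in> sections \<mu> \<Longrightarrow> weak_section f"
  by (simp add: sections_iff)

lemma section_dominated:
  assumes h: "weak_section h" "\<And>\<omega>. \<omega> \<notin> \<Omega> \<Longrightarrow> h \<omega> = (\<lambda>_. 0)"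
    and B: "integrable M B" "\<And>\<omega>. \<omega> \<in> \<Omega> \<Longrightarrow> (ell2_norm (fst \<omega>) (h \<omega>))\<^sup>2 \<le> B \<omega>"
  shows "h \<in> sections \<mu>"
proof -
  have "integrable M (\<lambda>\<omega>. (ell2_norm (fst \<omega>) (h \<omega>))\<^sup>2)"
  proof (rule Bochner_Integration.integrable_bound[OF B(1) norm_measurable[OF h(1)]])
    show "AE \<omega> in M. norm ((ell2_norm (fst \<omega>) (h \<omega>))\<^sup>2) \<le> norm (B \<omega>)"
      by (rule AE_I2) (use B(2) in \<open>force simp: abs_of_nonneg\<close>)
  qed
  then show ?thesis using h by (simp add: sections_iff)
qed

lemma section_bounded_by:
  assumes h: "weak_section h" "\<And>\<omega>. \<omega> \<notin> \<Omega> \<Longrightarrow> h \<omega> = (\<lambda>_. 0)" and f: "f \<in> sections \<mu>"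
    and le: "\<And>\<omega>. \<omega> \<in> \<Omega> \<Longrightarrow> ell2_norm (fst \<omega>) (h \<omega>) \<le> ell2_norm (fst \<omega>) (f \<omega>)"
  shows "h \<in> sections \<mu>"
  using h
proof (rule section_dominated)
  show "integrable M (\<lambda>\<omega>. (ell2_norm (fst \<omega>) (f \<omega>))\<^sup>2)" using f by (simp add: sections_iff)
qed (use le in \<open>auto intro: power_mono\<close>)

abbreviation lin_section :: "complex \<Rightarrow> (('x, 'c) conf \<Rightarrow> 'x \<Rightarrow> complex) \<Rightarrow> complex \<Rightarrow>
    (('x, 'c) conf \<Rightarrow> 'x \<Rightarrow> complex) \<Rightarrow> ('x, 'c) conf \<Rightarrow> 'x \<Rightarrow> complex" where
  "lin_section c f d g \<equiv> \<lambda>\<omega> x. c * f \<omega> x + d * g \<omega> x"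

lemma section_lin:
  assumes f: "f \<in> sections \<mu>" and g: "g \<in> sections \<mu>"
  shows "lin_section c f d g \<in> sections \<mu>"
proof (rule section_dominated)
  show "weak_section (lin_section c f d g)"
    using f g by (intro weak_section_lin section_weak) auto
  show "integrable M (\<lambda>\<omega>. 2 * (cmod c)\<^sup>2 * (ell2_norm (fst \<omega>) (f \<omega>))\<^sup>2 + 2 * (cmod d)\<^sup>2 * (ell2_norm (fst \<omega>) (g \<omega>))\<^sup>2)"
    using f g by (simp add: sections_iff)
qed (use f g in \<open>auto simp: sections_iff intro: ell2_norm_lin_le weak_section_in\<close>)

lemma section_mult:
  assumes f: "f \<in> sections \<mu>" and c: "c \<in> borel_measurable M" "\<And>\<omega>. \<omega> \<in> \<Omega> \<Longrightarrow> cmod (c \<omega>) \<le> 1"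
  shows "(\<lambda>\<omega> x. c \<omega> * f \<omega> x) \<in> sections \<mu>"
proof (rule section_bounded_by[OF _ _ f])
  have "weak_section (\<lambda>\<omega> x. c \<omega> * f \<omega> x + 0 * f \<omega> x)"
    using section_weak[OF f] section_weak[OF f] c(1) by (rule weak_section_lin) simp
  then show "weak_section (\<lambda>\<omega> x. c \<omega> * f \<omega> x)" by simp
  show "ell2_norm (fst \<omega>) (\<lambda>x. c \<omega> * f \<omega> x) \<le> ell2_norm (fst \<omega>) (f \<omega>)" if "\<omega> \<in> \<Omega>" for \<omega>
    using c(2)[OF that] section_in[OF f that] by (simp add: ell2_norm_scale mult_left_le_one_le)
qed (use f in \<open>auto simp: sections_iff\<close>)

lemma section_inner_integrable:
  assumes f: "f \<in> sections \<mu>" and g: "g \<in> sections \<mu>"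
  shows "integrable M (\<lambda>\<omega>. ell2_inner (fst \<omega>) (f \<omega>) (g \<omega>))"
proof (rule Bochner_Integration.integrable_bound)
  show "integrable M (\<lambda>\<omega>. (ell2_norm (fst \<omega>) (f \<omega>))\<^sup>2 + (ell2_norm (fst \<omega>) (g \<omega>))\<^sup>2)"
    using f g by (simp add: sections_iff)
  show "(\<lambda>\<omega>. ell2_inner (fst \<omega>) (f \<omega>) (g \<omega>)) \<in> borel_measurable M"
    using f g by (intro inner_measurable section_weak)
  show "AE \<omega> in M. cmod (ell2_inner (fst \<omega>) (f \<omega>) (g \<omega>)) \<le>
      norm ((ell2_norm (fst \<omega>) (f \<omega>))\<^sup>2 + (ell2_norm (fst \<omega>) (g \<omega>))\<^sup>2)"
  proof (rule AE_I2)
    fix \<omega> assume "\<omega> \<in> space M"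
    then have "cmod (ell2_inner (fst \<omega>) (f \<omega>) (g \<omega>)) \<le> ell2_norm (fst \<omega>) (f \<omega>) * ell2_norm (fst \<omega>) (g \<omega>)"
      using f g by (intro ell2_inner_Cauchy_Schwarz section_in) auto
    moreover have "0 \<le> ell2_norm (fst \<omega>) (f \<omega>) * ell2_norm (fst \<omega>) (g \<omega>)" by simp
    ultimately show "cmod (ell2_inner (fst \<omega>) (f \<omega>) (g \<omega>)) \<le>
      norm ((ell2_norm (fst \<omega>) (f \<omega>))\<^sup>2 + (ell2_norm (fst \<omega>) (g \<omega>))\<^sup>2)"
      using sum_squares_bound[of "ell2_norm (fst \<omega>) (f \<omega>)" "ell2_norm (fst \<omega>) (g \<omega>)"]
      unfolding real_norm_def by linarith
  qed
qed

lemma sections_inner_self: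
  assumes f: "f \<in> sections \<mu>"
  shows "sections_inner \<mu> f f = of_real (\<integral>\<omega>. (ell2_norm (fst \<omega>) (f \<omega>))\<^sup>2 \<partial>M)"
  unfolding sections_inner_def integral_complex_of_real[symmetric]
  by (rule Bochner_Integration.integral_cong) (use f in \<open>auto simp: ell2_inner_self section_in\<close>)

sublocale sec: psd_form "sections \<mu>" lin_section "sections_inner \<mu>"
proof
  fix u v w c d
  assume u: "u \<in> sections \<mu>"
  show "0 \<le> Re (sections_inner \<mu> u u)" using sections_inner_self[OF u] by simp
  assume v: "v \<in> sections \<mu>"
  show "lin_section c u d v \<in> sections \<mu>" using u v by (rule section_lin)
  show "sections_inner \<mu> v u = cnj (sections_inner \<mu> u v)"
  proof -
    have "sections_inner \<mu> v u = (\<integral>\<omega>. cnj (ell2_inner (fst \<omega>) (u \<omega>) (v \<omega>)) \<partial>M)"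
      unfolding sections_inner_def
      by (rule Bochner_Integration.integral_cong) (use u v in \<open>auto intro: ell2.ip_cnj section_in\<close>)
    then show ?thesis by (simp add: sections_inner_def)
  qed
  assume w: "w \<in> sections \<mu>"
  have "sections_inner \<mu> w (lin_section c u d v) =
      (\<integral>\<omega>. c * ell2_inner (fst \<omega>) (w \<omega>) (u \<omega>) + d * ell2_inner (fst \<omega>) (w \<omega>) (v \<omega>) \<partial>M)"
    unfolding sections_inner_def
    by (rule Bochner_Integration.integral_cong) (use u v w in \<open>auto intro: ell2.ip_lin section_in\<close>)
  also have "\<dots> = c * sections_inner \<mu> w u + d * sections_inner \<mu> w v"
    unfolding sections_inner_def using section_inner_integrable[OF w u] section_inner_integrable[OF w v] by simp
  finally show "sections_inner \<mu> w (lin_section c u d v) = c * sections_inner \<mu> w u + d * sections_inner \<mu> w v" .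
qed

lemma section_null:
  assumes f: "f \<in> sections \<mu>" and "Re (sections_inner \<mu> f f) = 0"
  shows "AE \<omega> in M. f \<omega> = (\<lambda>_. 0)"
proof -
  have "(\<integral>\<omega>. (ell2_norm (fst \<omega>) (f \<omega>))\<^sup>2 \<partial>M) = 0"
    using assms sections_inner_self[OF f] by simp
  then have "AE \<omega> in M. (ell2_norm (fst \<omega>) (f \<omega>))\<^sup>2 = 0"
    using f by (subst (asm) integral_nonneg_eq_0_iff_AE) (auto simp: sections_iff)
  with AE_space show ?thesis
  proof eventually_elim
    case (elim \<omega>)
    then have "ell2_norm (fst \<omega>) (f \<omega>) = 0" "f \<omega> \<in> ell2 (fst \<omega>)" using section_in[OF f] by auto
    then have "f \<omega> x = 0" for x using ell2_norm_eq_0D[of "f \<omega>" "fst \<omega>" x] by simp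
    then show ?case ..
  qed
qed

section \<open>The direct integral operator and sections concentrated near a point\<close>

abbreviation T :: "(('x, 'c) conf \<Rightarrow> 'x \<Rightarrow> complex) \<Rightarrow> ('x, 'c) conf \<Rightarrow> 'x \<Rightarrow> complex" where
  "T \<equiv> direct_integral_op \<mu> (hamiltonian \<iota>)"

lemma T_section: "f \<in> sections \<mu> \<Longrightarrow> T f \<in> sections \<mu>"
  using selfadj by (auto simp: selfadjoint_on_def)

lemma T_apply: "\<omega> \<in> \<Omega> \<Longrightarrow> T f \<omega> = hamiltonian \<iota> \<omega> (f \<omega>)"
  by (simp add: direct_integral_op_def)

definition bump_section :: "'x \<Rightarrow> ('x, 'c) conf \<Rightarrow> 'x \<Rightarrow> complex" where
  "bump_section p = (\<lambda>\<omega>. if \<omega> \<in> \<Omega> then trunc (fst \<omega>) (bump p) else (\<lambda>_. 0))"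

lemma bump_norm_le:
  assumes \<omega>: "\<omega> \<in> \<Omega>"
  shows "(ell2_norm (fst \<omega>) (trunc (fst \<omega>) (bump p)))\<^sup>2 \<le> 1"
proof (cases "\<exists>x\<in>fst \<omega>. dist p x < 1 / 2")
  case True
  then obtain x where x: "x \<in> fst \<omega>" "dist p x < 1 / 2" by blast
  have "ell2_inner (fst \<omega>) (delta x) (delta x) = 1" using x by (simp add: ell2_inner_delta) (simp add: delta_def)
  then have n1: "(ell2_norm (fst \<omega>) (delta x))\<^sup>2 = 1"
    using ell2_inner_self[OF delta_in[OF x(1)]] by (metis of_real_eq_1_iff)
  have "cmod (bump p x) \<le> 1" using zero_le_dist[of p x] unfolding bump_def norm_of_real by linarith
  moreover have "(ell2_norm (fst \<omega>) (\<lambda>y. bump p x * delta x y))\<^sup>2 = (cmod (bump p x))\<^sup>2"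
    unfolding ell2_norm_scale[OF delta_in[OF x(1)]] power_mult_distrib n1 by simp
  ultimately show ?thesis
    using \<omega> trunc_bump(1)[OF separated_conf[OF \<omega>] x] by (simp add: power_le_one)
next
  case False
  then have "trunc (fst \<omega>) (bump p) = (\<lambda>_. 0)" by (intro trunc_bump(2) separated_conf \<omega>) force
  then show ?thesis using \<omega> by (simp add: ell2_norm_def)
qed

lemma bump_section: "bump_section p \<in> sections \<mu>"
proof (rule section_dominated)
  show "weak_section (bump_section p)"
    unfolding weak_section_def
  proof (intro conjI ballI)
    fix \<phi> :: "'x \<Rightarrow> complex" assume "\<phi> \<in> Cc"
    then have "(\<lambda>\<omega>. ell2_inner (fst \<omega>) \<phi> (bump p)) \<in> borel_measurable M"
      by (intro measurable_restrict_space1 inner_Cc_measurable bump_Cc)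
    then show "(\<lambda>\<omega>. ell2_inner (fst \<omega>) \<phi> (bump_section p \<omega>)) \<in> borel_measurable M"
      by (rule measurable_cong[THEN iffD1, rotated])
        (auto simp: bump_section_def ell2_inner_def trunc_def intro!: infsum_cong)
  qed (auto simp: bump_section_def intro: trunc_in bump_Cc)
  interpret M: prob_space M by (rule prob_space_M)
  show "integrable M (\<lambda>_. 1 :: real)" by simp
  show "(ell2_norm (fst \<omega>) (bump_section p \<omega>))\<^sup>2 \<le> 1" if "\<omega> \<in> \<Omega>" for \<omega>
    using bump_norm_le[OF that] that by (simp add: bump_section_def)
qed (simp add: bump_section_def)

subsection \<open>Almost every operator is selfadjoint\<close>

text \<open>Symmetry is known only after integration over the configurations. Multiplying one
  section by a bounded measurable function \<open>k\<close> of the configuration localizes it.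
  Taking \<open>k\<close> proportional to the difference \<open>c\<close> of both sides, with the
  factor \<open>1 / (1 + cmod c)\<close> for boundedness, makes the integrand nonnegative and zero
  only where \<open>c\<close> is.\<close>

lemma AE_bump_symmetric:
  "AE \<omega> in M. ell2_inner (fst \<omega>) (T (bump_section p) \<omega>) (bump_section q \<omega>) =
    ell2_inner (fst \<omega>) (bump_section p \<omega>) (T (bump_section q) \<omega>)"
proof -
  let ?f = "bump_section p" and ?g = "bump_section q"
  define l where "l \<omega> = ell2_inner (fst \<omega>) (T ?f \<omega>) (?g \<omega>)" for \<omega>
  define r where "r \<omega> = ell2_inner (fst \<omega>) (?f \<omega>) (T ?g \<omega>)" for \<omega>
  define c where "c \<omega> = l \<omega> - r \<omega>" for \<omega>
  define k where "k \<omega> = c \<omega> / of_real (1 + cmod (c \<omega>))" for \<omega>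
  have fg: "?f \<in> sections \<mu>" "?g \<in> sections \<mu>" "T ?f \<in> sections \<mu>" "T ?g \<in> sections \<mu>"
    by (auto intro: bump_section T_section)
  have meas: "l \<in> borel_measurable M" "r \<in> borel_measurable M"
    unfolding l_def r_def using fg by (intro inner_measurable section_weak; simp)+
  then have c: "c \<in> borel_measurable M" unfolding c_def by (rule borel_measurable_diff)
  have k: "k \<in> borel_measurable M"
    unfolding k_def using c by (intro borel_measurable_divide borel_measurable_of_real borel_measurable_add borel_measurable_norm) auto
  have k1: "cmod (k \<omega>) \<le> 1" for \<omega>
  proof -
    have "0 < 1 + cmod (c \<omega>)" by (simp add: add_pos_nonneg)
    then show ?thesis unfolding k_def norm_divide norm_of_real by simp
  qed
  define f' where "f' = (\<lambda>\<omega> x. k \<omega> * ?f \<omega> x)"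
  have f': "f' \<in> sections \<mu>" unfolding f'_def using fg(1) k k1 by (rule section_mult)
  have "sections_inner \<mu> (T f') ?g = sections_inner \<mu> f' (T ?g)"
    using selfadj f' fg(2) by (auto simp: selfadjoint_on_def)
  then have "(\<integral>\<omega>. ell2_inner (fst \<omega>) (T f' \<omega>) (?g \<omega>) - ell2_inner (fst \<omega>) (f' \<omega>) (T ?g \<omega>) \<partial>M) = 0"
    unfolding sections_inner_def
    using section_inner_integrable[OF T_section[OF f'] fg(2)] section_inner_integrable[OF f' fg(4)] by simp
  moreover have "ell2_inner (fst \<omega>) (T f' \<omega>) (?g \<omega>) - ell2_inner (fst \<omega>) (f' \<omega>) (T ?g \<omega>) =
      of_real ((cmod (c \<omega>))\<^sup>2 / (1 + cmod (c \<omega>)))" if \<omega>: "\<omega> \<in> \<Omega>" for \<omega>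
  proof -
    interpret hopping_operator \<iota> \<omega> C R using hopping[OF \<omega>] .
    have "T f' \<omega> = (\<lambda>x. k \<omega> * T ?f \<omega> x + 0 * T ?f \<omega> x)"
      using H_lin[of "k \<omega>" "?f \<omega>" 0 "?f \<omega>"] by (simp add: T_apply[OF \<omega>] f'_def)
    then have 1: "ell2_inner (fst \<omega>) (T f' \<omega>) (?g \<omega>) = cnj (k \<omega>) * l \<omega>"
      using ell2.lin_ip[OF section_in[OF fg(2) \<omega>] section_in[OF fg(3) \<omega>] section_in[OF fg(3) \<omega>], of "k \<omega>" 0]
      by (simp add: l_def)
    have 2: "ell2_inner (fst \<omega>) (f' \<omega>) (T ?g \<omega>) = cnj (k \<omega>) * r \<omega>"
      using ell2.lin_ip[OF section_in[OF fg(4) \<omega>] section_in[OF fg(1) \<omega>] section_in[OF fg(1) \<omega>], of "k \<omega>" 0]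
      by (simp add: r_def f'_def)
    have "cnj (k \<omega>) * l \<omega> - cnj (k \<omega>) * r \<omega> = cnj (k \<omega>) * c \<omega>"
      by (simp add: c_def algebra_simps)
    also have "\<dots> = (cnj (c \<omega>) * c \<omega>) / of_real (1 + cmod (c \<omega>))"
      by (simp add: k_def)
    also have "cnj (c \<omega>) * c \<omega> = of_real ((cmod (c \<omega>))\<^sup>2)" by (metis complex_norm_square mult.commute)
    finally show ?thesis using 1 2 by (simp only: of_real_divide)
  qed
  ultimately have "(\<integral>\<omega>. complex_of_real ((cmod (c \<omega>))\<^sup>2 / (1 + cmod (c \<omega>))) \<partial>M) = 0"
    by (metis (mono_tags, lifting) Bochner_Integration.integral_cong space_M)
  moreover have int: "integrable M (\<lambda>\<omega>. (cmod (c \<omega>))\<^sup>2 / (1 + cmod (c \<omega>)))"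
  proof (rule Bochner_Integration.integrable_bound)
    show "integrable M c" unfolding c_def l_def r_def
      using section_inner_integrable[OF fg(3,2)] section_inner_integrable[OF fg(1,4)] by simp
    show "(\<lambda>\<omega>. (cmod (c \<omega>))\<^sup>2 / (1 + cmod (c \<omega>))) \<in> borel_measurable M" using c by simp
    show "AE \<omega> in M. norm ((cmod (c \<omega>))\<^sup>2 / (1 + cmod (c \<omega>))) \<le> norm (c \<omega>)"
    proof (rule AE_I2)
      fix \<omega>
      have "0 < 1 + cmod (c \<omega>)" by (simp add: add_pos_nonneg)
      then show "norm ((cmod (c \<omega>))\<^sup>2 / (1 + cmod (c \<omega>))) \<le> norm (c \<omega>)"
        by (simp add: divide_le_eq power2_eq_square algebra_simps)
    qed
  qed
  ultimately have "(\<integral>\<omega>. (cmod (c \<omega>))\<^sup>2 / (1 + cmod (c \<omega>)) \<partial>M) = 0"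
    unfolding integral_complex_of_real by simp
  then have "AE \<omega> in M. (cmod (c \<omega>))\<^sup>2 / (1 + cmod (c \<omega>)) = 0"
    using int by (subst (asm) integral_nonneg_eq_0_iff_AE) auto
  then show ?thesis
  proof eventually_elim
    case (elim \<omega>)
    moreover have "1 + cmod (c \<omega>) \<noteq> 0" using norm_ge_zero[of "c \<omega>"] by linarith
    ultimately have "c \<omega> = 0" by simp
    then show ?case by (simp add: c_def l_def r_def)
  qed
qed

text \<open>Bumps around a dense sequence isolate every point of every configuration, so all matrix
  elements are reached from countably many pairs of sections and one null set suffices.\<close>

lemma AE_hermitian: "AE \<omega> in M. hermitian_hopping \<iota> \<omega> C R"
proof -
  obtain d :: "nat \<Rightarrow> 'x" where d: "\<forall>x. \<forall>e>0. \<exists>n. dist (d n) x < e"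
    by (rule dense_sequence)
  have "AE \<omega> in M. \<forall>i j. ell2_inner (fst \<omega>) (T (bump_section (d i)) \<omega>) (bump_section (d j) \<omega>) =
    ell2_inner (fst \<omega>) (bump_section (d i) \<omega>) (T (bump_section (d j)) \<omega>)"
    unfolding AE_all_countable using AE_bump_symmetric by blast
  with AE_space show ?thesis
  proof eventually_elim
    case (elim \<omega>)
    then have \<omega>: "\<omega> \<in> \<Omega>" by simp
    interpret hopping_operator \<iota> \<omega> C R using hopping[OF \<omega>] .
    show ?case
    proof unfold_locales
      fix x y assume xy: "x \<in> A" "y \<in> A"
      obtain i where i: "dist (d i) x < 1 / 2" using d[rule_format, of "1 / 2" x] by auto
      obtain j where j: "dist (d j) y < 1 / 2" using d[rule_format, of "1 / 2" y] by auto
      define \<beta> where "\<beta> = 1 / 2 - dist (d i) x"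
      define \<gamma> where "\<gamma> = 1 / 2 - dist (d j) y"
      have pos: "\<beta> > 0" "\<gamma> > 0" using i j by (auto simp: \<beta>_def \<gamma>_def)
      have fi: "bump_section (d i) \<omega> = (\<lambda>z. of_real \<beta> * delta x z)"
        and fj: "bump_section (d j) \<omega> = (\<lambda>z. of_real \<gamma> * delta y z)"
        using trunc_bump(1)[OF sep xy(1) i] trunc_bump(1)[OF sep xy(2) j] \<omega> i j
        by (simp_all add: bump_section_def bump_def \<beta>_def \<gamma>_def)
      have H\<delta>: "H (\<lambda>z. c * delta w z) z = c * m z w" if "w \<in> A" "z \<in> A" for c w z
      proof -
        have "H (\<lambda>z. c * delta w z) z = (\<Sum>y\<in>{w}. m z y * (c * delta w y))"
          by (rule H_eq) (use that in \<open>auto simp: delta_def split: if_splits\<close>)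
        then show ?thesis by (simp add: delta_def)
      qed
      have in2: "(\<lambda>z. c * delta w z) \<in> ell2 A" if "w \<in> A" for c w using that by auto
      have ip\<delta>: "ell2_inner A (\<lambda>z. c * delta w z) v = cnj c * v w" if "w \<in> A" "v \<in> ell2 A" for c w v
        using ell2.lin_ip[OF that(2) delta_in[OF that(1)] delta_in[OF that(1)], of c 0] that(1)
        by (simp add: ell2_inner_delta)
      have "ell2_inner A (bump_section (d i) \<omega>) (T (bump_section (d j)) \<omega>) = of_real (\<beta> * \<gamma>) * m x y"
        unfolding T_apply[OF \<omega>] fi fj using xy by (simp add: ip\<delta> H_ell2 in2 H\<delta>)
      moreover have "ell2_inner A (T (bump_section (d i)) \<omega>) (bump_section (d j) \<omega>) = of_real (\<beta> * \<gamma>) * cnj (m y x)"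
      proof -
        have "ell2_inner A (bump_section (d j) \<omega>) (T (bump_section (d i)) \<omega>) = of_real (\<gamma> * \<beta>) * m y x"
          unfolding T_apply[OF \<omega>] fi fj using xy by (simp add: ip\<delta> H_ell2 in2 H\<delta>)
        then show ?thesis
          using ell2.ip_cnj[OF section_in[OF bump_section[of "d j"] \<omega>] section_in[OF T_section[OF bump_section[of "d i"]] \<omega>]]
          by simp
      qed
      ultimately have "of_real (\<beta> * \<gamma>) * cnj (m y x) = of_real (\<beta> * \<gamma>) * m x y"
        using elim(2)[rule_format, of i j] by (simp only:)
      then have "cnj (m y x) = m x y" using pos by simp
      then show "m y x = cnj (m x y)" by (metis complex_cnj_cnj)
    qed
  qed
qed

end

section \<open>The defect density vanishes\<close>

text \<open>The domain \<open>\<Omega>\<^sub>0\<close> is any measurable set of full measure on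
  which the fibre operators are Hermitian; the set of all such configurations need not itself be
  measurable.\<close>

locale random_hermitian = random_operator act haar F a b \<iota> \<mu> C R
  for act :: "'g::{topological_group_add,metric_space} \<Rightarrow>
                'x::{metric_space,second_countable_topology} \<Rightarrow> 'x"
    and haar :: "'g measure" and F :: "'x set" and a b :: real
    and \<iota> :: "complex \<Rightarrow> 'c::t2_space" and \<mu> :: "('x, 'c) conf measure" and C R :: real +
  fixes \<Omega>\<^sub>0 :: "('x, 'c) conf set" and lam :: real
  assumes good_sets: "\<Omega>\<^sub>0 \<in> sets M" and good_AE: "AE \<omega> in M. \<omega> \<in> \<Omega>\<^sub>0"
    and good: "\<And>\<omega>. \<omega> \<in> \<Omega>\<^sub>0 \<Longrightarrow> hermitian_hopping \<iota> \<omega> C R"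
begin

lemma good_support: "\<omega> \<in> \<Omega>\<^sub>0 \<Longrightarrow> \<omega> \<in> \<Omega>"
  using sets.sets_into_space[OF good_sets] by auto

abbreviation "op_D \<omega> \<equiv> hermitian_hopping.D \<iota> \<omega> lam"
abbreviation "op_ker \<omega> \<theta> \<equiv> ell2_selfadjoint.ker (fst \<omega>) (op_D \<omega>) \<theta>"
abbreviation "op_damping \<omega> \<theta> \<equiv> ell2_selfadjoint.damping (op_D \<omega>) ((C + \<bar>lam\<bar>)\<^sup>2) \<theta>"
abbreviation "comp_sp \<omega> \<equiv> closed_span (fst \<omega>) (compact_solutions \<iota> lam \<omega>)"
abbreviation "eigen_sp \<omega> \<equiv> op_ker \<omega> (\<lambda>_. 0)"
abbreviation "defect_sp \<omega> \<equiv> hermitian_hopping.defect \<iota> \<omega> lam"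

text \<open>Fibrewise constructions are controlled only on \<open>\<Omega>\<^sub>0\<close>. The
  value 0 elsewhere gives a total section and changes it only on a null set.\<close>

definition on_good :: "(('x, 'c) conf \<Rightarrow> ('x \<Rightarrow> complex) \<Rightarrow> 'x \<Rightarrow> complex) \<Rightarrow>
    (('x, 'c) conf \<Rightarrow> 'x \<Rightarrow> complex) \<Rightarrow> ('x, 'c) conf \<Rightarrow> 'x \<Rightarrow> complex" where
  "on_good P f = (\<lambda>\<omega>. if \<omega> \<in> \<Omega>\<^sub>0 then P \<omega> (f \<omega>) else (\<lambda>_. 0))"

lemma on_good_restrict: "f \<in> sections \<mu> \<Longrightarrow> on_good (\<lambda>_ u. u) f \<in> sections \<mu>"
proof -
  assume f: "f \<in> sections \<mu>"
  have "(\<lambda>\<omega> x. indicator \<Omega>\<^sub>0 \<omega> * f \<omega> x) \<in> sections \<mu>"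
    using f borel_measurable_indicator[OF good_sets] by (rule section_mult) (simp add: indicator_def)
  moreover have "(\<lambda>\<omega> x. indicator \<Omega>\<^sub>0 \<omega> * f \<omega> x) = on_good (\<lambda>_ u. u) f"
    by (auto simp: on_good_def indicator_def fun_eq_iff)
  ultimately show ?thesis by simp
qed

text \<open>For measurability the cutoff is moved onto the test function, which stays in
  \<open>Cc\<close> by continuity of the cutoff.\<close>

lemma theta_section:
  assumes \<theta>: "continuous_on UNIV \<theta>" "\<And>x. 0 \<le> \<theta> x" "\<And>x. \<theta> x \<le> (1 :: real)" and f: "f \<in> sections \<mu>"
  shows "(\<lambda>\<omega> x. complex_of_real (\<theta> x) * f \<omega> x) \<in> sections \<mu>"
proof (rule section_bounded_by[OF _ _ f])
  have le: "cmod (of_real (\<theta> x) * f \<omega> x) \<le> cmod (f \<omega> x)" for \<omega> x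
    using \<theta>(2,3)[of x] by (simp add: norm_mult mult_left_le_one_le)
  have bd: "(\<lambda>x. complex_of_real (\<theta> x) * f \<omega> x) \<in> ell2 (fst \<omega>) \<and>
      ell2_norm (fst \<omega>) (\<lambda>x. complex_of_real (\<theta> x) * f \<omega> x) \<le> ell2_norm (fst \<omega>) (f \<omega>)" if \<omega>: "\<omega> \<in> \<Omega>" for \<omega>
  proof (rule conjI; rule ell2I_bounded)
    fix S assume S: "finite S" "S \<subseteq> fst \<omega>"
    have "(\<Sum>x\<in>S. (cmod (of_real (\<theta> x) * f \<omega> x))\<^sup>2) \<le> (\<Sum>x\<in>S. (cmod (f \<omega> x))\<^sup>2)"
      using le by (intro sum_mono power_mono) auto
    also have "\<dots> \<le> (ell2_norm (fst \<omega>) (f \<omega>))\<^sup>2" using ell2_sum_le_norm[OF section_in[OF f \<omega>] S] .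
    finally show "(\<Sum>x\<in>S. (cmod (of_real (\<theta> x) * f \<omega> x))\<^sup>2) \<le> (ell2_norm (fst \<omega>) (f \<omega>))\<^sup>2" .
    then show "(\<Sum>x\<in>S. (cmod (of_real (\<theta> x) * f \<omega> x))\<^sup>2) \<le> (ell2_norm (fst \<omega>) (f \<omega>))\<^sup>2" .
  qed (use ell2_outside[OF section_in[OF f \<omega>]] in auto)
  then show "\<omega> \<in> \<Omega> \<Longrightarrow> ell2_norm (fst \<omega>) (\<lambda>x. complex_of_real (\<theta> x) * f \<omega> x) \<le> ell2_norm (fst \<omega>) (f \<omega>)" for \<omega>
    by blast
  show "weak_section (\<lambda>\<omega> x. complex_of_real (\<theta> x) * f \<omega> x)"
    unfolding weak_section_def
  proof (intro conjI ballI)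
    fix \<phi> :: "'x \<Rightarrow> complex" assume \<phi>: "\<phi> \<in> Cc"
    have "continuous_on UNIV (\<lambda>x. of_real (\<theta> x) * \<phi> x)"
      using \<theta>(1) \<phi> by (intro continuous_intros) (auto simp: Cc_def)
    moreover obtain p r where "{x. \<phi> x \<noteq> 0} \<subseteq> cball p r"
      using Cc_bounded[OF \<phi>] bounded_subset_cball by blast
    ultimately have "(\<lambda>x. of_real (\<theta> x) * \<phi> x) \<in> Cc" by (intro CcI[of _ p r]) auto
    then have "(\<lambda>\<omega>. ell2_inner (fst \<omega>) (\<lambda>x. of_real (\<theta> x) * \<phi> x) (f \<omega>)) \<in> borel_measurable M"
      using section_weak[OF f] unfolding weak_section_def by blast
    then show "(\<lambda>\<omega>. ell2_inner (fst \<omega>) \<phi> (\<lambda>x. complex_of_real (\<theta> x) * f \<omega> x)) \<in> borel_measurable M"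
      by (simp add: ell2_inner_def algebra_simps)
  qed (use bd in blast)
  show "(\<lambda>x. complex_of_real (\<theta> x) * f \<omega> x) = (\<lambda>_. 0)" if "\<omega> \<notin> \<Omega>" for \<omega>
  proof -
    have "f \<omega> = (\<lambda>_. 0)" using f that unfolding sections_iff by blast
    then show ?thesis by simp
  qed
qed

text \<open>The measurability of the Hamiltonian is part of selfadjointness of the direct integral:
  \<open>T\<close> maps sections to sections.\<close>

lemma D_section:
  assumes f: "f \<in> sections \<mu>"
  shows "on_good op_D f \<in> sections \<mu>"
proof -
  have "on_good (\<lambda>_ u. u) (lin_section 1 (T f) (- of_real lam) f) \<in> sections \<mu>"
    using f by (intro on_good_restrict section_lin T_section)
  moreover have "on_good (\<lambda>_ u. u) (lin_section 1 (T f) (- of_real lam) f) = on_good op_D f"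
    by (simp add: on_good_def hermitian_hopping.D_def[OF good] T_apply good_support fun_eq_iff)
  ultimately show ?thesis by simp
qed

lemma damping_section:
  assumes \<theta>: "continuous_on UNIV \<theta>" "\<And>x. 0 \<le> \<theta> x" "\<And>x. \<theta> x \<le> (1 :: real)" and f: "f \<in> sections \<mu>"
  shows "on_good (\<lambda>\<omega>. op_damping \<omega> \<theta>) f \<in> sections \<mu>"
proof -
  define t where "t = (\<lambda>\<omega> x. complex_of_real (\<theta> x) * f \<omega> x)"
  define h where "h = lin_section 1 f (- 1 / of_real (2 * ((C + \<bar>lam\<bar>)\<^sup>2 + 1))) (lin_section 1 (on_good op_D (on_good op_D f)) 1 t)"
  have "on_good (\<lambda>_ u. u) h \<in> sections \<mu>"
    unfolding h_def t_def using f theta_section[OF \<theta> f]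
    by (intro on_good_restrict section_lin D_section)
  moreover have "on_good (\<lambda>_ u. u) h \<omega> = on_good (\<lambda>\<omega>. op_damping \<omega> \<theta>) f \<omega>" for \<omega>
  proof (cases "\<omega> \<in> \<Omega>\<^sub>0")
    case True
    interpret hermitian_hopping \<iota> \<omega> C R lam using good[OF True] .
    show ?thesis using True by (simp add: on_good_def h_def t_def sa.damping_def fun_eq_iff diff_divide_distrib)
  qed (simp add: on_good_def)
  then have "on_good (\<lambda>_ u. u) h = on_good (\<lambda>\<omega>. op_damping \<omega> \<theta>) f" ..
  ultimately show ?thesis by (simp only:)
qed

lemma damping_pow_section:
  assumes \<theta>: "continuous_on UNIV \<theta>" "\<And>x. 0 \<le> \<theta> x" "\<And>x. \<theta> x \<le> (1 :: real)" and f: "f \<in> sections \<mu>"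
  shows "on_good (\<lambda>\<omega>. op_damping \<omega> \<theta> ^^ k) f \<in> sections \<mu>"
proof (induction k)
  case 0
  then show ?case using on_good_restrict[OF f] by (simp add: on_good_def)
next
  case (Suc k)
  have "on_good (\<lambda>\<omega>. op_damping \<omega> \<theta> ^^ Suc k) f = on_good (\<lambda>\<omega>. op_damping \<omega> \<theta>) (on_good (\<lambda>\<omega>. op_damping \<omega> \<theta> ^^ k) f)"
    by (simp add: on_good_def fun_eq_iff)
  then show ?case using damping_section[OF \<theta> Suc.IH] by (simp only:)
qed

text \<open>Weak measurability passes to fibrewise norm limits, and the contraction bound supplies
  square integrability.\<close>

lemma limit_section:
  assumes P: "\<And>k. on_good (P k) f \<in> sections \<mu>" and f: "f \<in> sections \<mu>"
    and Q: "\<And>\<omega>. \<omega> \<in> \<Omega>\<^sub>0 \<Longrightarrow> Q \<omega> (f \<omega>) \<in> ell2 (fst \<omega>)"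
    "\<And>\<omega>. \<omega> \<in> \<Omega>\<^sub>0 \<Longrightarrow> ell2_norm (fst \<omega>) (Q \<omega> (f \<omega>)) \<le> ell2_norm (fst \<omega>) (f \<omega>)"
    "\<And>\<omega>. \<omega> \<in> \<Omega>\<^sub>0 \<Longrightarrow> (\<lambda>k. ell2_norm (fst \<omega>) (\<lambda>x. P k \<omega> (f \<omega>) x - Q \<omega> (f \<omega>) x)) \<longlonglongrightarrow> 0"
  shows "on_good Q f \<in> sections \<mu>"
proof (rule section_bounded_by[OF _ _ f])
  show "weak_section (on_good Q f)"
    unfolding weak_section_def
  proof (intro conjI ballI)
    show "on_good Q f \<omega> \<in> ell2 (fst \<omega>)" for \<omega> using Q(1) by (simp add: on_good_def)
    fix \<phi> :: "'x \<Rightarrow> complex" assume \<phi>: "\<phi> \<in> Cc"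
    show "(\<lambda>\<omega>. ell2_inner (fst \<omega>) \<phi> (on_good Q f \<omega>)) \<in> borel_measurable M"
    proof (rule borel_measurable_LIMSEQ_metric)
      show "(\<lambda>\<omega>. ell2_inner (fst \<omega>) \<phi> (on_good (P k) f \<omega>)) \<in> borel_measurable M" for k
        using section_weak[OF P[of k]] \<phi> unfolding weak_section_def by blast
      fix \<omega> assume "\<omega> \<in> space M"
      then have \<omega>: "\<omega> \<in> \<Omega>" by simp
      show "(\<lambda>k. ell2_inner (fst \<omega>) \<phi> (on_good (P k) f \<omega>)) \<longlonglongrightarrow> ell2_inner (fst \<omega>) \<phi> (on_good Q f \<omega>)"
      proof (cases "\<omega> \<in> \<Omega>\<^sub>0")
        case True
        have "(\<lambda>k. ell2_inner (fst \<omega>) (trunc (fst \<omega>) \<phi>) (P k \<omega> (f \<omega>))) \<longlonglongrightarrow>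
            ell2_inner (fst \<omega>) (trunc (fst \<omega>) \<phi>) (Q \<omega> (f \<omega>))"
        proof (rule ell2_inner_tendsto[OF trunc_in[OF \<omega> \<phi>] _ Q(1)[OF True] Q(3)[OF True]])
          show "P k \<omega> (f \<omega>) \<in> ell2 (fst \<omega>)" for k
            using section_in[OF P[of k] \<omega>] True by (simp add: on_good_def)
        qed
        then show ?thesis using True by (simp add: on_good_def ell2_inner_trunc)
      qed (simp add: on_good_def)
    qed
  qed
  show "ell2_norm (fst \<omega>) (on_good Q f \<omega>) \<le> ell2_norm (fst \<omega>) (f \<omega>)" for \<omega>
    using Q(2) by (simp add: on_good_def ell2_norm_def infsum_nonneg)
  show "on_good Q f \<omega> = (\<lambda>_. 0)" if "\<omega> \<notin> \<Omega>" for \<omega>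
    using good_support[of \<omega>] that by (auto simp: on_good_def)
qed

lemma ker_proj_section:
  assumes \<theta>: "continuous_on UNIV \<theta>" "\<And>x. 0 \<le> \<theta> x" "\<And>x. \<theta> x \<le> (1 :: real)" and f: "f \<in> sections \<mu>"
  shows "on_good (\<lambda>\<omega>. ell2_proj (fst \<omega>) (op_ker \<omega> \<theta>)) f \<in> sections \<mu>"
proof (rule limit_section[where P = "\<lambda>k \<omega>. op_damping \<omega> \<theta> ^^ (2 * k)", OF damping_pow_section[OF \<theta> f] f])
  fix \<omega> assume \<omega>: "\<omega> \<in> \<Omega>\<^sub>0"
  interpret hermitian_hopping \<iota> \<omega> C R lam using good[OF \<omega>] .
  have f\<omega>: "f \<omega> \<in> ell2 A" using section_in[OF f good_support[OF \<omega>]] .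
  note proj = sa.ker_has_proj[of \<theta>, OF \<theta>(2,3)]
  show "ell2_proj A (sa.ker \<theta>) (f \<omega>) \<in> ell2 A" using proj f\<omega> by (rule ell2_proj_in)
  show "ell2_norm A (ell2_proj A (sa.ker \<theta>) (f \<omega>)) \<le> ell2_norm A (f \<omega>)" using proj f\<omega> by (rule ell2_norm_proj(2))
  show "(\<lambda>k. ell2_norm A (\<lambda>x. (sa.damping \<theta> ^^ (2 * k)) (f \<omega>) x - ell2_proj A (sa.ker \<theta>) (f \<omega>) x)) \<longlonglongrightarrow> 0"
    using \<theta>(2,3) f\<omega> by (rule sa.damping_tendsto)
qed

lemma eigen_section: "f \<in> sections \<mu> \<Longrightarrow> on_good (\<lambda>\<omega>. ell2_proj (fst \<omega>) (eigen_sp \<omega>)) f \<in> sections \<mu>"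
  by (rule ker_proj_section) auto

lemma comp_section:
  assumes f: "f \<in> sections \<mu>"
  shows "on_good (\<lambda>\<omega>. ell2_proj (fst \<omega>) (comp_sp \<omega>)) f \<in> sections \<mu>"
proof (rule limit_section[OF _ f])
  \<comment> \<open>\<open>undefined\<close> serves as a base point of the space that is the same
    for all configurations.\<close>
  show "on_good (\<lambda>\<omega>. ell2_proj (fst \<omega>) (op_ker \<omega> (hermitian_hopping.cutoff undefined n))) f \<in> sections \<mu>" for n
  proof -
    define \<theta> :: "'x \<Rightarrow> real" where "\<theta> = (\<lambda>x. min 1 (max 0 (dist undefined x - real n)))"
    have "on_good (\<lambda>\<omega>. ell2_proj (fst \<omega>) (op_ker \<omega> \<theta>)) f \<in> sections \<mu>"
      unfolding \<theta>_def by (intro ker_proj_section[OF _ _ _ f] continuous_intros) auto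
    moreover have "hermitian_hopping.cutoff undefined n = \<theta>" if "\<omega> \<in> \<Omega>\<^sub>0" for \<omega>
      unfolding \<theta>_def hermitian_hopping.cutoff_def[OF good[OF that]] ..
    then have "on_good (\<lambda>\<omega>. ell2_proj (fst \<omega>) (op_ker \<omega> (hermitian_hopping.cutoff undefined n))) f =
        on_good (\<lambda>\<omega>. ell2_proj (fst \<omega>) (op_ker \<omega> \<theta>)) f"
      by (auto simp: on_good_def)
    ultimately show ?thesis by simp
  qed
  fix \<omega> assume \<omega>: "\<omega> \<in> \<Omega>\<^sub>0"
  interpret hermitian_hopping \<iota> \<omega> C R lam using good[OF \<omega>] .
  have f\<omega>: "f \<omega> \<in> ell2 A" using section_in[OF f good_support[OF \<omega>]] .
  show "ell2_proj A comp_space (f \<omega>) \<in> ell2 A" using comp_space_has_proj f\<omega> by (rule ell2_proj_in)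
  show "ell2_norm A (ell2_proj A comp_space (f \<omega>)) \<le> ell2_norm A (f \<omega>)"
    using comp_space_has_proj f\<omega> by (rule ell2_norm_proj(2))
  show "(\<lambda>n. ell2_norm A (\<lambda>x. ell2_proj A (sa.ker (cutoff undefined n)) (f \<omega>) x - ell2_proj A comp_space (f \<omega>) x)) \<longlonglongrightarrow> 0"
    using f\<omega> by (rule comp_proj_tendsto)
qed

text \<open>A smoothed local trace of the projection onto the defect space. The bump replaces the
  indicator of a ball, so that measurability follows from that of sections.\<close>

definition defect_density :: "'x \<Rightarrow> ('x, 'c) conf \<Rightarrow> real" where
  "defect_density p \<omega> = (if \<omega> \<in> \<Omega>\<^sub>0 then
     Re (ell2_inner (fst \<omega>) (trunc (fst \<omega>) (bump p)) (ell2_proj (fst \<omega>) (defect_sp \<omega>) (trunc (fst \<omega>) (bump p))))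
     else 0)"

lemma defect_density_measurable: "defect_density p \<in> borel_measurable \<mu>"
proof -
  let ?e = "on_good (\<lambda>\<omega>. ell2_proj (fst \<omega>) (eigen_sp \<omega>)) (bump_section p)"
  let ?c = "on_good (\<lambda>\<omega>. ell2_proj (fst \<omega>) (comp_sp \<omega>)) (bump_section p)"
  let ?h = "lin_section 1 ?e (- 1) ?c"
  have "?h \<in> sections \<mu>" by (intro section_lin eigen_section comp_section bump_section)
  then have "(\<lambda>\<omega>. ell2_inner (fst \<omega>) (bump_section p \<omega>) (?h \<omega>)) \<in> borel_measurable M"
    by (intro inner_measurable section_weak bump_section)
  then have "(\<lambda>\<omega>. Re (ell2_inner (fst \<omega>) (bump_section p \<omega>) (?h \<omega>))) \<in> borel_measurable M" by measurable
  moreover have "Re (ell2_inner (fst \<omega>) (bump_section p \<omega>) (?h \<omega>)) = defect_density p \<omega>" if "\<omega> \<in> \<Omega>" for \<omega>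
  proof (cases "\<omega> \<in> \<Omega>\<^sub>0")
    case True
    interpret hermitian_hopping \<iota> \<omega> C R lam using good[OF True] .
    show ?thesis using True that
      by (simp add: defect_density_def on_good_def bump_section_def defect_proj trunc_in bump_Cc)
  next
    case False
    then show ?thesis by (simp add: defect_density_def on_good_def ell2_inner_def)
  qed
  ultimately have "defect_density p \<in> borel_measurable M" by (rule measurable_cong[THEN iffD1, rotated]) simp
  then have "(\<lambda>\<omega>. indicator \<Omega> \<omega> *\<^sub>R defect_density p \<omega>) \<in> borel_measurable \<mu>"
    using borel_measurable_restrict_space_iff[of \<Omega> \<mu> "defect_density p"] support_sets by (simp add: sets.Int_space_eq2)
  moreover have "(\<lambda>\<omega>. indicator \<Omega> \<omega> *\<^sub>R defect_density p \<omega>) = defect_density p"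
  proof
    show "indicator \<Omega> \<omega> *\<^sub>R defect_density p \<omega> = defect_density p \<omega>" for \<omega>
      using good_support[of \<omega>] by (auto simp: defect_density_def indicator_def)
  qed
  ultimately show ?thesis by (simp only:)
qed

definition diag :: "('x, 'c) conf \<Rightarrow> 'x \<Rightarrow> real" where
  "diag \<omega> x = Re (ell2_proj (fst \<omega>) (defect_sp \<omega>) (delta x) x)"

lemma diag_nonneg:
  assumes "\<omega> \<in> \<Omega>\<^sub>0" "x \<in> fst \<omega>"
  shows "0 \<le> diag \<omega> x"
proof -
  interpret hermitian_hopping \<iota> \<omega> C R lam using good[OF assms(1)] .
  show ?thesis using delta_proj_diag[OF defect_has_proj assms(2)] by (simp add: diag_def)
qed

text \<open>The ball contains at most one point of the configuration, so the sum has at most one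
  term and no off-diagonal entries appear.\<close>

lemma defect_density_eq:
  assumes \<omega>: "\<omega> \<in> \<Omega>\<^sub>0"
  shows "defect_density p \<omega> = (\<Sum>x\<in>fst \<omega> \<inter> ball p (1 / 2). (1 / 2 - dist p x)\<^sup>2 * diag \<omega> x)"
proof -
  interpret hermitian_hopping \<iota> \<omega> C R lam using good[OF \<omega>] .
  show ?thesis
  proof (cases "\<exists>x\<in>A. dist p x < 1 / 2")
    case True
    then obtain x where x: "x \<in> A" "dist p x < 1 / 2" by blast
    have eq: "A \<inter> ball p (1 / 2) = {x}" using sep x by (rule separated_ball)
    have scale: "(\<lambda>y. c * u y) \<in> defect" if "u \<in> defect" for u c
    proof -
      have u: "u \<in> eigenspace" "u \<in> ell2 A" using that by (auto simp: defect_def sa.ker_def)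
      have "(\<lambda>y. c * u y) \<in> eigenspace" using eigenspace_closed_lin[OF u(1) u(1), of c 0] by simp
      moreover have "ell2_inner A s (\<lambda>y. c * u y) = 0" if "s \<in> solutions" for s
        using that \<open>u \<in> defect\<close> u(2) by (simp add: ell2_inner_scale_right defect_def compact_solutions_def)
      ultimately show ?thesis by (simp add: defect_def)
    qed
    have t: "trunc A (bump p) = (\<lambda>y. bump p x * delta x y)" using sep x by (rule trunc_bump(1))
    have bp: "bump p x = of_real (1 / 2 - dist p x)" using x by (simp add: bump_def)
    define w where "w = ell2_proj A defect (delta x)"
    have w: "w \<in> ell2 A" using ell2_proj_in[OF defect_has_proj delta_in[OF x(1)]] by (simp add: w_def)
    have "ell2_inner A (trunc A (bump p)) (ell2_proj A defect (trunc A (bump p))) =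
        ell2_inner A (\<lambda>y. bump p x * delta x y) (\<lambda>y. bump p x * w y)"
      unfolding t w_def using ell2_proj_scale[OF defect_has_proj scale delta_in[OF x(1)]] by simp
    also have "\<dots> = cnj (bump p x) * ell2_inner A (delta x) (\<lambda>y. bump p x * w y)"
      using ell2.lin_ip[OF ell2_scale[OF w] delta_in[OF x(1)] delta_in[OF x(1)], of "bump p x" 0] by simp
    also have "\<dots> = of_real ((1 / 2 - dist p x)\<^sup>2) * w x"
      using x(1) by (simp add: ell2_inner_delta bp power2_eq_square)
    finally show ?thesis using \<omega> eq by (simp add: defect_density_def diag_def w_def del: of_real_power)
  next
    case False
    then have "trunc A (bump p) = (\<lambda>_. 0)" by (intro trunc_bump(2) sep) force
    moreover have "A \<inter> ball p (1 / 2) = {}" using False by auto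
    ultimately show ?thesis by (simp add: defect_density_def ell2_inner_def)
  qed
qed

lemma defect_density_nonneg: "0 \<le> defect_density p \<omega>"
proof (cases "\<omega> \<in> \<Omega>\<^sub>0")
  case True
  then show ?thesis unfolding defect_density_eq[OF True] by (intro sum_nonneg mult_nonneg_nonneg diag_nonneg) auto
qed (simp add: defect_density_def)

lemma defect_density_le:
  assumes \<omega>: "\<omega> \<in> \<Omega>\<^sub>0"
  shows "defect_density p \<omega> \<le> (\<Sum>x\<in>fst \<omega> \<inter> ball p (1 / 2). diag \<omega> x)"
  unfolding defect_density_eq[OF \<omega>]
proof (rule sum_mono)
  fix x assume x: "x \<in> fst \<omega> \<inter> ball p (1 / 2)"
  have "(1 / 2 - dist p x)\<^sup>2 \<le> 1\<^sup>2" using x zero_le_dist[of p x] by (intro power_mono) (auto simp del: zero_le_dist)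
  then show "(1 / 2 - dist p x)\<^sup>2 * diag \<omega> x \<le> diag \<omega> x"
    using diag_nonneg[OF \<omega>, of x] x by (intro mult_left_le_one_le) auto
qed

text \<open>The half-balls around the separated orbit points are disjoint and lie in \<Lambda>. As
  diagonal entries are nonnegative, the sum is at most the trace over \<Lambda>.\<close>

lemma sum_defect_density_le:
  assumes \<omega>: "\<omega> \<in> \<Omega>\<^sub>0" and G: "finite G" and \<Lambda>: "bounded \<Lambda>"
    and sepG: "\<And>g h. g \<in> G \<Longrightarrow> h \<in> G \<Longrightarrow> g \<noteq> h \<Longrightarrow> 1 \<le> dist (act g p) (act h p)"
    and sub: "\<And>g. g \<in> G \<Longrightarrow> ball (act g p) (1 / 2) \<subseteq> \<Lambda>"
    and fin: "finite {x \<in> fst \<omega>. x \<notin> \<Lambda> \<and> (\<exists>y\<in>\<Lambda>. dist x y < 2 * R)}"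
  shows "(\<Sum>g\<in>G. defect_density (act g p) \<omega>) \<le> card {x \<in> fst \<omega>. x \<notin> \<Lambda> \<and> (\<exists>y\<in>\<Lambda>. dist x y < 2 * R)}"
proof -
  interpret hermitian_hopping \<iota> \<omega> C R lam using good[OF \<omega>] .
  have "(\<Sum>g\<in>G. defect_density (act g p) \<omega>) \<le> (\<Sum>g\<in>G. \<Sum>x\<in>A \<inter> ball (act g p) (1 / 2). diag \<omega> x)"
    by (intro sum_mono defect_density_le \<omega>)
  also have "\<dots> = (\<Sum>x\<in>(\<Union>g\<in>G. A \<inter> ball (act g p) (1 / 2)). diag \<omega> x)"
  proof (rule sum.UNION_disjoint[symmetric, OF G])
    show "\<forall>g\<in>G. finite (A \<inter> ball (act g p) (1 / 2))" by (intro ballI finite_bounded) simp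
    show "\<forall>g\<in>G. \<forall>h\<in>G. g \<noteq> h \<longrightarrow> A \<inter> ball (act g p) (1 / 2) \<inter> (A \<inter> ball (act h p) (1 / 2)) = {}"
    proof (intro ballI impI, rule ccontr)
      fix g h assume gh: "g \<in> G" "h \<in> G" "g \<noteq> h" "A \<inter> ball (act g p) (1 / 2) \<inter> (A \<inter> ball (act h p) (1 / 2)) \<noteq> {}"
      then obtain x where "dist (act g p) x < 1 / 2" "dist (act h p) x < 1 / 2" by auto
      then have "dist (act g p) (act h p) < 1" using dist_triangle2[of "act g p" "act h p" x] by simp
      then show False using sepG[OF gh(1-3)] by simp
    qed
  qed
  also have "\<dots> \<le> (\<Sum>x\<in>A \<inter> \<Lambda>. diag \<omega> x)"
    using sub by (intro sum_mono2 finite_bounded[OF \<Lambda>] diag_nonneg[OF \<omega>]) auto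
  also have "\<dots> \<le> card {x \<in> A. x \<notin> \<Lambda> \<and> (\<exists>y\<in>\<Lambda>. dist x y < 2 * R)}"
    using defect_trace_le[OF \<Lambda> fin] by (simp add: diag_def)
  finally show ?thesis .
qed

subsection \<open>Invariance\<close>

lemma act_conf_simps:
  "fst (act_conf act g \<omega>) = act g ` fst \<omega>"
  "x \<in> fst \<omega> \<Longrightarrow> y \<in> fst \<omega> \<Longrightarrow>
    matrix_element \<iota> (act_conf act g \<omega>) (act g x) (act g y) = matrix_element \<iota> \<omega> x y"
  by (auto simp: act_conf_def matrix_element_def split: prod.splits)

lemma act_conf_in: "\<omega> \<in> configurations \<Longrightarrow> act_conf act g \<omega> \<in> configurations"
  by (auto simp: configurations_def act_conf_def) (metis act_dist)

lemma inj_act: "inj_on (act g) S"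
  by (rule inj_on_inverseI[of _ "act (- g)"]) simp

text \<open>The unitary translation from the fibre over \<omega> to the one over
  \<open>act_conf act g \<omega>\<close>. It intertwines the Hamiltonians because
  \<open>act_conf\<close> carries the matrix elements along.\<close>

definition shift :: "'g \<Rightarrow> ('x \<Rightarrow> complex) \<Rightarrow> 'x \<Rightarrow> complex" where
  "shift g v = (\<lambda>x. v (act (- g) x))"

lemma shift_shift [simp]: "shift g (shift (- g) v) = v"
  by (simp add: shift_def)

lemma shift_inner: "ell2_inner (act g ` A) (shift g u) (shift g v) = ell2_inner A u v"
  unfolding ell2_inner_def shift_def by (subst infsum_reindex[OF inj_act]) (simp add: comp_def)

lemma shift_ell2: "shift g v \<in> ell2 (act g ` A) \<longleftrightarrow> v \<in> ell2 A"
proof -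
  have "(\<lambda>x. (cmod (v (act (- g) x)))\<^sup>2) summable_on (act g ` A) \<longleftrightarrow> (\<lambda>x. (cmod (v x))\<^sup>2) summable_on A"
    by (subst summable_on_reindex[OF inj_act]) (simp add: comp_def)
  moreover have "(\<forall>x. x \<notin> act g ` A \<longrightarrow> v (act (- g) x) = 0) \<longleftrightarrow> (\<forall>x. x \<notin> A \<longrightarrow> v x = 0)"
  proof
    assume L: "\<forall>x. x \<notin> act g ` A \<longrightarrow> v (act (- g) x) = 0"
    show "\<forall>x. x \<notin> A \<longrightarrow> v x = 0"
    proof (intro allI impI)
      fix x assume "x \<notin> A"
      then have "act g x \<notin> act g ` A" using inj_act[of g UNIV] by (auto dest: injD)
      then show "v x = 0" using L[rule_format, of "act g x"] by simp
    qed
  next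
    assume R: "\<forall>x. x \<notin> A \<longrightarrow> v x = 0"
    show "\<forall>x. x \<notin> act g ` A \<longrightarrow> v (act (- g) x) = 0"
    proof (intro allI impI)
      fix x assume "x \<notin> act g ` A"
      then have "act (- g) x \<notin> A" using act_minus(2)[of g x] by (metis image_eqI)
      then show "v (act (- g) x) = 0" using R by simp
    qed
  qed
  ultimately show ?thesis by (simp add: ell2_def shift_def)
qed

lemma shift_hamiltonian: "hamiltonian \<iota> (act_conf act g \<omega>) (shift g v) = shift g (hamiltonian \<iota> \<omega> v)"
proof
  fix x
  have mem: "x \<in> act g ` fst \<omega> \<longleftrightarrow> act (- g) x \<in> fst \<omega>"
    by (metis (no_types, lifting) act_minus image_iff)
  show "hamiltonian \<iota> (act_conf act g \<omega>) (shift g v) x = shift g (hamiltonian \<iota> \<omega> v) x"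
  proof (cases "act (- g) x \<in> fst \<omega>")
    case True
    have "hamiltonian \<iota> (act_conf act g \<omega>) (shift g v) x =
        (\<Sum>\<^sub>\<infinity>y\<in>act g ` fst \<omega>. matrix_element \<iota> (act_conf act g \<omega>) x y * v (act (- g) y))"
      using True mem by (simp add: hamiltonian_def act_conf_simps shift_def)
    also have "\<dots> = (\<Sum>\<^sub>\<infinity>y\<in>fst \<omega>. matrix_element \<iota> (act_conf act g \<omega>) x (act g y) * v y)"
      by (subst infsum_reindex[OF inj_act]) (simp add: comp_def)
    also have "\<dots> = (\<Sum>\<^sub>\<infinity>y\<in>fst \<omega>. matrix_element \<iota> \<omega> (act (- g) x) y * v y)"
    proof (rule infsum_cong)
      show "matrix_element \<iota> (act_conf act g \<omega>) x (act g y) * v y = matrix_element \<iota> \<omega> (act (- g) x) y * v y"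
        if "y \<in> fst \<omega>" for y
        using act_conf_simps(2)[OF True that, of g] by simp
    qed
    finally show ?thesis using True by (simp add: hamiltonian_def shift_def)
  next
    case False
    then show ?thesis using mem by (simp add: hamiltonian_def shift_def act_conf_simps)
  qed
qed

lemma shift_eq_iff: "shift g u = shift g v \<longleftrightarrow> u = v"
proof
  assume "shift g u = shift g v"
  then have "shift g u (act g x) = shift g v (act g x)" for x by simp
  then show "u = v" by (simp add: shift_def fun_eq_iff)
qed simp

lemma shift_solutions:
  "shift g u \<in> compact_solutions \<iota> lam (act_conf act g \<omega>) \<longleftrightarrow> u \<in> compact_solutions \<iota> lam \<omega>"
proof -
  have "(\<exists>K. compact K \<and> {x. shift g u x \<noteq> 0} \<subseteq> K) \<longleftrightarrow> (\<exists>K. compact K \<and> {x. u x \<noteq> 0} \<subseteq> K)"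
  proof
    assume "\<exists>K. compact K \<and> {x. shift g u x \<noteq> 0} \<subseteq> K"
    then obtain K where K: "compact K" "{x. shift g u x \<noteq> 0} \<subseteq> K" by blast
    have "{x. u x \<noteq> 0} \<subseteq> act (- g) ` K"
    proof
      fix x assume "x \<in> {x. u x \<noteq> 0}"
      then have "act g x \<in> K" using K(2) by (auto simp: shift_def)
      then show "x \<in> act (- g) ` K" by (metis act_minus(1) image_eqI)
    qed
    then show "\<exists>K. compact K \<and> {x. u x \<noteq> 0} \<subseteq> K"
      using compact_continuous_image[OF continuous_act K(1)] by blast
  next
    assume "\<exists>K. compact K \<and> {x. u x \<noteq> 0} \<subseteq> K"
    then obtain K where K: "compact K" "{x. u x \<noteq> 0} \<subseteq> K" by blast
    have "{x. shift g u x \<noteq> 0} \<subseteq> act g ` K"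
    proof
      fix x assume "x \<in> {x. shift g u x \<noteq> 0}"
      then have "act (- g) x \<in> K" using K(2) by (auto simp: shift_def)
      then show "x \<in> act g ` K" by (metis act_minus(2) image_eqI)
    qed
    then show "\<exists>K. compact K \<and> {x. shift g u x \<noteq> 0} \<subseteq> K"
      using compact_continuous_image[OF continuous_act K(1)] by blast
  qed
  moreover have "(\<lambda>x. of_real lam * shift g u x) = shift g (\<lambda>x. of_real lam * u x)"
    by (simp add: shift_def)
  ultimately show ?thesis
    unfolding compact_solutions_def by (simp add: act_conf_simps shift_ell2 shift_hamiltonian shift_eq_iff)
qed

lemma shift_defect:
  assumes "\<omega> \<in> \<Omega>\<^sub>0" "act_conf act g \<omega> \<in> \<Omega>\<^sub>0"
  shows "shift g u \<in> defect_sp (act_conf act g \<omega>) \<longleftrightarrow> u \<in> defect_sp \<omega>"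
proof -
  interpret A: hermitian_hopping \<iota> \<omega> C R lam using good[OF assms(1)] .
  interpret B: hermitian_hopping \<iota> "act_conf act g \<omega>" C R lam using good[OF assms(2)] .
  have sc: "(\<lambda>x. of_real lam * shift g u x) = shift g (\<lambda>x. of_real lam * u x)"
    by (simp add: shift_def)
  have ker: "shift g u \<in> B.eigenspace \<longleftrightarrow> u \<in> A.eigenspace"
    unfolding A.eigenspace_iff B.eigenspace_iff sc by (simp add: act_conf_simps shift_ell2 shift_hamiltonian shift_eq_iff)
  have "(\<forall>s\<in>B.solutions. ell2_inner B.A s (shift g u) = 0) \<longleftrightarrow> (\<forall>s\<in>A.solutions. ell2_inner A.A s u = 0)"
  proof
    assume L: "\<forall>s\<in>B.solutions. ell2_inner B.A s (shift g u) = 0"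
    show "\<forall>s\<in>A.solutions. ell2_inner A.A s u = 0"
    proof
      fix s assume "s \<in> A.solutions"
      then have "shift g s \<in> B.solutions" by (simp add: shift_solutions)
      then show "ell2_inner A.A s u = 0" using L shift_inner[of g A.A s u] by (simp add: act_conf_simps)
    qed
  next
    assume R: "\<forall>s\<in>A.solutions. ell2_inner A.A s u = 0"
    show "\<forall>s\<in>B.solutions. ell2_inner B.A s (shift g u) = 0"
    proof
      fix s assume "s \<in> B.solutions"
      then have "shift (- g) s \<in> A.solutions" using shift_solutions[of g "shift (- g) s" \<omega>] by simp
      then show "ell2_inner B.A s (shift g u) = 0"
        using R shift_inner[of g A.A "shift (- g) s" u] by (simp add: act_conf_simps)
    qed
  qed
  then show ?thesis unfolding A.defect_def B.defect_def using ker by blast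
qed

lemma defect_density_act:
  assumes \<omega>: "\<omega> \<in> \<Omega>\<^sub>0" "act_conf act g \<omega> \<in> \<Omega>\<^sub>0"
  shows "defect_density p (act_conf act g \<omega>) = defect_density (act (- g) p) \<omega>"
proof -
  interpret A: hermitian_hopping \<iota> \<omega> C R lam using good[OF \<omega>(1)] .
  interpret B: hermitian_hopping \<iota> "act_conf act g \<omega>" C R lam using good[OF \<omega>(2)] .
  define t where "t = trunc A.A (bump (act (- g) p))"
  have t: "t \<in> ell2 A.A" unfolding t_def by (intro trunc_in good_support \<omega> bump_Cc)
  have BA: "B.A = act g ` A.A" by (simp add: act_conf_simps)
  have "trunc B.A (bump p) x = shift g t x" for x
  proof -
    have "x \<in> act g ` A.A \<longleftrightarrow> act (- g) x \<in> A.A" by (metis (no_types, lifting) act_minus image_iff)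
    moreover have "bump p x = bump (act (- g) p) (act (- g) x)" by (simp add: bump_def)
    ultimately show ?thesis by (simp add: trunc_def t_def shift_def BA)
  qed
  then have st: "trunc B.A (bump p) = shift g t" ..
  define w where "w = ell2_proj A.A A.defect t"
  have w: "w \<in> A.defect" "w \<in> ell2 A.A"
    unfolding w_def using ell2_proj(1)[OF A.defect_has_proj t] ell2_proj_in[OF A.defect_has_proj t] by auto
  have "ell2_proj B.A B.defect (shift g t) = shift g w"
  proof (rule ell2_projI)
    show "B.defect \<subseteq> ell2 B.A" using B.defect_has_proj by (simp add: ell2_has_proj_def)
    show "shift g t \<in> ell2 B.A" using t by (simp add: BA shift_ell2)
    show "shift g w \<in> B.defect" using w shift_defect[OF \<omega>] by simp
    fix u assume "u \<in> B.defect"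
    then have u: "shift (- g) u \<in> A.defect" using shift_defect[OF \<omega>, of "shift (- g) u"] by simp
    have "ell2_inner B.A u (\<lambda>x. shift g t x - shift g w x) =
        ell2_inner (act g ` A.A) (shift g (shift (- g) u)) (shift g (\<lambda>x. t x - w x))"
      by (simp add: BA) (simp add: shift_def)
    also have "\<dots> = 0"
      unfolding shift_inner w_def using ell2_proj(2)[OF A.defect_has_proj t u] .
    finally show "ell2_inner B.A u (\<lambda>x. shift g t x - shift g w x) = 0" .
  qed
  moreover have "defect_density p (act_conf act g \<omega>) =
      Re (ell2_inner B.A (shift g t) (ell2_proj B.A B.defect (shift g t)))"
    using \<omega>(2) unfolding defect_density_def st by simp
  moreover have "defect_density (act (- g) p) \<omega> = Re (ell2_inner A.A t w)"
    using \<omega>(1) unfolding defect_density_def t_def[symmetric] w_def[symmetric] by simp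
  ultimately show ?thesis unfolding BA by (simp add: shift_inner)
qed

text \<open>A non-measurable map would give the invalid value 0 to some set and to its complement.\<close>

lemma act_conf_measurable: "act_conf act g \<in> measurable \<mu> \<mu>"
proof (rule measurableI)
  let ?T = "act_conf act g"
  show "?T \<omega> \<in> space \<mu>" if "\<omega> \<in> space \<mu>" for \<omega>
    using that act_conf_in by (simp add: space_\<mu>)
  define \<nu> where "\<nu> B = emeasure \<mu> (?T -` B \<inter> space \<mu>)" for B
  have em: "emeasure \<mu> B = \<nu> B" if B: "B \<in> sets \<mu>" for B
  proof -
    \<comment> \<open>Unfolding \<open>distr\<close> exposes two default values: 0 off the
      sigma-algebra, and 0 everywhere if \<nu> is not a measure. The total mass 1 of \<mu> rules out
      the second.\<close>
    have d: "emeasure \<mu> X = (if X \<in> sets \<mu> \<and> measure_space (space \<mu>) (sets \<mu>) \<nu> then \<nu> X else 0)" for X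
    proof -
      have "emeasure \<mu> X = emeasure (distr \<mu> \<mu> ?T) X" using invariant by simp
      also have "\<dots> = emeasure (measure_of (space \<mu>) (sets \<mu>) \<nu>) X" by (simp add: distr_def \<nu>_def[abs_def])
      finally show ?thesis by (simp add: emeasure_measure_of_conv sets.sigma_sets_eq)
    qed
    have "measure_space (space \<mu>) (sets \<mu>) \<nu>" using d[of "space \<mu>"] emeasure_space_1 by (auto split: if_splits)
    then show ?thesis using d[of B] B by simp
  qed
  fix B assume B: "B \<in> sets \<mu>"
  show "?T -` B \<inter> space \<mu> \<in> sets \<mu>"
  proof (rule ccontr)
    assume no: "?T -` B \<inter> space \<mu> \<notin> sets \<mu>"
    have eq: "?T -` (space \<mu> - B) \<inter> space \<mu> = space \<mu> - (?T -` B \<inter> space \<mu>)"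
      using act_conf_in by (auto simp: space_\<mu>)
    have "?T -` (space \<mu> - B) \<inter> space \<mu> \<notin> sets \<mu>"
    proof
      assume "?T -` (space \<mu> - B) \<inter> space \<mu> \<in> sets \<mu>"
      then have "space \<mu> - (space \<mu> - (?T -` B \<inter> space \<mu>)) \<in> sets \<mu>" unfolding eq by (rule sets.compl_sets)
      moreover have "space \<mu> - (space \<mu> - (?T -` B \<inter> space \<mu>)) = ?T -` B \<inter> space \<mu>" by blast
      ultimately show False using no by simp
    qed
    then have "emeasure \<mu> B = 0" "emeasure \<mu> (space \<mu> - B) = 0"
      using em[OF B] em[OF sets.compl_sets[OF B]] no by (simp_all add: \<nu>_def emeasure_notin_sets)
    moreover have "emeasure \<mu> B + emeasure \<mu> (space \<mu> - B) = emeasure \<mu> (space \<mu>)"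
      using B sets.sets_into_space[OF B] by (subst plus_emeasure) (auto simp: Un_absorb1)
    ultimately show False using emeasure_space_1 by simp
  qed
qed

lemma good_AE_\<mu>: "AE \<omega> in \<mu>. \<omega> \<in> \<Omega>\<^sub>0"
proof -
  have "AE \<omega> in \<mu>. \<omega> \<in> \<Omega> \<longrightarrow> \<omega> \<in> \<Omega>\<^sub>0"
    using good_AE support_sets by (simp add: AE_restrict_space_iff sets.Int_space_eq2)
  with AE_support show ?thesis by eventually_elim simp
qed

lemma defect_density_integrable: "integrable \<mu> (defect_density p)"
proof (rule Bochner_Integration.integrable_bound[OF _ defect_density_measurable])
  show "integrable \<mu> (\<lambda>_. 1 :: real)" by simp
  show "AE \<omega> in \<mu>. norm (defect_density p \<omega>) \<le> norm (1 :: real)"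
  proof (rule AE_I2)
    fix \<omega>
    have "defect_density p \<omega> \<le> 1"
    proof (cases "\<omega> \<in> \<Omega>\<^sub>0")
      case True
      interpret hermitian_hopping \<iota> \<omega> C R lam using good[OF True] .
      let ?t = "trunc A (bump p)"
      have t: "?t \<in> ell2 A" by (intro trunc_in good_support True bump_Cc)
      have "defect_density p \<omega> = (ell2_norm A (ell2_proj A defect ?t))\<^sup>2"
        using True ell2_norm_proj(1)[OF defect_has_proj t] by (simp add: defect_density_def)
      also have "\<dots> \<le> (ell2_norm A ?t)\<^sup>2" using ell2_norm_proj(2)[OF defect_has_proj t] by (intro power_mono) auto
      also have "\<dots> \<le> 1" using bump_norm_le[of \<omega> p] good_support[OF True] by simp
      finally show ?thesis .
    qed (simp add: defect_density_def)
    then show "norm (defect_density p \<omega>) \<le> norm (1 :: real)" using defect_density_nonneg[of p \<omega>] by simp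
  qed
qed

lemma defect_density_integral_act: "(\<integral>\<omega>. defect_density (act g p) \<omega> \<partial>\<mu>) = (\<integral>\<omega>. defect_density p \<omega> \<partial>\<mu>)"
proof -
  have "(\<integral>\<omega>. defect_density (act g p) \<omega> \<partial>\<mu>) = (\<integral>\<omega>. defect_density (act g p) \<omega> \<partial>distr \<mu> \<mu> (act_conf act g))"
    using invariant by simp
  also have "\<dots> = (\<integral>\<omega>. defect_density (act g p) (act_conf act g \<omega>) \<partial>\<mu>)"
    by (rule integral_distr[OF act_conf_measurable defect_density_measurable])
  also have "\<dots> = (\<integral>\<omega>. defect_density p \<omega> \<partial>\<mu>)"
  proof (rule integral_cong_AE)
    show "(\<lambda>\<omega>. defect_density (act g p) (act_conf act g \<omega>)) \<in> borel_measurable \<mu>"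
      using measurable_compose[OF act_conf_measurable defect_density_measurable] .
    \<comment> \<open>\<open>\<Omega>\<^sub>0\<close> need not be invariant under the action, but by
      invariance of \<mu> almost every translated configuration lies in it.\<close>
    have "AE \<omega> in distr \<mu> \<mu> (act_conf act g). \<omega> \<in> \<Omega>\<^sub>0"
      unfolding invariant[rule_format, of g] by (rule good_AE_\<mu>)
    then have "AE \<omega> in \<mu>. act_conf act g \<omega> \<in> \<Omega>\<^sub>0" by (rule AE_distrD[OF act_conf_measurable])
    with good_AE_\<mu> show "AE \<omega> in \<mu>. defect_density (act g p) (act_conf act g \<omega>) = defect_density p \<omega>"
      by eventually_elim (simp add: defect_density_act)
  qed (rule defect_density_measurable)
  finally show ?thesis .
qed

lemma defect_density_integral_0: "(\<integral>\<omega>. defect_density p \<omega> \<partial>\<mu>) = 0"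
proof -
  have "(\<integral>\<omega>. defect_density p \<omega> \<partial>\<mu>) \<le> 0 + \<epsilon>" if "\<epsilon> > 0" for \<epsilon>
  proof (rule Foelner_space[OF that, where p = p and R = "2 * R"])
    fix G \<Lambda>
    assume G: "finite G" "G \<noteq> {}" "bounded \<Lambda>"
      and sepG: "\<And>g h. g \<in> G \<Longrightarrow> h \<in> G \<Longrightarrow> g \<noteq> h \<Longrightarrow> 1 \<le> dist (act g p) (act h p)"
      and sub: "\<And>g. g \<in> G \<Longrightarrow> ball (act g p) (1 / 2) \<subseteq> \<Lambda>"
      and bd: "\<And>A. separated 1 A \<Longrightarrow>
        finite {x \<in> A. x \<notin> \<Lambda> \<and> (\<exists>y\<in>\<Lambda>. dist x y < 2 * R)} \<and>
        real (card {x \<in> A. x \<notin> \<Lambda> \<and> (\<exists>y\<in>\<Lambda>. dist x y < 2 * R)}) \<le> \<epsilon> * real (card G)"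
    have "(\<Sum>g\<in>G. defect_density (act g p) \<omega>) \<le> \<epsilon> * real (card G)" if \<omega>: "\<omega> \<in> \<Omega>\<^sub>0" for \<omega>
    proof -
      note b = bd[OF separated_conf[OF good_support[OF \<omega>]]]
      show ?thesis using sum_defect_density_le[OF \<omega> G(1,3) sepG sub b[THEN conjunct1]] b[THEN conjunct2] by linarith
    qed
    with good_AE_\<mu> have "AE \<omega> in \<mu>. (\<Sum>g\<in>G. defect_density (act g p) \<omega>) \<le> \<epsilon> * real (card G)" by auto
    then have "(\<integral>\<omega>. (\<Sum>g\<in>G. defect_density (act g p) \<omega>) \<partial>\<mu>) \<le> (\<integral>\<omega>. \<epsilon> * real (card G) \<partial>\<mu>)"
      by (intro integral_mono_AE Bochner_Integration.integrable_sum defect_density_integrable) auto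
    also have "\<dots> = \<epsilon> * real (card G)" by (simp add: prob_space)
    also have "(\<integral>\<omega>. (\<Sum>g\<in>G. defect_density (act g p) \<omega>) \<partial>\<mu>) = real (card G) * (\<integral>\<omega>. defect_density p \<omega> \<partial>\<mu>)"
      by (simp add: Bochner_Integration.integral_sum defect_density_integrable defect_density_integral_act)
    finally show "(\<integral>\<omega>. defect_density p \<omega> \<partial>\<mu>) \<le> 0 + \<epsilon>"
      using G(1,2) by (simp add: mult.commute card_gt_0_iff)
  qed
  then have "(\<integral>\<omega>. defect_density p \<omega> \<partial>\<mu>) \<le> 0" by (rule field_le_epsilon)
  moreover have "0 \<le> (\<integral>\<omega>. defect_density p \<omega> \<partial>\<mu>)" by (intro integral_nonneg_AE AE_I2 defect_density_nonneg)
  ultimately show ?thesis by simp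
qed

text \<open>Countably many base points suffice: every point of a configuration is within 1/2 of some
  \<open>d n\<close> and then enters \<open>defect_density (d n)\<close> with positive
  weight.\<close>

lemma AE_eigenspace: "AE \<omega> in M. \<omega> \<in> \<Omega>\<^sub>0 \<and> eigen_sp \<omega> = comp_sp \<omega>"
proof -
  obtain d :: "nat \<Rightarrow> 'x" where d: "\<forall>x. \<forall>e>0. \<exists>n. dist (d n) x < e"
    by (rule dense_sequence)
  have "AE \<omega> in \<mu>. defect_density p \<omega> = 0" for p
    using defect_density_integral_0[of p] defect_density_integrable[of p] defect_density_nonneg
    by (subst (asm) integral_nonneg_eq_0_iff_AE) auto
  then have "AE \<omega> in \<mu>. \<forall>n. defect_density (d n) \<omega> = 0" by (simp add: AE_all_countable)
  then have "AE \<omega> in M. \<forall>n. defect_density (d n) \<omega> = 0"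
    using support_sets by (auto simp: AE_restrict_space_iff sets.Int_space_eq2)
  with good_AE show ?thesis
  proof eventually_elim
    case (elim \<omega>)
    interpret hermitian_hopping \<iota> \<omega> C R lam using good[OF elim(1)] .
    have "ell2_proj A defect (delta x) x = 0" if x: "x \<in> A" for x
    proof -
      obtain n where n: "dist (d n) x < 1 / 2" using d[rule_format, of "1 / 2" x] by auto
      have "A \<inter> ball (d n) (1 / 2) = {x}" using sep x n by (rule separated_ball)
      then have "(1 / 2 - dist (d n) x)\<^sup>2 * diag \<omega> x = 0"
        using defect_density_eq[OF elim(1), of "d n"] elim(2) by simp
      then have "diag \<omega> x = 0" using n by simp
      then show ?thesis using delta_proj_diag[OF defect_has_proj x] by (simp add: diag_def)
    qed
    then show ?case using eigenspace_eq_comp_space elim(1) by simp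
  qed
qed

section \<open>The spectral projections\<close>

lemma spectral_projection_fibre:
  assumes \<omega>: "\<omega> \<in> \<Omega>\<^sub>0" and eq: "eigen_sp \<omega> = comp_sp \<omega>"
    and E: "spectral_family (ell2 (fst \<omega>)) (ell2_inner (fst \<omega>)) (hamiltonian \<iota> \<omega>) E"
    and v: "v \<in> ell2 (fst \<omega>)"
  shows "E {lam} v = P_comp \<iota> lam \<omega> v"
proof -
  interpret hermitian_hopping \<iota> \<omega> C R lam using good[OF \<omega>] .
  interpret spectral_form "ell2 A" "\<lambda>a u b v x. a * u x + b * v x" "ell2_inner A" H E
    by unfold_locales (use E in \<open>auto simp: selfadjoint_on_def H_ell2 H_sym\<close>)
  define w where "w = E {lam} v"
  have w: "w \<in> ell2 A" using v by (simp add: w_def E_in)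
  have "H w = (\<lambda>x. of_real lam * w x)"
  proof (rule ell2_eqI)
    show "ell2_inner A u (H w) = ell2_inner A u (\<lambda>x. of_real lam * w x)" if "u \<in> ell2 A" for u
      using E_singleton_eigen[OF v that] w that by (simp add: w_def ell2_inner_scale_right)
  qed (use w in \<open>auto intro: H_ell2\<close>)
  then have "w \<in> eigenspace" using w by (simp add: eigenspace_iff)
  moreover have "ell2_inner A u (\<lambda>x. v x - w x) = 0" if u: "u \<in> eigenspace" for u
  proof -
    have u2: "u \<in> ell2 A" "H u = (\<lambda>x. of_real lam * u x)" using u by (auto simp: eigenspace_iff)
    show ?thesis
      using E_singleton_orthogonal[OF v u2(1), of lam] u2 by (simp add: ell2_inner_scale_right w_def)
  qed
  ultimately have "ell2_proj A eigenspace v = w"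
    using v by (intro ell2_projI) (auto simp: eigenspace_iff)
  then show ?thesis using eq by (simp add: P_comp_def w_def)
qed

text \<open>\<open>E\<close> is not assumed to act fibrewise, so \<open>g = E {lam} f\<close> is
  recognized indirectly. Its residual \<open>r\<close> is null, hence almost every
  \<open>g \<omega>\<close> is an eigenvector. The fibrewise eigenprojection \<open>Pd\<close> of
  \<open>d = f - g\<close> is a section in the kernel of \<open>T - lam\<close>, hence orthogonal to
  \<open>d\<close>, hence null. Both facts together identify \<open>g \<omega>\<close> as the
  projection of \<open>f \<omega>\<close>.\<close>

lemma spectral_projection_integral:
  assumes E: "spectral_family (sections \<mu>) (sections_inner \<mu>) T E" and f: "f \<in> sections \<mu>"
  shows "AE \<omega> in M. E {lam} f \<omega> = direct_integral_op \<mu> (P_comp \<iota> lam) f \<omega>"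
proof -
  interpret spectral_form "sections \<mu>" lin_section "sections_inner \<mu>" T E
    by unfold_locales (use E selfadj in auto)
  define g where "g = E {lam} f"
  define d where "d = lin_section 1 f (- 1) g"
  define Pd where "Pd = on_good (\<lambda>\<omega>. ell2_proj (fst \<omega>) (eigen_sp \<omega>)) d"
  have g: "g \<in> sections \<mu>" using f by (simp add: g_def E_in)
  have d: "d \<in> sections \<mu>" unfolding d_def using f g by (rule section_lin)
  have Pd: "Pd \<in> sections \<mu>" unfolding Pd_def using d by (rule eigen_section)
  define r where "r = lin_section 1 (T g) (- of_real lam) g"
  have r: "r \<in> sections \<mu>" unfolding r_def using T_section[OF g] g by (rule section_lin)
  \<comment> \<open>Testing the weak eigenvalue equation against the residual itself turns it into
    an equation in almost every fibre.\<close>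
  have "sections_inner \<mu> r r = 1 * sections_inner \<mu> r (T g) + - of_real lam * sections_inner \<mu> r g"
    using sec.ip_lin[OF r T_section[OF g] g, of 1 "- of_real lam", folded r_def] .
  then have "sections_inner \<mu> r r = 0" using E_singleton_eigen[OF f r, of lam, folded g_def] by simp
  then have r0: "AE \<omega> in M. r \<omega> = (\<lambda>_. 0)" using r by (intro section_null) auto
  have Pd_eig: "T Pd \<omega> = (\<lambda>x. of_real lam * Pd \<omega> x)" if \<omega>: "\<omega> \<in> \<Omega>\<^sub>0" for \<omega>
  proof -
    interpret hermitian_hopping \<iota> \<omega> C R lam using good[OF \<omega>] .
    have "Pd \<omega> \<in> eigenspace"
      using ell2_proj(1)[OF eigenspace_has_proj section_in[OF d good_support[OF \<omega>]]] \<omega> by (simp add: Pd_def on_good_def)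
    then show ?thesis using good_support[OF \<omega>] by (simp add: eigenspace_iff T_apply)
  qed
  have "sections_inner \<mu> x (T Pd) = of_real lam * sections_inner \<mu> x Pd" if x: "x \<in> sections \<mu>" for x
  proof -
    have "sections_inner \<mu> x (T Pd) = (\<integral>\<omega>. of_real lam * ell2_inner (fst \<omega>) (x \<omega>) (Pd \<omega>) \<partial>M)"
      unfolding sections_inner_def
    proof (rule integral_cong_AE)
      show "(\<lambda>\<omega>. ell2_inner (fst \<omega>) (x \<omega>) (T Pd \<omega>)) \<in> borel_measurable M"
        using x Pd T_section by (intro inner_measurable section_weak) auto
      show "(\<lambda>\<omega>. of_real lam * ell2_inner (fst \<omega>) (x \<omega>) (Pd \<omega>)) \<in> borel_measurable M"
        using x Pd by (intro borel_measurable_times inner_measurable section_weak) auto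
      show "AE \<omega> in M. ell2_inner (fst \<omega>) (x \<omega>) (T Pd \<omega>) = of_real lam * ell2_inner (fst \<omega>) (x \<omega>) (Pd \<omega>)"
        using good_AE
      proof eventually_elim
        case (elim \<omega>)
        then show ?case
          using Pd_eig ell2_inner_scale_right[OF section_in[OF x] section_in[OF Pd]] good_support by simp
      qed
    qed
    then show ?thesis by (simp add: sections_inner_def)
  qed
  then have "sections_inner \<mu> Pd d = 0"
    using E_singleton_orthogonal[OF f Pd, of lam] by (simp add: d_def g_def)
  then have int: "(\<integral>\<omega>. ell2_inner (fst \<omega>) (Pd \<omega>) (d \<omega>) \<partial>M) = 0" by (simp add: sections_inner_def)
  have Pdd: "ell2_inner (fst \<omega>) (Pd \<omega>) (d \<omega>) = ell2_inner (fst \<omega>) (Pd \<omega>) (Pd \<omega>)" if \<omega>: "\<omega> \<in> \<Omega>\<^sub>0" for \<omega>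
  proof -
    interpret hermitian_hopping \<iota> \<omega> C R lam using good[OF \<omega>] .
    have d\<omega>: "d \<omega> \<in> ell2 A" using section_in[OF d good_support[OF \<omega>]] .
    show ?thesis
      using ell2_inner_proj[OF eigenspace_has_proj d\<omega> ell2_proj(1)[OF eigenspace_has_proj d\<omega>]] \<omega>
      by (simp add: Pd_def on_good_def)
  qed
  have "sections_inner \<mu> Pd Pd = (\<integral>\<omega>. ell2_inner (fst \<omega>) (Pd \<omega>) (d \<omega>) \<partial>M)"
    unfolding sections_inner_def
  proof (rule integral_cong_AE)
    show "AE \<omega> in M. ell2_inner (fst \<omega>) (Pd \<omega>) (Pd \<omega>) = ell2_inner (fst \<omega>) (Pd \<omega>) (d \<omega>)"
      using good_AE by eventually_elim (simp add: Pdd)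
  qed (use Pd d in \<open>auto intro: inner_measurable section_weak\<close>)
  then have "AE \<omega> in M. Pd \<omega> = (\<lambda>_. 0)" using int by (intro section_null[OF Pd]) simp
  with r0 AE_eigenspace show ?thesis
  proof eventually_elim
    case (elim \<omega>)
    then have \<omega>: "\<omega> \<in> \<Omega>\<^sub>0" by simp
    interpret hermitian_hopping \<iota> \<omega> C R lam using good[OF \<omega>] .
    have g\<omega>: "g \<omega> \<in> ell2 A" and f\<omega>: "f \<omega> \<in> ell2 A" and d\<omega>: "d \<omega> \<in> ell2 A"
      using section_in[OF g] section_in[OF f] section_in[OF d] good_support[OF \<omega>] by auto
    have "g \<omega> \<in> eigenspace"
      using elim(1) g\<omega> by (simp add: eigenspace_iff r_def T_apply good_support[OF \<omega>] fun_eq_iff)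
    moreover have "ell2_inner A u (\<lambda>x. f \<omega> x - g \<omega> x) = 0" if u: "u \<in> eigenspace" for u
    proof -
      have "ell2_inner A u (d \<omega>) = ell2_inner A u (Pd \<omega>)"
        using ell2_inner_proj[OF eigenspace_has_proj d\<omega> u] \<omega> by (simp add: Pd_def on_good_def)
      also have "\<dots> = 0" using elim(3) by (simp add: ell2_inner_def)
      finally show ?thesis by (simp add: d_def)
    qed
    ultimately have "ell2_proj A eigenspace (f \<omega>) = g \<omega>"
      using f\<omega> by (intro ell2_projI) (auto simp: eigenspace_iff)
    then show ?case
      using elim(2) good_support[OF \<omega>] by (simp add: direct_integral_op_def P_comp_def g_def)
  qed
qed

end

theorem theorem2p2:
  fixes act :: "'g::{topological_group_add,metric_space} \<Rightarrow>
                'x::{metric_space,second_countable_topology} \<Rightarrow> 'x"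
    and haar :: "'g measure"
    and F' :: "'x set"
    and a b :: real
    and \<iota> :: "complex \<Rightarrow> 'c::t2_space"
    and \<mu> :: "('x, 'c) conf measure"
    and s :: "'g \<Rightarrow> 'x \<Rightarrow> complex"
    and lam :: real
  assumes "locally_compact_space (euclidean :: 'x topology)"
    and "locally_compact_space (euclidean :: 'g topology)"
    and "\<forall>g h k :: 'g. dist (g + h) (g + k) = dist h k"
    and "\<forall>(g :: 'g) r. compact (closure (ball g r))"
    and "haar_measure haar"
    and "unimodular haar"
    and "amenable haar"
    and "continuous_isometric_action act"
    and "fundamental_domain act F'"
    and "rough_isometry a b (group_coordinate act F')"
    and "compactification \<iota>"
    and "prob_space \<mu>"
    and "regular_borel_measure vague_topology \<mu>"
    and "\<forall>g. distr \<mu> \<mu> (act_conf act g) = \<mu>"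
    and "\<not> supp_conf \<mu> \<subseteq> {({}, \<lambda>_. undefined)}"
    and "condition_A act s \<iota> \<mu>"
  shows "(\<forall>E. spectral_family (sections \<mu>) (sections_inner \<mu>)
                (direct_integral_op \<mu> (hamiltonian \<iota>)) E \<longrightarrow>
            (\<forall>f\<in>sections \<mu>. AE \<omega> in restrict_space \<mu> (supp_conf \<mu>).
               E {lam} f \<omega> = direct_integral_op \<mu> (P_comp \<iota> lam) f \<omega>)) \<and>
         (AE \<omega> in restrict_space \<mu> (supp_conf \<mu>).
            \<forall>E. spectral_family (ell2 (fst \<omega>)) (ell2_inner (fst \<omega>)) (hamiltonian \<iota> \<omega>) E \<longrightarrow>
              (\<forall>v\<in>ell2 (fst \<omega>). E {lam} v = P_comp \<iota> lam \<omega> v))"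
proof -
  note A = \<open>condition_A act s \<iota> \<mu>\<close>[unfolded condition_A_def]
  obtain C where C: "\<forall>\<omega>\<in>supp_conf \<mu>. \<forall>v. finite {x. v x \<noteq> 0} \<and> {x. v x \<noteq> 0} \<subseteq> fst \<omega> \<longrightarrow>
      hamiltonian \<iota> \<omega> v \<in> ell2 (fst \<omega>) \<and>
      ell2_norm (fst \<omega>) (hamiltonian \<iota> \<omega> v) \<le> C * ell2_norm (fst \<omega>) v"
    using A by blast
  obtain R where R: "\<forall>\<omega>\<in>supp_conf \<mu>. \<forall>x\<in>fst \<omega>. \<forall>y\<in>fst \<omega>. dist x y \<ge> R \<longrightarrow> matrix_element \<iota> \<omega> x y = 0"
    using A by blast
  interpret amenable_action act haar F' a b
    by unfold_locales fact+
  \<comment> \<open>The constants in condition (A) come without a sign. Enlarging them preserves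
    both bounds and gives the sign conditions of the locale.\<close>
  interpret random_operator act haar F' a b \<iota> \<mu> "max C 0" "max R 1"
  proof (rule random_operator.intro, rule amenable_action_axioms, rule random_operator_axioms.intro)
    show "compact (UNIV :: 'c set)"
      using \<open>compactification \<iota>\<close> by (simp add: compactification_def)
    show "prob_space \<mu>" "regular_borel_measure vague_topology \<mu>" "\<forall>g. distr \<mu> \<mu> (act_conf act g) = \<mu>" by fact+
    show "selfadjoint_on (sections \<mu>) (sections_inner \<mu>) (direct_integral_op \<mu> (hamiltonian \<iota>))"
      using A by blast
    fix \<omega> assume \<omega>: "\<omega> \<in> supp_conf \<mu>"
    show "hamiltonian \<iota> \<omega> v \<in> ell2 (fst \<omega>) \<and>
        ell2_norm (fst \<omega>) (hamiltonian \<iota> \<omega> v) \<le> max C 0 * ell2_norm (fst \<omega>) v"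
      if "finite {x. v x \<noteq> 0}" "{x. v x \<noteq> 0} \<subseteq> fst \<omega>" for v
    proof -
      have "C * ell2_norm (fst \<omega>) v \<le> max C 0 * ell2_norm (fst \<omega>) v" by (intro mult_right_mono) auto
      then show ?thesis using C[rule_format, OF \<omega>, of v] that by force
    qed
    show "matrix_element \<iota> \<omega> x y = 0" if "x \<in> fst \<omega>" "y \<in> fst \<omega>" "max R 1 \<le> dist x y" for x y
      using R \<omega> that by simp
  qed auto
  \<comment> \<open>A measurable null set that covers the exceptional configurations; removing it
    leaves the measurable domain on which the fibres are analysed.\<close>
  obtain N where N: "N \<in> sets M" "emeasure M N = 0" "{\<omega> \<in> space M. \<not> hermitian_hopping \<iota> \<omega> (max C 0) (max R 1)} \<subseteq> N"
    using AE_hermitian by (rule AE_E)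
  interpret random_hermitian act haar F' a b \<iota> \<mu> "max C 0" "max R 1" "space M - N" lam
  proof (rule random_hermitian.intro, rule random_operator_axioms, rule random_hermitian_axioms.intro)
    show "space M - N \<in> sets M" using N(1) by (rule sets.compl_sets)
    have "N \<in> null_sets M" using N by auto
    then show "AE \<omega> in M. \<omega> \<in> space M - N" by (rule AE_I') auto
    show "hermitian_hopping \<iota> \<omega> (max C 0) (max R 1)" if "\<omega> \<in> space M - N" for \<omega>
      using N(3) that by blast
  qed
  have "AE \<omega> in M. \<forall>E. spectral_family (ell2 (fst \<omega>)) (ell2_inner (fst \<omega>)) (hamiltonian \<iota> \<omega>) E \<longrightarrow>
      (\<forall>v\<in>ell2 (fst \<omega>). E {lam} v = P_comp \<iota> lam \<omega> v)"
    using AE_eigenspace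
  proof eventually_elim
    case (elim \<omega>)
    then show ?case using spectral_projection_fibre by blast
  qed
  then show ?thesis using spectral_projection_integral by blast
qed

end
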